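(* Let $\dot x=f(x,u)$ be a flat system with $n$-dimensional state $x$ and $m$-dimensional input $u$, let $y=\varphi(x,u,u_{[1]},\dots,u_{[q]})$ be a flat output, and let $R=(r^1,\dots,r^m)$ be the associated minimal multi-index. Let $A=(a^1,\dots,a^m)$ be a multi-index with $A\le R$ (componentwise) such that the differentials $\mathrm{d}x,\mathrm{d}\varphi_{[A]},\mathrm{d}\varphi_{[A+1]},\dots,\mathrm{d}\varphi_{[R-1]}$ (that is, $\mathrm{d}x^1,\dots,\mathrm{d}x^n$ together with $\mathrm{d}\varphi^j_{[\beta]}$ for $j=1,\dots,m$ and $a^j\le\beta\le r^j-1$) are linearly independent. Then there exists an endogenous feedback of the form $$\dot z=g(x,z,v,v_{[1]},\dots),\qquad u=\alpha(x,z,v,v_{[1]},\dots)$$ with $\dim(z)=|A|-n$ such that the closed-loop system has the input-output behavior $y_{[A]}=v$. In the case $|A|=n$, $z$ is empty and the feedback reduces to $u=\alpha(x,v,v_{[1]},\dots)$, i.e., a quasi-static feedback of the state $x$.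
   Context: Setting. $\mathcal X$ is an $n$-dimensional smooth manifold with local coordinates $x=(x^1,\dots,x^n)$, and $\dot x=f(x,u)$ is a smooth control system with $m$ inputs $u=(u^1,\dots,u^m)$. On the manifold $\mathcal X\times\mathcal U_{[0,l_u]}$ with coordinates $(x,u,u_{[1]},\dots,u_{[l_u]})$, where $u_{[\alpha]}$ denotes the $\alpha$-th time derivative of $u$ and $l_u$ is a sufficiently large finite integer, consider the vector field $$f_u=\sum_{i=1}^n f^i(x,u)\,\partial_{x^i}+\sum_{j=1}^m\sum_{\alpha=0}^{l_u-1}u^j_{[\alpha+1]}\,\partial_{u^j_{[\alpha]}}.$$ The Lie derivative $\mathrm L_{f_u}h$ is the time derivative of a function $h$ along trajectories ($l_u$ is chosen so large that this is correct for all functions considered), and $h_{[\alpha]}$ denotes the $\alpha$-th time derivative of $h$. All results are generically local (they hold locally on open dense subsets), and all Jacobian matrices and codistributions considered are assumed to have locally constant rank. Linear independence of differentials is over smooth functions. Multi-index notation. A multi-index $A=(a^1,\dots,a^m)$ consists of nonnegative integers; $|A|=\sum_j a^j$; $A\pm c=(a^1\pm c,\dots,a^m\pm c)$ for an integer $c$; $A\le B$ is meant componentwise; $h_{[A]}=(h^1_{[a^1]},\dots,h^m_{[a^m]})$; $h_{[A,B]}$ is the collection of all $h^j_{[\beta]}$ with $a^j\le\beta\le b^j$ (empty for those $j$ with $a^j>b^j$); $h_{[0,B]}$ is the collection of all $h^j_{[\beta]}$ with $0\le\beta\le b^j$. Flatness. The system is flat if there exist an $m$-tuple of smooth functions $y^j=\varphi^j(x,u,u_{[1]},\dots,u_{[q]})$,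 $j=1,\dots,m$, on $\mathcal X\times\mathcal U_{[0,l_u]}$ and smooth functions $F_x,F_u$ such that locally $x=F_x(\varphi_{[0,R-1]})$ and $u=F_u(\varphi_{[0,R]})$ for some multi-index $R=(r^1,\dots,r^m)$, where $\varphi_{[\alpha]}=\mathrm L_{f_u}^\alpha\varphi$. The $m$-tuple is called a flat output. There is a unique minimal such multi-index, and $R$ always denotes this minimal one. Endogenous feedback. A feedback $\dot z=g(x,z,v,v_{[1]},\dots)$, $u=\alpha(x,z,v,v_{[1]},\dots)$ (depending on finitely many time derivatives of the new $m$-dimensional input $v$) is endogenous if its state $z$ and the new input $v$ can be expressed as functions of $x$, $u$ and time derivatives of $u$. Quasi-static feedback of the state $x$. Given an invertible transformation of the form $u=\alpha(x,v,v_{[1]},\dots)$, $u_{[k]}=\alpha_k(x,v,v_{[1]},\dots)$, with inverse $v=\hat\alpha(x,u,u_{[1]},\dots)$, $v_{[k]}=\hat\alpha_k(x,u,u_{[1]},\dots)$, $k\ge1$, such that the differentials $\mathrm{d}x,\mathrm{d}v,\mathrm{d}v_{[1]},\dots$ are linearly independent, $u=\alpha(x,v,v_{[1]},\dots)$ is called a quasi-static feedback of the state $x$. The closed-loop system is $\dot x=f(x,\alpha(x,z,v,v_{[1]},\dots))$, $\dot z=g(x,z,v,v_{[1]},\dots)$; it has the input-output behavior $y_{[A]}=v$ if, with $y$ and its time derivatives evaluated along trajectories of the closed-loop system, the $a^j$-th time derivative of $y^j$ equals $v^j$ for $j=1,\dots,m$. *)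

theory Defs
  imports "HOL-Analysis.Analysis"
begin

section \<open>Smooth functions of finitely many coordinates\<close>

text \<open>
  A point is a function assigning a real value to every coordinate of an index type \<open>'c\<close>, which
  may be infinite: an input has infinitely many time derivatives. Instead of a finite but
  sufficiently large number of derivatives we use all of them, and every smooth function
  depends on finitely many coordinates only. Openness and continuity refer to the product topology,
  for which a neighbourhood of a point constrains finitely many coordinates.
\<close>

definition pd :: "'c \<Rightarrow> (('c \<Rightarrow> real) \<Rightarrow> real) \<Rightarrow> ('c \<Rightarrow> real) \<Rightarrow> real" where
  "pd c h p = deriv (\<lambda>t. h (p(c := t))) (p c)"

fun Ck_on :: "nat \<Rightarrow> ('c \<Rightarrow> real) set \<Rightarrow> (('c \<Rightarrow> real) \<Rightarrow> real) \<Rightarrow> bool" where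
  "Ck_on 0 S h \<longleftrightarrow> continuous_on S h"
| "Ck_on (Suc k) S h \<longleftrightarrow>
     continuous_on S h \<and>
     (\<forall>c. \<forall>p\<in>S. (\<lambda>t. h (p(c := t))) differentiable (at (p c))) \<and>
     (\<forall>c. Ck_on k S (pd c h))"

definition depends_on :: "'c set \<Rightarrow> ('c \<Rightarrow> real) set \<Rightarrow> (('c \<Rightarrow> real) \<Rightarrow> real) \<Rightarrow> bool" where
  "depends_on C S h \<longleftrightarrow> (\<forall>p\<in>S. \<forall>q\<in>S. (\<forall>c\<in>C. p c = q c) \<longrightarrow> h p = h q)"

text \<open>\<open>smooth_on I S h\<close>: on the open set \<open>S\<close>, \<open>h\<close> is a smooth function of finitely many of the
  coordinates in \<open>I\<close>.\<close>

definition smooth_on :: "'c set \<Rightarrow> ('c \<Rightarrow> real) set \<Rightarrow> (('c \<Rightarrow> real) \<Rightarrow> real) \<Rightarrow> bool" where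
  "smooth_on I S h \<longleftrightarrow>
     (\<exists>C. finite C \<and> C \<subseteq> I \<and> depends_on C S h) \<and> (\<forall>k. Ck_on k S h)"

text \<open>The differential of \<open>h\<close> at \<open>p\<close> is the covector \<open>\<lambda>\<xi>. pd \<xi> h p\<close>. Independence of a family of
  differentials is over the smooth functions on \<open>D\<close>; a possibly infinite family is independent if
  every finite subfamily is.\<close>

definition diff_independent ::
    "('c \<Rightarrow> real) set \<Rightarrow> ('k \<Rightarrow> ('c \<Rightarrow> real) \<Rightarrow> real) \<Rightarrow> 'k set \<Rightarrow> bool" where
  "diff_independent D h K \<longleftrightarrow>
     (\<forall>F a. finite F \<and> F \<subseteq> K \<and> (\<forall>k\<in>F. smooth_on UNIV D (a k)) \<and>
            (\<forall>p\<in>D. \<forall>\<xi>. (\<Sum>k\<in>F. a k p * pd \<xi> (h k) p) = 0)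
        \<longrightarrow> (\<forall>k\<in>F. \<forall>p\<in>D. a k p = 0))"

text \<open>Rank at \<open>p\<close> of the codistribution spanned by a finite family of differentials, i.e. of the
  Jacobian matrix of the family: the largest number of rows that are linearly independent over
  the reals.\<close>

definition diff_rank :: "('k \<Rightarrow> ('c \<Rightarrow> real) \<Rightarrow> real) \<Rightarrow> 'k set \<Rightarrow> ('c \<Rightarrow> real) \<Rightarrow> nat" where
  "diff_rank h K p =
     Max (card ` {F. F \<subseteq> K \<and>
       (\<forall>a :: 'k \<Rightarrow> real. (\<forall>\<xi>. (\<Sum>k\<in>F. a k * pd \<xi> (h k) p) = 0) \<longrightarrow> (\<forall>k\<in>F. a k = 0))})"

definition locally_constant_rank ::
    "('c \<Rightarrow> real) set \<Rightarrow> ('k \<Rightarrow> ('c \<Rightarrow> real) \<Rightarrow> real) \<Rightarrow> 'k set \<Rightarrow> bool" where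
  "locally_constant_rank D h K \<longleftrightarrow>
     (\<forall>p\<in>D. \<exists>W. open W \<and> p \<in> W \<and> W \<subseteq> D \<and> (\<forall>q\<in>W. diff_rank h K q = diff_rank h K p))"

section \<open>Vector fields, Lie derivatives, trajectories\<close>

text \<open>A vector field is given by its components \<open>b c\<close>. At points where \<open>h\<close> is smooth only finitely
  many of its partial derivatives are nonzero, so the sum is the full sum over all coordinates.\<close>

definition lie ::
    "('c \<Rightarrow> ('c \<Rightarrow> real) \<Rightarrow> real) \<Rightarrow> (('c \<Rightarrow> real) \<Rightarrow> real) \<Rightarrow> ('c \<Rightarrow> real) \<Rightarrow> real" where
  "lie b h p = (\<Sum>c | pd c h p \<noteq> 0. b c p * pd c h p)"

abbreviation tder ::
    "('c \<Rightarrow> ('c \<Rightarrow> real) \<Rightarrow> real) \<Rightarrow> nat \<Rightarrow> (('c \<Rightarrow> real) \<Rightarrow> real) \<Rightarrow> ('c \<Rightarrow> real) \<Rightarrow> real" where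
  "tder b k h \<equiv> (lie b ^^ k) h"

definition integral_curve ::
    "('c \<Rightarrow> ('c \<Rightarrow> real) \<Rightarrow> real) \<Rightarrow> ('c \<Rightarrow> real) set \<Rightarrow> real \<Rightarrow> real \<Rightarrow> (real \<Rightarrow> 'c \<Rightarrow> real) \<Rightarrow> bool"
  where
  "integral_curve b W t0 t1 \<gamma> \<longleftrightarrow>
     (\<forall>t\<in>{t0<..<t1}. \<gamma> t \<in> W \<and>
        (\<forall>c. ((\<lambda>\<tau>. \<gamma> \<tau> c) has_real_derivative b c (\<gamma> t)) (at t)))"

section \<open>Control systems and flat outputs\<close>

text \<open>\<open>St i\<close> is the \<open>i\<close>-th state coordinate, \<open>In j k\<close> the \<open>k\<close>-th time derivative of the \<open>j\<close>-th
  input. The state manifold is represented by a coordinate chart.\<close>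

datatype ('s, 'm) coord = St 's | In 'm nat

type_synonym ('s, 'm) jet = "('s, 'm) coord \<Rightarrow> real"

definition state_of :: "('n::finite, 'm) jet \<Rightarrow> real ^ 'n" where
  "state_of p = (\<chi> i. p (St i))"

definition input_of :: "('s, 'm::finite) jet \<Rightarrow> real ^ 'm" where
  "input_of p = (\<chi> j. p (In j 0))"

definition smooth_system ::
    "(real ^ 'n::finite \<Rightarrow> real ^ 'm::finite \<Rightarrow> real ^ 'n) \<Rightarrow> ('n, 'm) jet set \<Rightarrow> bool" where
  "smooth_system f D \<longleftrightarrow> (\<forall>i. smooth_on UNIV D (\<lambda>p. f (state_of p) (input_of p) $ i))"

text \<open>The vector field \<open>f\<^sub>u\<close>.\<close>

fun field_u ::
    "(real ^ 'n::finite \<Rightarrow> real ^ 'm::finite \<Rightarrow> real ^ 'n) \<Rightarrow>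
     ('n, 'm) coord \<Rightarrow> ('n, 'm) jet \<Rightarrow> real" where
  "field_u f (St i) p = f (state_of p) (input_of p) $ i"
| "field_u f (In j k) p = p (In j (Suc k))"

text \<open>All time derivatives of the components of \<open>\<phi>\<close>: the entry \<open>(j, \<beta>)\<close> is
  \<open>\<phi>\<^sup>j\<^sub>[\<^sub>\<beta>\<^sub>]\<close>.\<close>

definition output_jet ::
    "(real ^ 'n::finite \<Rightarrow> real ^ 'm::finite \<Rightarrow> real ^ 'n) \<Rightarrow> ('m \<Rightarrow> ('n, 'm) jet \<Rightarrow> real) \<Rightarrow>
     ('n, 'm) jet \<Rightarrow> 'm \<times> nat \<Rightarrow> real" where
  "output_jet f \<phi> p = (\<lambda>(j, \<beta>). tder (field_u f) \<beta> (\<phi> j) p)"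

definition flat_parametrization ::
    "(real ^ 'n::finite \<Rightarrow> real ^ 'm::finite \<Rightarrow> real ^ 'n) \<Rightarrow> ('n, 'm) jet set \<Rightarrow>
     ('m \<Rightarrow> ('n, 'm) jet \<Rightarrow> real) \<Rightarrow> ('m \<Rightarrow> nat) \<Rightarrow> bool" where
  "flat_parametrization f D \<phi> R \<longleftrightarrow>
     (\<forall>p\<in>D. \<exists>W V Fx Fu.
        open W \<and> p \<in> W \<and> W \<subseteq> D \<and> open V \<and> output_jet f \<phi> ` W \<subseteq> V \<and>
        (\<forall>i. smooth_on {(j, \<beta>). \<beta> < R j} V (Fx i)) \<and>
        (\<forall>j. smooth_on {(j, \<beta>). \<beta> \<le> R j} V (Fu j)) \<and>
        (\<forall>q\<in>W. (\<forall>i. q (St i) = Fx i (output_jet f \<phi> q)) \<and>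
               (\<forall>j. q (In j 0) = Fu j (output_jet f \<phi> q))))"

definition flat_output ::
    "(real ^ 'n::finite \<Rightarrow> real ^ 'm::finite \<Rightarrow> real ^ 'n) \<Rightarrow> ('n, 'm) jet set \<Rightarrow>
     ('m \<Rightarrow> ('n, 'm) jet \<Rightarrow> real) \<Rightarrow> bool" where
  "flat_output f D \<phi> \<longleftrightarrow>
     (\<exists>q. \<forall>j. smooth_on (range St \<union> {In l k | l k. k \<le> q}) D (\<phi> j)) \<and>
     (\<exists>R. flat_parametrization f D \<phi> R)"

definition minimal_index ::
    "(real ^ 'n::finite \<Rightarrow> real ^ 'm::finite \<Rightarrow> real ^ 'n) \<Rightarrow> ('n, 'm) jet set \<Rightarrow>
     ('m \<Rightarrow> ('n, 'm) jet \<Rightarrow> real) \<Rightarrow> ('m \<Rightarrow> nat) \<Rightarrow> bool" where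
  "minimal_index f D \<phi> R \<longleftrightarrow>
     flat_parametrization f D \<phi> R \<and>
     (\<forall>R'. flat_parametrization f D \<phi> R' \<and> R' \<le> R \<longrightarrow> R' = R)"

text \<open>The functions \<open>x\<^sup>i\<close> and \<open>\<phi>\<^sup>j\<^sub>[\<^sub>\<beta>\<^sub>]\<close>, and the index set selecting all \<open>x\<^sup>i\<close> together
  with the \<open>\<phi>\<^sup>j\<^sub>[\<^sub>\<beta>\<^sub>]\<close> for \<open>A j \<le> \<beta> \<le> R j - 1\<close>.\<close>

fun state_output ::
    "(real ^ 'n::finite \<Rightarrow> real ^ 'm::finite \<Rightarrow> real ^ 'n) \<Rightarrow> ('m \<Rightarrow> ('n, 'm) jet \<Rightarrow> real) \<Rightarrow>
     'n + 'm \<times> nat \<Rightarrow> ('n, 'm) jet \<Rightarrow> real" where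
  "state_output f \<phi> (Inl i) p = p (St i)"
| "state_output f \<phi> (Inr (j, \<beta>)) p = tder (field_u f) \<beta> (\<phi> j) p"

definition state_output_indices :: "('m \<Rightarrow> nat) \<Rightarrow> ('m \<Rightarrow> nat) \<Rightarrow> ('n + 'm \<times> nat) set" where
  "state_output_indices A R = range Inl \<union> Inr ` {(j, \<beta>). A j \<le> \<beta> \<and> \<beta> < R j}"

section \<open>Dynamic feedback\<close>

text \<open>
  The closed loop has the state \<open>(x, z)\<close> and the input \<open>v\<close>. Its coordinates are \<open>St (Inl i)\<close> for
  \<open>x\<^sup>i\<close>, \<open>St (Inr k)\<close> for \<open>z\<^sup>k\<close>, and \<open>In j k\<close> for the derivatives of \<open>v\<close>. As the dimension \<open>d\<close> of
  \<open>z\<close> is a number and not a type, \<open>z\<close> is indexed by \<open>{..<d}\<close>; the coordinates \<open>St (Inr k)\<close> with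
  \<open>k \<ge> d\<close> are without significance and nothing may depend on them.
\<close>

definition cl_coords :: "nat \<Rightarrow> ('n + nat, 'm) coord set" where
  "cl_coords d = range (\<lambda>i. St (Inl i)) \<union> (\<lambda>k. St (Inr k)) ` {..<d} \<union> {In j k | j k. True}"

definition feedback_on ::
    "nat \<Rightarrow> ('n + nat, 'm) jet set \<Rightarrow> (nat \<Rightarrow> ('n + nat, 'm) jet \<Rightarrow> real) \<Rightarrow>
     ('m \<Rightarrow> ('n + nat, 'm) jet \<Rightarrow> real) \<Rightarrow> bool" where
  "feedback_on d W g \<alpha> \<longleftrightarrow>
     open W \<and> (\<forall>w\<in>W. \<forall>w'. (\<forall>c\<in>cl_coords d. w' c = w c) \<longrightarrow> w' \<in> W) \<and>
     (\<forall>k<d. smooth_on (cl_coords d) W (g k)) \<and>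
     (\<forall>j. smooth_on (cl_coords d) W (\<alpha> j))"

fun cl_field ::
    "(real ^ 'n::finite \<Rightarrow> real ^ 'm::finite \<Rightarrow> real ^ 'n) \<Rightarrow> nat \<Rightarrow>
     (nat \<Rightarrow> ('n + nat, 'm) jet \<Rightarrow> real) \<Rightarrow> ('m \<Rightarrow> ('n + nat, 'm) jet \<Rightarrow> real) \<Rightarrow>
     ('n + nat, 'm) coord \<Rightarrow> ('n + nat, 'm) jet \<Rightarrow> real" where
  "cl_field f d g \<alpha> (St (Inl i)) w = f (\<chi> l. w (St (Inl l))) (\<chi> j. \<alpha> j w) $ i"
| "cl_field f d g \<alpha> (St (Inr k)) w = (if k < d then g k w else 0)"
| "cl_field f d g \<alpha> (In j k) w = w (In j (Suc k))"

text \<open>The point \<open>(x, u, u\<^sub>[\<^sub>1\<^sub>], \<dots>)\<close> that the feedback produces from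
  \<open>(x, z, v, v\<^sub>[\<^sub>1\<^sub>], \<dots>)\<close>.\<close>

definition cl_jet ::
    "(real ^ 'n::finite \<Rightarrow> real ^ 'm::finite \<Rightarrow> real ^ 'n) \<Rightarrow> nat \<Rightarrow>
     (nat \<Rightarrow> ('n + nat, 'm) jet \<Rightarrow> real) \<Rightarrow> ('m \<Rightarrow> ('n + nat, 'm) jet \<Rightarrow> real) \<Rightarrow>
     ('n + nat, 'm) jet \<Rightarrow> ('n, 'm) jet" where
  "cl_jet f d g \<alpha> w =
     (\<lambda>c. case c of St i \<Rightarrow> w (St (Inl i)) | In j k \<Rightarrow> tder (cl_field f d g \<alpha>) k (\<alpha> j) w)"

definition endogenous_feedback ::
    "(real ^ 'n::finite \<Rightarrow> real ^ 'm::finite \<Rightarrow> real ^ 'n) \<Rightarrow> ('n, 'm) jet set \<Rightarrow> nat \<Rightarrow>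
     ('n + nat, 'm) jet set \<Rightarrow> (nat \<Rightarrow> ('n + nat, 'm) jet \<Rightarrow> real) \<Rightarrow>
     ('m \<Rightarrow> ('n + nat, 'm) jet \<Rightarrow> real) \<Rightarrow> bool" where
  "endogenous_feedback f D d W g \<alpha> \<longleftrightarrow>
     feedback_on d W g \<alpha> \<and>
     (\<exists>N \<zeta> \<nu>. open N \<and> N \<subseteq> D \<and> cl_jet f d g \<alpha> ` W \<subseteq> N \<and>
        (\<forall>k<d. smooth_on UNIV N (\<zeta> k)) \<and> (\<forall>j. smooth_on UNIV N (\<nu> j)) \<and>
        (\<forall>w\<in>W. (\<forall>k<d. w (St (Inr k)) = \<zeta> k (cl_jet f d g \<alpha> w)) \<and>
               (\<forall>j. w (In j 0) = \<nu> j (cl_jet f d g \<alpha> w))))"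

text \<open>Along a trajectory \<open>\<gamma>\<close> of the closed loop, the point \<open>(x, u, u\<^sub>[\<^sub>1\<^sub>], \<dots>)\<close> at time \<open>t\<close>, with
  the derivatives of \<open>u\<close> taken with respect to time.\<close>

definition traj_jet ::
    "('m \<Rightarrow> ('n + nat, 'm) jet \<Rightarrow> real) \<Rightarrow> (real \<Rightarrow> ('n + nat, 'm) jet) \<Rightarrow> real \<Rightarrow>
     ('n, 'm) jet" where
  "traj_jet \<alpha> \<gamma> t =
     (\<lambda>c. case c of St i \<Rightarrow> \<gamma> t (St (Inl i)) | In j k \<Rightarrow> (deriv ^^ k) (\<lambda>\<tau>. \<alpha> j (\<gamma> \<tau>)) t)"

definition io_behavior ::
    "(real ^ 'n::finite \<Rightarrow> real ^ 'm::finite \<Rightarrow> real ^ 'n) \<Rightarrow> ('m \<Rightarrow> ('n, 'm) jet \<Rightarrow> real) \<Rightarrow>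
     ('m \<Rightarrow> nat) \<Rightarrow> nat \<Rightarrow> ('n + nat, 'm) jet set \<Rightarrow>
     (nat \<Rightarrow> ('n + nat, 'm) jet \<Rightarrow> real) \<Rightarrow> ('m \<Rightarrow> ('n + nat, 'm) jet \<Rightarrow> real) \<Rightarrow> bool" where
  "io_behavior f \<phi> A d W g \<alpha> \<longleftrightarrow>
     (\<forall>t0 t1 \<gamma>. integral_curve (cl_field f d g \<alpha>) W t0 t1 \<gamma> \<longrightarrow>
        (\<forall>j. \<forall>t\<in>{t0<..<t1}.
           (deriv ^^ A j) (\<lambda>\<tau>. \<phi> j (traj_jet \<alpha> \<gamma> \<tau>)) t = \<gamma> t (In j 0)))"

section \<open>Quasi-static feedback of the state\<close>

text \<open>Here the points \<open>(x, v, v\<^sub>[\<^sub>1\<^sub>], \<dots>)\<close> have the same coordinates as \<open>(x, u, u\<^sub>[\<^sub>1\<^sub>], \<dots>)\<close>.\<close>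

fun qs_field ::
    "(real ^ 'n::finite \<Rightarrow> real ^ 'm::finite \<Rightarrow> real ^ 'n) \<Rightarrow> ('m \<Rightarrow> ('n, 'm) jet \<Rightarrow> real) \<Rightarrow>
     ('n, 'm) coord \<Rightarrow> ('n, 'm) jet \<Rightarrow> real" where
  "qs_field f \<alpha> (St i) w = f (state_of w) (\<chi> j. \<alpha> j w) $ i"
| "qs_field f \<alpha> (In j k) w = w (In j (Suc k))"

text \<open>The map \<open>(x, v, v\<^sub>[\<^sub>1\<^sub>], \<dots>) \<mapsto> (x, u, u\<^sub>[\<^sub>1\<^sub>], \<dots>)\<close> given by \<open>\<alpha>\<close> and its time derivatives is
  \<open>state_input_map (qs_field f \<alpha>) \<alpha>\<close>; the map in the opposite direction given by
  \<open>v = \<beta>(x, u, u\<^sub>[\<^sub>1\<^sub>], \<dots>)\<close> is \<open>state_input_map (field_u f) \<beta>\<close>.\<close>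

definition state_input_map ::
    "(('n, 'm) coord \<Rightarrow> ('n, 'm) jet \<Rightarrow> real) \<Rightarrow> ('m \<Rightarrow> ('n, 'm) jet \<Rightarrow> real) \<Rightarrow>
     ('n, 'm) jet \<Rightarrow> ('n, 'm) jet" where
  "state_input_map b h p = (\<lambda>c. case c of St i \<Rightarrow> p (St i) | In j k \<Rightarrow> tder b k (h j) p)"

definition quasi_static_feedback ::
    "(real ^ 'n::finite \<Rightarrow> real ^ 'm::finite \<Rightarrow> real ^ 'n) \<Rightarrow> ('n, 'm) jet set \<Rightarrow> ('n, 'm) jet \<Rightarrow>
     ('n, 'm) jet set \<Rightarrow> ('m \<Rightarrow> ('n, 'm) jet \<Rightarrow> real) \<Rightarrow> bool" where
  "quasi_static_feedback f D p W \<alpha> \<longleftrightarrow>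
     open W \<and> (\<forall>j. smooth_on UNIV W (\<alpha> j)) \<and>
     (\<exists>N \<beta>. open N \<and> p \<in> N \<and> N \<subseteq> D \<and> (\<forall>j. smooth_on UNIV N (\<beta> j)) \<and>
        (\<forall>w\<in>W. state_input_map (qs_field f \<alpha>) \<alpha> w \<in> N \<and>
           state_input_map (field_u f) \<beta> (state_input_map (qs_field f \<alpha>) \<alpha> w) = w) \<and>
        (\<forall>q\<in>N. state_input_map (field_u f) \<beta> q \<in> W \<and>
           state_input_map (qs_field f \<alpha>) \<alpha> (state_input_map (field_u f) \<beta> q) = q) \<and>
        diff_independent N (\<lambda>c q. state_input_map (field_u f) \<beta> q c) UNIV)"

text \<open>Regards \<open>(x, v, v\<^sub>[\<^sub>1\<^sub>], \<dots>)\<close> as a point of the closed loop with empty \<open>z\<close>.\<close>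

definition empty_z :: "('n, 'm) jet \<Rightarrow> ('n + nat, 'm) jet" where
  "empty_z p = (\<lambda>c. case c of
      St s \<Rightarrow> (case s of Inl i \<Rightarrow> p (St i) | Inr k \<Rightarrow> 0)
    | In j k \<Rightarrow> p (In j k))"

end

theory Submission
  imports Defs
begin

text \<open>
  Let \<open>\<Phi>\<close> map \<open>(x, u, u\<^sub>[\<^sub>1\<^sub>], \<dots>)\<close> to all \<open>\<phi>\<^sup>j\<^sub>[\<^sub>\<beta>\<^sub>]\<close>, and let \<open>\<Psi>\<close> be the flat parametrization together with the
  time derivatives of its \<open>u\<close>-part, so that \<open>\<Psi> \<circ> \<Phi> = id\<close>. A nontrivial relation with smooth coefficients
  between the \<open>d\<phi>\<^sup>j\<^sub>[\<^sub>\<beta>\<^sub>]\<close> could be differentiated in time without end, and then \<open>d\<phi>\<^sub>[\<^sub>0\<^sub>,\<^sub>K\<^sub>]\<close> would have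
  too small a rank to span \<open>du, \<dots>, du\<^sub>[\<^sub>K\<^sub>-\<^sub>r\<^sub>]\<close>. As the rows of \<open>d\<Phi> d\<Psi> - id\<close> are such relations, \<open>\<Phi>\<close> is
  a submersion in every finite set of components, whence also \<open>\<Phi> \<circ> \<Psi> = id\<close> locally. The independence of
  \<open>dx, d\<phi>\<^sub>[\<^sub>A\<^sub>], \<dots>, d\<phi>\<^sub>[\<^sub>R\<^sub>-\<^sub>1\<^sub>]\<close> says that \<open>F\<^sub>x\<close> has rank \<open>n\<close> in the variables \<open>\<phi>\<^sub>[\<^sub>0\<^sub>,\<^sub>A\<^sub>-\<^sub>1\<^sub>]\<close>; hence \<open>n\<close> of them
  can be exchanged for \<open>x\<close>. The others are \<open>z\<close>, and \<open>v\<^sub>[\<^sub>k\<^sub>]\<close> is \<open>\<phi>\<^sub>[\<^sub>A\<^sub>+\<^sub>k\<^sub>]\<close>.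
\<close>

section \<open>The product topology\<close>

text \<open>In a space with infinitely many coordinates, local invertibility of
  \<open>\<Phi>\<close> cannot be read off one finite Jacobian matrix. Finite dependence takes the
  place of finite dimension: every smooth function sees finitely many coordinates, so the calculus
  needed reduces to the mean value and intermediate value theorems along single coordinate lines.

  A relation among output differentials must have coefficients that are smooth on a whole open set,
  because it is to be differentiated in time again and again; a linear dependence at one point would
  be useless. The entries of \<open>d\<Phi> d\<Psi> - id\<close> qualify because
  \<open>\<Psi>\<close> is smooth on an open set that contains the image of \<open>\<Phi>\<close>.

  The exchange of coordinates works at a point, whereas the given independence is over smooth
  functions. Locally constant rank connects the two, through a relation whose coefficients are built
  without division.\<close>

lemma open_fun_box:
  fixes S :: "('c \<Rightarrow> real) set"
  assumes "open S" "p \<in> S"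
  obtains C e where "finite C" "e > 0" "{q. \<forall>c\<in>C. \<bar>q c - p c\<bar> < e} \<subseteq> S"
proof -
  obtain X where X: "p \<in> PiE UNIV X" "\<And>i. openin euclidean (X i)"
      "finite {i. X i \<noteq> topspace euclidean}" "PiE UNIV X \<subseteq> S"
    using product_topology_open_contains_basis[of "\<lambda>_. euclidean" UNIV S p] assms
    unfolding open_fun_def by blast
  define C where "C = {i. X i \<noteq> UNIV}"
  have fin: "finite C" using X(3) by (simp add: C_def)
  have "\<exists>e>0. \<forall>y. \<bar>y - p c\<bar> < e \<longrightarrow> y \<in> X c" for c
  proof -
    have "open (X c)" "p c \<in> X c" using X(1,2) by (auto simp: PiE_iff)
    then obtain e where "e > 0" "\<And>y. dist y (p c) < e \<Longrightarrow> y \<in> X c"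
      unfolding open_dist by blast
    then show ?thesis by (auto simp: dist_real_def)
  qed
  then obtain e where e: "\<And>c. e c > 0" "\<And>c y. \<bar>y - p c\<bar> < e c \<Longrightarrow> y \<in> X c"
    by metis
  \<comment> \<open>\<open>insert 1\<close> keeps the minimum defined when \<open>C\<close> is
    empty.\<close>
  define d where "d = Min (insert 1 (e ` C))"
  have d: "d > 0" "\<And>c. c \<in> C \<Longrightarrow> d \<le> e c"
    unfolding d_def using fin e(1) by auto
  have "{q. \<forall>c\<in>C. \<bar>q c - p c\<bar> < d} \<subseteq> S"
  proof
    fix q assume q: "q \<in> {q. \<forall>c\<in>C. \<bar>q c - p c\<bar> < d}"
    have "q c \<in> X c" for c
    proof (cases "c \<in> C")
      case True
      then have "\<bar>q c - p c\<bar> < e c" using q d(2)[OF True] by fastforce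
      then show ?thesis by (rule e(2))
    qed (simp add: C_def)
    then show "q \<in> S" using X(4) by (auto simp: PiE_iff)
  qed
  with fin d(1) show thesis by (rule that)
qed

lemma open_fun_cylinder:
  fixes p :: "'c \<Rightarrow> real"
  assumes "finite C"
  shows "open {q. \<forall>c\<in>C. \<bar>q c - p c\<bar> < e}"
proof -
  have "open {q :: 'c \<Rightarrow> real. \<forall>c\<in>C. q c \<in> {p c - e<..<p c + e}}"
    using product_topology_basis'[OF assms, of "\<lambda>c. {p c - e<..<p c + e}" id] by simp
  moreover have "{q. \<forall>c\<in>C. q c \<in> {p c - e<..<p c + e}} = {q. \<forall>c\<in>C. \<bar>q c - p c\<bar> < e}"
    by (auto simp: abs_less_iff)
  ultimately show ?thesis by simp
qed

lemma tendsto_fun: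
  fixes l :: "'c \<Rightarrow> real"
  assumes "\<And>c. ((\<lambda>x. f x c) \<longlongrightarrow> l c) F"
  shows "(f \<longlongrightarrow> l) F"
proof (rule topological_tendstoI)
  fix S assume "open S" "l \<in> S"
  then obtain C e where C: "finite C" "e > 0" "{q. \<forall>c\<in>C. \<bar>q c - l c\<bar> < e} \<subseteq> S"
    by (rule open_fun_box)
  have "\<forall>\<^sub>F x in F. \<bar>f x c - l c\<bar> < e" for c
    using tendstoD[OF assms[of c] C(2)] by (simp add: dist_real_def)
  then have "\<forall>\<^sub>F x in F. \<forall>c\<in>C. \<bar>f x c - l c\<bar> < e"
    using C(1) by (simp add: eventually_ball_finite)
  then show "\<forall>\<^sub>F x in F. f x \<in> S"
    by eventually_elim (use C(3) in auto)
qed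

lemma continuous_on_coord [continuous_intros]: "continuous_on S (\<lambda>p :: 'c \<Rightarrow> real. p c)"
  by (rule continuous_on_subset[OF continuous_on_product_coordinates]) simp

lemma continuous_on_fun_upd [continuous_intros]:
  fixes g :: "'a::topological_space \<Rightarrow> 'c \<Rightarrow> real"
  assumes "continuous_on S g" "continuous_on S h"
  shows "continuous_on S (\<lambda>p. (g p)(c := h p))"
proof (rule continuous_on_coordinatewise_then_product)
  fix i
  show "continuous_on S (\<lambda>p. ((g p)(c := h p)) i)"
    using assms(2) continuous_on_product_then_coordinatewise[OF assms(1), of i]
    by (cases "i = c") auto
qed

lemma open_preimage:
  assumes "open S" "open T" "continuous_on S f"
  shows "open {p \<in> S. f p \<in> T}"
  using continuous_open_preimage[OF assms(3,1,2)] by (simp add: vimage_def Int_def)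

lemma open_line: "open S \<Longrightarrow> open {t. p(c := t) \<in> S}" for p :: "'c \<Rightarrow> real"
  using open_preimage[OF open_UNIV _ continuous_on_fun_upd[OF continuous_on_const continuous_on_id], of S p c]
  by simp

lemma eventually_line:
  fixes p :: "'c \<Rightarrow> real"
  assumes "open S" "p(c := t) \<in> S"
  shows "\<forall>\<^sub>F s in nhds t. p(c := s) \<in> S"
  using eventually_nhds_in_open[OF open_line[OF assms(1)]] assms(2) by auto

section \<open>Calculus of smooth functions\<close>

lemma pd_cong:
  assumes "open S" "p \<in> S" "\<And>q. q \<in> S \<Longrightarrow> h q = g q"
  shows "pd c h p = pd c g p"
  unfolding pd_def
proof (rule deriv_cong_ev)
  show "\<forall>\<^sub>F t in nhds (p c). h (p(c := t)) = g (p(c := t))"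
    using eventually_line[OF assms(1), of p c "p c"] assms(2,3)
    by (auto elim: eventually_mono)
qed simp

section \<open>Functions of class C^k and their closure properties\<close>

lemma Ck_on_imp_continuous: "Ck_on k S h \<Longrightarrow> continuous_on S h"
  by (cases k) auto

lemma Ck_on_subset: "Ck_on k S h \<Longrightarrow> T \<subseteq> S \<Longrightarrow> Ck_on k T h"
  by (induction k arbitrary: h) (auto intro: continuous_on_subset)

lemma Ck_on_SucD: "Ck_on (Suc k) S h \<Longrightarrow> Ck_on k S h"
  by (induction k arbitrary: h) auto

lemma Ck_on_pd: "Ck_on (Suc k) S h \<Longrightarrow> Ck_on k S (pd c h)"
  by auto

lemma pd_DERIV:
  assumes "Ck_on (Suc k) S h" "p \<in> S"
  shows "((\<lambda>t. h (p(c := t))) has_real_derivative pd c h p) (at (p c))"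
proof -
  have "(\<lambda>t. h (p(c := t))) differentiable (at (p c))" using assms by simp
  then show ?thesis unfolding pd_def
    by (metis DERIV_imp_deriv real_differentiable_def)
qed

lemma pd_DERIV':
  assumes "Ck_on (Suc k) S h" "p(c := t) \<in> S"
  shows "((\<lambda>s. h (p(c := s))) has_real_derivative pd c h (p(c := t))) (at t)"
  using pd_DERIV[OF assms(1), of "p(c := t)" c] assms(2) by simp

lemma pd_eqI:
  "((\<lambda>t. h (p(c := t))) has_real_derivative d) (at (p c)) \<Longrightarrow> pd c h p = d"
  unfolding pd_def by (rule DERIV_imp_deriv)

lemma DERIV_cong_line:
  fixes p :: "'c \<Rightarrow> real"
  assumes "open S" "p \<in> S" "\<And>q. q \<in> S \<Longrightarrow> h q = g q"
  shows "((\<lambda>t. h (p(c := t))) has_real_derivative d) (at (p c)) \<longleftrightarrow>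
         ((\<lambda>t. g (p(c := t))) has_real_derivative d) (at (p c))"
proof (rule DERIV_cong_ev)
  show "\<forall>\<^sub>F t in nhds (p c). h (p(c := t)) = g (p(c := t))"
    using eventually_line[OF assms(1), of p c "p c"] assms(2,3)
    by (auto elim: eventually_mono)
qed auto

lemma Ck_on_cong:
  assumes "open S" "\<And>p. p \<in> S \<Longrightarrow> h p = g p"
  shows "Ck_on k S h \<longleftrightarrow> Ck_on k S g"
  using assms(2)
proof (induction k arbitrary: h g)
  case 0
  then show ?case by (auto cong: continuous_on_cong)
next
  case (Suc k)
  have "Ck_on k S (pd c h) \<longleftrightarrow> Ck_on k S (pd c g)" for c
    by (rule Suc.IH) (rule pd_cong[OF assms(1) _ Suc.prems])
  moreover have "continuous_on S h \<longleftrightarrow> continuous_on S g"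
    using Suc.prems by (auto cong: continuous_on_cong)
  moreover have "(\<lambda>t. h (p(c := t))) differentiable (at (p c)) \<longleftrightarrow>
      (\<lambda>t. g (p(c := t))) differentiable (at (p c))" if "p \<in> S" for p c
    unfolding real_differentiable_def
    using DERIV_cong_line[OF assms(1) that, of h g c] Suc.prems by simp
  ultimately show ?case by simp
qed

text \<open>A candidate \<open>g\<close> for the partial derivatives is enough: it coincides with
  \<open>pd\<close> on \<open>S\<close>, and since \<open>S\<close> is open its regularity transfers
  by congruence. The closure properties below use this rule in an induction on the order.\<close>

lemma Ck_on_SucI:
  assumes "open S" "continuous_on S h"
    and "\<And>p c. p \<in> S \<Longrightarrow> ((\<lambda>t. h (p(c := t))) has_real_derivative g c p) (at (p c))"
    and "\<And>c. Ck_on k S (g c)"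
  shows "Ck_on (Suc k) S h"
proof -
  have "pd c h p = g c p" if "p \<in> S" for c p by (rule pd_eqI[OF assms(3)[OF that]])
  then have "Ck_on k S (pd c h)" for c
    using assms(4)[of c] Ck_on_cong[OF assms(1), of "pd c h" "g c" k] by simp
  then show ?thesis
    using assms(2,3) by (auto simp: real_differentiable_def)
qed

lemma Ck_on_const: "open S \<Longrightarrow> Ck_on k S (\<lambda>p. a)"
proof (induction k arbitrary: a)
  case (Suc k)
  then show ?case by (intro Ck_on_SucI[where g = "\<lambda>_ _. 0"]) auto
qed simp

lemma DERIV_coord:
  "((\<lambda>t. (p(c := t)) a) has_real_derivative (if a = c then 1 else 0)) (at x)"
  by (cases "a = c") auto

lemma Ck_on_coord: "open S \<Longrightarrow> Ck_on k S (\<lambda>p. p a)"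
proof (cases k)
  case (Suc l)
  assume "open S"
  then show ?thesis unfolding Suc
    by (intro Ck_on_SucI[where g = "\<lambda>c _. if a = c then 1 else 0"])
       (auto intro!: continuous_intros Ck_on_const intro: DERIV_coord[unfolded fun_upd_def])
qed (auto intro!: continuous_intros)

lemma Ck_on_add:
  assumes "open S" "Ck_on k S h" "Ck_on k S g"
  shows "Ck_on k S (\<lambda>p. h p + g p)"
  using assms(2,3)
proof (induction k arbitrary: h g)
  case 0
  then show ?case by (auto intro: continuous_intros)
next
  case (Suc k)
  show ?case
  proof (rule Ck_on_SucI[OF assms(1), where g = "\<lambda>c p. pd c h p + pd c g p"])
    show "continuous_on S (\<lambda>p. h p + g p)"
      using Suc.prems by (auto intro: continuous_intros)
    show "Ck_on k S (\<lambda>p. pd c h p + pd c g p)" for c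
      using Suc.prems by (intro Suc.IH) auto
    show "((\<lambda>t. h (p(c := t)) + g (p(c := t))) has_real_derivative pd c h p + pd c g p) (at (p c))"
      if "p \<in> S" for p c
      using pd_DERIV[OF Suc.prems(1) that] pd_DERIV[OF Suc.prems(2) that] by (rule DERIV_add)
  qed
qed

lemma Ck_on_mult:
  assumes "open S" "Ck_on k S h" "Ck_on k S g"
  shows "Ck_on k S (\<lambda>p. h p * g p)"
  using assms(2,3)
proof (induction k arbitrary: h g)
  case 0
  then show ?case by (auto intro: continuous_intros)
next
  case (Suc k)
  show ?case
  proof (rule Ck_on_SucI[OF assms(1), where g = "\<lambda>c p. pd c h p * g p + pd c g p * h p"])
    show "continuous_on S (\<lambda>p. h p * g p)"
      using Suc.prems by (auto intro: continuous_intros)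
    show "Ck_on k S (\<lambda>p. pd c h p * g p + pd c g p * h p)" for c
      using Suc.prems(1,2)[THEN Ck_on_SucD] Suc.prems(1,2)[THEN Ck_on_pd]
      by (intro Ck_on_add[OF assms(1)] Suc.IH) auto
    show "((\<lambda>t. h (p(c := t)) * g (p(c := t))) has_real_derivative
        pd c h p * g p + pd c g p * h p) (at (p c))" if "p \<in> S" for p c
      by (rule DERIV_cong[OF DERIV_mult[OF pd_DERIV[OF Suc.prems(1) that] pd_DERIV[OF Suc.prems(2) that]]])
        simp
  qed
qed

lemma Ck_on_inverse:
  assumes "open S" "Ck_on k S h" "\<And>p. p \<in> S \<Longrightarrow> h p \<noteq> 0"
  shows "Ck_on k S (\<lambda>p. inverse (h p))"
  using assms(2)
proof (induction k)
  case 0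
  then show ?case using assms(3) by (auto intro!: continuous_intros)
next
  case (Suc k)
  show ?case
  proof (rule Ck_on_SucI[OF assms(1),
        where g = "\<lambda>c p. - 1 * (pd c h p * (inverse (h p) * inverse (h p)))"])
    show "continuous_on S (\<lambda>p. inverse (h p))"
      using Suc.prems assms(3) by (auto intro!: continuous_intros)
    show "Ck_on k S (\<lambda>p. - 1 * (pd c h p * (inverse (h p) * inverse (h p))))" for c
      using Suc.prems[THEN Ck_on_SucD] Suc.prems[THEN Ck_on_pd]
      by (intro Ck_on_mult Ck_on_const assms(1) Suc.IH) auto
    show "((\<lambda>t. inverse (h (p(c := t)))) has_real_derivative
        - 1 * (pd c h p * (inverse (h p) * inverse (h p)))) (at (p c))" if "p \<in> S" for p c
      by (rule DERIV_cong[OF DERIV_inverse_fun[OF pd_DERIV[OF Suc.prems that]]])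
        (use assms(3)[OF that] in \<open>auto simp: power2_eq_square\<close>)
  qed
qed

section \<open>Mean value theorem on coordinate lines and the chain rule\<close>

lemma line_mvt:
  fixes p :: "'c \<Rightarrow> real"
  assumes "Ck_on (Suc k) S h" "\<And>x. x \<in> closed_segment u v \<Longrightarrow> p(a := x) \<in> S"
  obtains x where "x \<in> closed_segment u v" "h (p(a := v)) - h (p(a := u)) = (v - u) * pd a h (p(a := x))"
proof -
  have *: "\<exists>x\<in>{u..v}. h (p(a := v)) - h (p(a := u)) = (v - u) * pd a h (p(a := x))"
    if "u < v" "\<And>x. x \<in> {u..v} \<Longrightarrow> p(a := x) \<in> S" for u v
  proof -
    have "\<exists>x>u. x < v \<and> h (p(a := v)) - h (p(a := u)) = (v - u) * pd a h (p(a := x))"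
      by (rule MVT2[OF \<open>u < v\<close>, of "\<lambda>t. h (p(a := t))" "\<lambda>t. pd a h (p(a := t))"])
        (use pd_DERIV'[OF assms(1)] that in \<open>auto simp del: fun_upd_apply\<close>)
    then show ?thesis by force
  qed
  consider "u = v" | "u < v" | "v < u" by linarith
  then show thesis
  proof cases
    case 1
    then show ?thesis using that[of u] by simp
  next
    case 2
    with *[of u v] assms(2) that show ?thesis
      by (auto simp: closed_segment_eq_real_ivl)
  next
    case 3
    with *[of v u] assms(2) obtain x where "x \<in> {v..u}" "h (p(a := u)) - h (p(a := v)) = (u - v) * pd a h (p(a := x))"
      by (auto simp: closed_segment_eq_real_ivl)
    with 3 that[of x] show ?thesis
      by (auto simp: closed_segment_eq_real_ivl algebra_simps)
  qed
qed

lemma closed_segment_bound: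
  fixes x :: real
  assumes "x \<in> closed_segment u v"
  shows "\<bar>x - w\<bar> \<le> max \<bar>u - w\<bar> \<bar>v - w\<bar>"
  using assms by (auto simp: closed_segment_eq_real_ivl split: if_splits)

text \<open>Chain rule from continuous partial derivatives alone. The coordinates in
  \<open>C\<close> are released one at a time; each release changes \<open>h\<close> by a mean value
  term along one coordinate line, and continuity of \<open>pd a h\<close> gives the limit of its
  difference quotient.\<close>

lemma DERIV_curve:
  fixes \<gamma> :: "real \<Rightarrow> 'c \<Rightarrow> real"
  assumes S: "open S" and h: "Ck_on (Suc k) S h" and C: "finite C" "depends_on C S h"
    and t: "\<gamma> t \<in> S" and \<gamma>: "\<And>c. ((\<lambda>s. \<gamma> s c) has_real_derivative \<gamma>' c) (at t)"
  shows "((\<lambda>s. h (\<gamma> s)) has_real_derivative (\<Sum>c\<in>C. pd c h (\<gamma> t) * \<gamma>' c)) (at t)"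
proof -
  \<comment> \<open>\<open>G F s\<close> lets only the coordinates in \<open>F\<close> follow the
    curve and freezes the others at time \<open>t\<close>, so enlarging \<open>F\<close> by one
    element is a move along a coordinate line.\<close>
  define G where "G F s = (\<lambda>c. if c \<in> F then \<gamma> s c else \<gamma> t c)" for F s
  have lim: "((\<lambda>s. \<gamma> s c) \<longlongrightarrow> \<gamma> t c) (at t)" for c
    using DERIV_isCont[OF \<gamma>[of c]] by (simp add: isCont_def)
  obtain B e where B: "finite B" "e > 0" "{q. \<forall>c\<in>B. \<bar>q c - \<gamma> t c\<bar> < e} \<subseteq> S"
    using open_fun_box[OF S t] .
  have ev: "\<forall>\<^sub>F s in at t. \<forall>c\<in>B. \<bar>\<gamma> s c - \<gamma> t c\<bar> < e"
    using tendstoD[OF lim B(2)] B(1) by (simp add: eventually_ball_finite dist_real_def)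
  have main: "((\<lambda>s. h (G F s)) has_real_derivative (\<Sum>c\<in>F. pd c h (\<gamma> t) * \<gamma>' c)) (at t)"
    if "finite F" for F
    using that
  proof (induction F)
    case empty
    have "G {} s = \<gamma> t" for s by (auto simp: G_def)
    then show ?case by simp
  next
    case (insert a F)
    have upd: "G (insert a F) s = (G F s)(a := \<gamma> s a)" "G F s = (G F s)(a := \<gamma> t a)" for s
      using insert.hyps by (auto simp: G_def)
    \<comment> \<open>The mean value point is asserted only while the curve stays in the box, where
      the segment lies in \<open>S\<close>; the implication allows a choice of \<open>x\<close> for
      every \<open>s\<close>.\<close>
    have "\<exists>x. (\<forall>c\<in>B. \<bar>\<gamma> s c - \<gamma> t c\<bar> < e) \<longrightarrow> x \<in> closed_segment (\<gamma> t a) (\<gamma> s a) \<and>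
        h (G (insert a F) s) - h (G F s) = (\<gamma> s a - \<gamma> t a) * pd a h ((G F s)(a := x))" for s
    proof (cases "\<forall>c\<in>B. \<bar>\<gamma> s c - \<gamma> t c\<bar> < e")
      case True
      have "(G F s)(a := x) \<in> S" if "x \<in> closed_segment (\<gamma> t a) (\<gamma> s a)" for x
      proof -
        have "\<bar>((G F s)(a := x)) c - \<gamma> t c\<bar> < e" if "c \<in> B" for c
          using True \<open>c \<in> B\<close> closed_segment_bound[OF \<open>x \<in> _\<close>, of "\<gamma> t a"] B(2)
          by (auto simp: G_def)
        then show ?thesis using B(3) by blast
      qed
      then obtain x where "x \<in> closed_segment (\<gamma> t a) (\<gamma> s a)"
        "h ((G F s)(a := \<gamma> s a)) - h ((G F s)(a := \<gamma> t a)) = (\<gamma> s a - \<gamma> t a) * pd a h ((G F s)(a := x))"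
        by (rule line_mvt[OF h])
      then show ?thesis using upd by metis
    qed auto
    then obtain x where x: "\<And>s. (\<forall>c\<in>B. \<bar>\<gamma> s c - \<gamma> t c\<bar> < e) \<Longrightarrow> x s \<in> closed_segment (\<gamma> t a) (\<gamma> s a) \<and>
        h (G (insert a F) s) - h (G F s) = (\<gamma> s a - \<gamma> t a) * pd a h ((G F s)(a := x s))"
      by metis
    have xlim: "(x \<longlongrightarrow> \<gamma> t a) (at t)"
    proof (rule Lim_null_comparison[where f = "\<lambda>s. x s - \<gamma> t a", THEN LIM_zero_cancel])
      show "\<forall>\<^sub>F s in at t. norm (x s - \<gamma> t a) \<le> \<bar>\<gamma> s a - \<gamma> t a\<bar>"
        using ev
      proof eventually_elim
        case (elim s)
        then show ?case using closed_segment_bound[of "x s" "\<gamma> t a" "\<gamma> s a" "\<gamma> t a"] x by auto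
      qed
      show "((\<lambda>s. \<bar>\<gamma> s a - \<gamma> t a\<bar>) \<longlongrightarrow> 0) (at t)"
        using tendsto_rabs[OF LIM_zero[OF lim[of a]]] by simp
    qed
    have "((\<lambda>s. (G F s)(a := x s)) \<longlongrightarrow> \<gamma> t) (at t)"
    proof (rule tendsto_fun)
      fix c
      show "((\<lambda>s. ((G F s)(a := x s)) c) \<longlongrightarrow> \<gamma> t c) (at t)"
        using lim[of c] xlim by (cases "c = a"; cases "c \<in> F") (auto simp: G_def)
    qed
    moreover have "\<forall>\<^sub>F s in at t. (G F s)(a := x s) \<in> S"
      using calculation S t by (rule topological_tendstoD)
    ultimately have pdlim: "((\<lambda>s. pd a h ((G F s)(a := x s))) \<longlongrightarrow> pd a h (\<gamma> t)) (at t)"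
      by (rule continuous_on_tendsto_compose[OF Ck_on_imp_continuous[OF Ck_on_pd[OF h]] _ t])
    have "((\<lambda>s. (\<gamma> s a - \<gamma> t a) / (s - t) * pd a h ((G F s)(a := x s))) \<longlongrightarrow> \<gamma>' a * pd a h (\<gamma> t)) (at t)"
      using \<gamma>[of a] unfolding has_field_derivative_iff by (intro tendsto_mult pdlim)
    then have "((\<lambda>s. h (G (insert a F) s) - h (G F s)) has_real_derivative \<gamma>' a * pd a h (\<gamma> t)) (at t)"
      unfolding has_field_derivative_iff
    proof (rule Lim_transform_eventually)
      show "\<forall>\<^sub>F s in at t. (\<gamma> s a - \<gamma> t a) / (s - t) * pd a h ((G F s)(a := x s)) =
          (h (G (insert a F) s) - h (G F s) - (h (G (insert a F) t) - h (G F t))) / (s - t)"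
        using ev
      proof eventually_elim
        case (elim s)
        have "G F t = G (insert a F) t" by (auto simp: G_def)
        then show ?case using x[OF elim] by simp
      qed
    qed
    from DERIV_add[OF this insert.IH] show ?case
      using insert.hyps by (simp add: algebra_simps)
  qed
  \<comment> \<open>\<open>depends_on\<close> compares points of \<open>S\<close> only, so both the
    curve and its truncation \<open>G C s\<close> must lie in the box, as they do for
    \<open>s\<close> near \<open>t\<close>.\<close>
  have evn: "\<forall>\<^sub>F s in nhds t. h (\<gamma> s) = h (G C s)"
    unfolding eventually_nhds_conv_at
  proof
    show "h (\<gamma> t) = h (G C t)" by (simp add: G_def)
    show "\<forall>\<^sub>F s in at t. h (\<gamma> s) = h (G C s)"
      using ev
    proof eventually_elim
      case (elim s)
      have "\<gamma> s \<in> S" using elim by (intro subsetD[OF B(3)] CollectI)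
      have "\<forall>c\<in>B. \<bar>G C s c - \<gamma> t c\<bar> < e" using elim B(2) by (simp add: G_def)
      then have "G C s \<in> S" by (intro subsetD[OF B(3)] CollectI)
      moreover have "\<forall>c\<in>C. \<gamma> s c = G C s c" by (simp add: G_def)
      ultimately show ?case using C(2) \<open>\<gamma> s \<in> S\<close> unfolding depends_on_def by blast
    qed
  qed
  show ?thesis by (rule iffD2[OF DERIV_cong_ev[OF refl evn refl] main[OF C(1)]])
qed

lemma depends_on_mono: "depends_on C S h \<Longrightarrow> C \<subseteq> B \<Longrightarrow> depends_on B S h"
  unfolding depends_on_def by blast

lemma depends_on_subset: "depends_on C S h \<Longrightarrow> T \<subseteq> S \<Longrightarrow> depends_on C T h"
  unfolding depends_on_def by blast

lemma pd_eq_0: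
  assumes "open S" "depends_on C S h" "p \<in> S" "c \<notin> C"
  shows "pd c h p = 0"
proof (rule pd_eqI)
  have "\<forall>\<^sub>F t in nhds (p c). h (p(c := t)) = h p"
    using eventually_line[OF assms(1), of p c "p c"] assms(3)
  proof (auto elim!: eventually_mono)
    fix t assume "p(c := t) \<in> S"
    then show "h (p(c := t)) = h p"
      using assms(2-4) unfolding depends_on_def by (metis fun_upd_other)
  qed
  then show "((\<lambda>t. h (p(c := t))) has_real_derivative 0) (at (p c))"
    by (rule iffD2[OF DERIV_cong_ev[OF refl _ refl]]) simp
qed

text \<open>For \<open>c\<close> in \<open>C\<close>, the lines through \<open>p\<close> and
  \<open>q\<close> in direction \<open>c\<close> are distinct only off \<open>C\<close>, so
  \<open>h\<close> agrees along them near the base points. For \<open>c\<close> outside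
  \<open>C\<close> both derivatives vanish.\<close>

lemma depends_on_pd:
  assumes "open S" "depends_on C S h"
  shows "depends_on C S (pd c h)"
  unfolding depends_on_def
proof (intro ballI impI)
  fix p q assume pq: "p \<in> S" "q \<in> S" "\<forall>c\<in>C. p c = q c"
  show "pd c h p = pd c h q"
  proof (cases "c \<in> C")
    case True
    have "\<forall>\<^sub>F t in nhds (p c). p(c := t) \<in> S \<and> q(c := t) \<in> S"
    proof (intro eventually_conj eventually_line[OF assms(1)])
      have "q(c := p c) = q" using pq(3) True by auto
      then show "p(c := p c) \<in> S" "q(c := p c) \<in> S" using pq by auto
    qed
    then have "\<forall>\<^sub>F t in nhds (p c). h (p(c := t)) = h (q(c := t))"
      by (rule eventually_mono) (use assms(2) pq(3) in \<open>auto simp: depends_on_def\<close>)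
    then show ?thesis unfolding pd_def
      using pq(3) True by (intro deriv_cong_ev) auto
  next
    case False
    then show ?thesis using pd_eq_0[OF assms] pq by simp
  qed
qed

lemma pd_comp_DERIV:
  assumes "open V" "Ck_on (Suc k) V h" "finite C" "depends_on C V h"
    and "\<And>a. Ck_on (Suc k) W (\<lambda>p. \<Phi> p a)" "\<And>p. p \<in> W \<Longrightarrow> \<Phi> p \<in> V" "p \<in> W"
  shows "((\<lambda>t. h (\<Phi> (p(c := t)))) has_real_derivative
          (\<Sum>a\<in>C. pd a h (\<Phi> p) * pd c (\<lambda>p. \<Phi> p a) p)) (at (p c))"
proof -
  have "((\<lambda>t. h (\<Phi> (p(c := t)))) has_real_derivative
          (\<Sum>a\<in>C. pd a h (\<Phi> (p(c := p c))) * pd c (\<lambda>p. \<Phi> p a) p)) (at (p c))"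
    by (rule DERIV_curve[OF assms(1-4), where \<gamma> = "\<lambda>t. \<Phi> (p(c := t))"])
      (use assms(6,7) pd_DERIV[OF assms(5,7)] in simp_all)
  then show ?thesis by simp
qed

text \<open>The induction varies \<open>h\<close>, because the chain rule brings in
  \<open>pd a h\<close>; the finite set \<open>C\<close> stays fixed, since partial derivatives
  depend on the same coordinates.\<close>

lemma Ck_on_comp:
  assumes "open W" "open V" "Ck_on k V h" "finite C" "depends_on C V h"
    and "\<And>a. Ck_on k W (\<lambda>p. \<Phi> p a)" "\<And>p. p \<in> W \<Longrightarrow> \<Phi> p \<in> V"
  shows "Ck_on k W (\<lambda>p. h (\<Phi> p))"
proof -
  have sum: "Ck_on k W (\<lambda>p. \<Sum>a\<in>C. g a p)" if "finite C" "\<And>a. Ck_on k W (g a)"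
    for k C and g :: "'b \<Rightarrow> ('a \<Rightarrow> real) \<Rightarrow> real"
    using that by (induction C) (auto intro: Ck_on_const Ck_on_add assms(1))
  have cont: "continuous_on W (\<lambda>p. h (\<Phi> p))" if "continuous_on V h" for h
  proof (rule continuous_on_compose2[OF that])
    show "continuous_on W \<Phi>"
      by (rule continuous_on_coordinatewise_then_product) (rule Ck_on_imp_continuous[OF assms(6)])
  qed (use assms(7) in auto)
  show ?thesis
    using assms(3,5,6)
  proof (induction k arbitrary: h)
    case 0
    then show ?case using cont by auto
  next
    case (Suc k)
    show ?case
    proof (rule Ck_on_SucI[OF assms(1) _ pd_comp_DERIV[OF assms(2) Suc.prems(1) assms(4) Suc.prems(2,3) assms(7)]])
      show "continuous_on W (\<lambda>p. h (\<Phi> p))" using cont Suc.prems(1) by auto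
      show "Ck_on k W (\<lambda>p. \<Sum>a\<in>C. pd a h (\<Phi> p) * pd c (\<lambda>p. \<Phi> p a) p)" for c
      proof (rule sum[OF assms(4)], rule Ck_on_mult[OF assms(1)])
        fix a
        show "Ck_on k W (\<lambda>p. pd a h (\<Phi> p))"
          by (rule Suc.IH[OF Ck_on_pd[OF Suc.prems(1)] depends_on_pd[OF assms(2) Suc.prems(2)]
                Ck_on_SucD[OF Suc.prems(3)]])
        show "Ck_on k W (pd c (\<lambda>p. \<Phi> p a))" by (rule Ck_on_pd[OF Suc.prems(3)])
      qed
    qed
  qed
qed

section \<open>Smooth functions of finitely many coordinates\<close>

lemma smooth_onE:
  assumes "smooth_on I S h"
  obtains C where "finite C" "C \<subseteq> I" "depends_on C S h" "\<And>k. Ck_on k S h"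
  using assms unfolding smooth_on_def by blast

lemma smooth_onI:
  "finite C \<Longrightarrow> C \<subseteq> I \<Longrightarrow> depends_on C S h \<Longrightarrow> (\<And>k. Ck_on k S h) \<Longrightarrow> smooth_on I S h"
  unfolding smooth_on_def by blast

lemma smooth_on_Ck: "smooth_on I S h \<Longrightarrow> Ck_on k S h"
  unfolding smooth_on_def by blast

lemma smooth_on_continuous: "smooth_on I S h \<Longrightarrow> continuous_on S h"
  using Ck_on_imp_continuous smooth_on_Ck by blast

lemma smooth_on_map_continuous: "(\<And>a. smooth_on I S (\<lambda>p. \<Phi> p a)) \<Longrightarrow> continuous_on S \<Phi>"
  by (rule continuous_on_coordinatewise_then_product) (rule smooth_on_continuous)

lemma smooth_on_mono: "smooth_on I S h \<Longrightarrow> I \<subseteq> J \<Longrightarrow> T \<subseteq> S \<Longrightarrow> smooth_on J T h"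
  unfolding smooth_on_def by (meson Ck_on_subset depends_on_subset subset_trans)

lemma smooth_on_cong:
  assumes "open S" "\<And>p. p \<in> S \<Longrightarrow> h p = g p"
  shows "smooth_on I S h \<longleftrightarrow> smooth_on I S g"
proof -
  have "Ck_on k S h \<longleftrightarrow> Ck_on k S g" for k by (rule Ck_on_cong[OF assms])
  moreover have "depends_on C S h \<longleftrightarrow> depends_on C S g" for C
    using assms(2) by (auto simp: depends_on_def)
  ultimately show ?thesis unfolding smooth_on_def by simp
qed

lemma smooth_on_const: "open S \<Longrightarrow> smooth_on I S (\<lambda>p. a)"
  by (rule smooth_onI[of "{}"]) (auto simp: depends_on_def intro: Ck_on_const)

lemma smooth_on_coord: "open S \<Longrightarrow> a \<in> I \<Longrightarrow> smooth_on I S (\<lambda>p. p a)"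
  by (rule smooth_onI[of "{a}"]) (auto simp: depends_on_def intro: Ck_on_coord)

lemma smooth_on_binop:
  assumes "smooth_on I S h" "smooth_on I S g"
    and "\<And>k. Ck_on k S h \<Longrightarrow> Ck_on k S g \<Longrightarrow> Ck_on k S (\<lambda>p. r (h p) (g p))"
  shows "smooth_on I S (\<lambda>p. r (h p) (g p))"
proof -
  obtain C where C: "finite C" "C \<subseteq> I" "depends_on C S h" "\<And>k. Ck_on k S h"
    using assms(1) unfolding smooth_on_def by blast
  obtain B where B: "finite B" "B \<subseteq> I" "depends_on B S g" "\<And>k. Ck_on k S g"
    using assms(2) unfolding smooth_on_def by blast
  show ?thesis
  proof (rule smooth_onI[of "C \<union> B"])
    show "depends_on (C \<union> B) S (\<lambda>p. r (h p) (g p))"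
      unfolding depends_on_def
    proof (intro ballI impI)
      fix p q assume "p \<in> S" "q \<in> S" "\<forall>c\<in>C \<union> B. p c = q c"
      then have "h p = h q" "g p = g q" using C(3) B(3) unfolding depends_on_def by blast+
      then show "r (h p) (g p) = r (h q) (g q)" by simp
    qed
    show "Ck_on k S (\<lambda>p. r (h p) (g p))" for k using B(4) C(4) by (rule assms(3)[rotated])
  qed (use B C in auto)
qed

lemma smooth_on_add:
  "open S \<Longrightarrow> smooth_on I S h \<Longrightarrow> smooth_on I S g \<Longrightarrow> smooth_on I S (\<lambda>p. h p + g p)"
  by (rule smooth_on_binop) (auto intro: Ck_on_add)

lemma smooth_on_mult:
  "open S \<Longrightarrow> smooth_on I S h \<Longrightarrow> smooth_on I S g \<Longrightarrow> smooth_on I S (\<lambda>p. h p * g p)"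
  by (rule smooth_on_binop) (auto intro: Ck_on_mult)

lemma smooth_on_diff:
  assumes "open S" "smooth_on I S h" "smooth_on I S g"
  shows "smooth_on I S (\<lambda>p. h p - g p)"
  using smooth_on_add[OF assms(1,2) smooth_on_mult[OF assms(1) smooth_on_const[OF assms(1), of I "-1"] assms(3)]]
  by simp

lemma smooth_on_sum:
  assumes "open S" "finite F" "\<And>a. a \<in> F \<Longrightarrow> smooth_on I S (g a)"
  shows "smooth_on I S (\<lambda>p. \<Sum>a\<in>F. g a p)"
  using assms(2,3)
proof (induction F rule: finite_induct)
  case (insert a F)
  then show ?case by (simp add: smooth_on_add assms(1))
qed (simp add: smooth_on_const assms(1))

lemma smooth_on_pd: "open S \<Longrightarrow> smooth_on I S h \<Longrightarrow> smooth_on I S (pd c h)"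
  by (meson Ck_on_pd depends_on_pd smooth_onE smooth_onI)

text \<open>Only the components of \<open>\<Phi>\<close> in the finite dependence set of
  \<open>h\<close> matter, so the union of their dependence sets stays finite even if
  \<open>\<Phi>\<close> has infinitely many components.\<close>

lemma smooth_on_comp:
  assumes "open W" "open V" "smooth_on J V h"
    and "\<And>a. smooth_on I W (\<lambda>p. \<Phi> p a)" "\<And>p. p \<in> W \<Longrightarrow> \<Phi> p \<in> V"
  shows "smooth_on I W (\<lambda>p. h (\<Phi> p))"
proof -
  obtain C where C: "finite C" "depends_on C V h" "\<And>k. Ck_on k V h"
    using smooth_onE[OF assms(3)] by metis
  have "\<exists>B. finite B \<and> B \<subseteq> I \<and> depends_on B W (\<lambda>p. \<Phi> p a)" for a
    using assms(4)[of a] unfolding smooth_on_def by blast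
  then obtain B where B: "\<And>a. finite (B a)" "\<And>a. B a \<subseteq> I" "\<And>a. depends_on (B a) W (\<lambda>p. \<Phi> p a)"
    by metis
  show ?thesis
  proof (rule smooth_onI[of "\<Union>(B ` C)"])
    show "depends_on (\<Union>(B ` C)) W (\<lambda>p. h (\<Phi> p))"
      unfolding depends_on_def
    proof (intro ballI impI)
      fix p q assume *: "p \<in> W" "q \<in> W" "\<forall>c\<in>\<Union>(B ` C). p c = q c"
      then have "\<Phi> p a = \<Phi> q a" if "a \<in> C" for a
        using that B(3)[of a] unfolding depends_on_def by blast
      then show "h (\<Phi> p) = h (\<Phi> q)"
        using C(2) assms(5) * unfolding depends_on_def by blast
    qed
    show "Ck_on k W (\<lambda>p. h (\<Phi> p))" for k
      by (rule Ck_on_comp[OF assms(1,2) C(3,1,2)]) (use smooth_on_Ck[OF assms(4)] assms(5) in auto)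
  qed (use B C in auto)
qed

lemma pd_comp:
  assumes "open V" "smooth_on J V h" "finite C" "depends_on C V h"
    and "\<And>a. smooth_on I W (\<lambda>p. \<Phi> p a)" "\<And>p. p \<in> W \<Longrightarrow> \<Phi> p \<in> V" "p \<in> W"
  shows "pd c (\<lambda>p. h (\<Phi> p)) p = (\<Sum>a\<in>C. pd a h (\<Phi> p) * pd c (\<lambda>p. \<Phi> p a) p)"
  by (rule pd_eqI, rule pd_comp_DERIV[OF assms(1) smooth_on_Ck[OF assms(2)] assms(3,4) smooth_on_Ck[OF assms(5)] assms(6,7)])

lemma pd_DERIV_smooth:
  "smooth_on I S h \<Longrightarrow> p \<in> S \<Longrightarrow> ((\<lambda>t. h (p(c := t))) has_real_derivative pd c h p) (at (p c))"
  by (rule pd_DERIV[OF smooth_on_Ck])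

lemma pd_const: "pd c (\<lambda>p. a) p = 0"
  by (rule pd_eqI) simp

lemma pd_coord: "pd c (\<lambda>p. p a) p = (if a = c then 1 else 0)"
  by (rule pd_eqI) (rule DERIV_coord)

lemma pd_mult:
  assumes "smooth_on I S h" "smooth_on J S g" "p \<in> S"
  shows "pd c (\<lambda>p. h p * g p) p = pd c h p * g p + h p * pd c g p"
  by (rule pd_eqI, rule DERIV_cong[OF DERIV_mult[OF pd_DERIV_smooth[OF assms(1,3)] pd_DERIV_smooth[OF assms(2,3)]]])
    simp

lemma pd_sum:
  assumes "\<And>a. a \<in> F \<Longrightarrow> smooth_on (I a) S (g a)" "p \<in> S"
  shows "pd c (\<lambda>p. \<Sum>a\<in>F. g a p) p = (\<Sum>a\<in>F. pd c (g a) p)"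
  by (rule pd_eqI, rule DERIV_sum, rule pd_DERIV_smooth[OF assms])

section \<open>Symmetry of mixed partial derivatives\<close>

text \<open>The mean value theorem is applied in direction \<open>c\<close> to the difference of
  \<open>h\<close> along two parallel edges of a square, and then in direction \<open>d\<close> to
  \<open>pd c h\<close>.\<close>

lemma second_difference_mvt:
  fixes p :: "'c \<Rightarrow> real"
  assumes h: "Ck_on (Suc (Suc k)) S h" and "c \<noteq> d" "\<delta> > 0"
    and box: "\<And>s t. s \<in> {p c..p c + \<delta>} \<Longrightarrow> t \<in> {p d..p d + \<delta>} \<Longrightarrow> p(c := s, d := t) \<in> S"
  shows "\<exists>s\<in>{p c..p c + \<delta>}. \<exists>t\<in>{p d..p d + \<delta>}.
    h (p(c := p c + \<delta>, d := p d + \<delta>)) - h (p(c := p c + \<delta>)) - h (p(d := p d + \<delta>)) + h p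
      = \<delta>\<^sup>2 * pd d (pd c h) (p(c := s, d := t))"
proof -
  have twist: "p(d := t, c := s) = p(c := s, d := t)" for s t
    using \<open>c \<noteq> d\<close> by (rule fun_upd_twist[symmetric])
  have triv: "p(c := s, d := p d) = p(c := s)" for s
    using \<open>c \<noteq> d\<close> by auto
  let ?u = "\<lambda>s. h (p(d := p d + \<delta>, c := s)) - h (p(d := p d, c := s))"
  have box': "p(d := t, c := s) \<in> S" if "s \<in> {p c..p c + \<delta>}" "t \<in> {p d..p d + \<delta>}" for s t
    using box[OF that] unfolding twist .
  have "\<exists>s>p c. s < p c + \<delta> \<and> ?u (p c + \<delta>) - ?u (p c) =
      (p c + \<delta> - p c) * (pd c h (p(d := p d + \<delta>, c := s)) - pd c h (p(d := p d, c := s)))"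
  proof (rule MVT2)
    fix s assume "p c \<le> s" "s \<le> p c + \<delta>"
    then have "p(d := p d + \<delta>, c := s) \<in> S" "p(d := p d, c := s) \<in> S"
      using box'[of s "p d + \<delta>"] box'[of s "p d"] \<open>\<delta> > 0\<close> by auto
    then show "(?u has_real_derivative pd c h (p(d := p d + \<delta>, c := s)) - pd c h (p(d := p d, c := s))) (at s)"
      by (intro DERIV_diff pd_DERIV'[OF h])
  qed (use \<open>\<delta> > 0\<close> in simp)
  then obtain s where s: "p c < s" "s < p c + \<delta>"
    "?u (p c + \<delta>) - ?u (p c) = \<delta> * (pd c h (p(d := p d + \<delta>, c := s)) - pd c h (p(d := p d, c := s)))"
    by auto
  have seg: "closed_segment (p d) (p d + \<delta>) = {p d..p d + \<delta>}"
    using \<open>\<delta> > 0\<close> by (simp add: closed_segment_eq_real_ivl)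
  obtain t where t: "t \<in> {p d..p d + \<delta>}"
    "pd c h (p(c := s, d := p d + \<delta>)) - pd c h (p(c := s, d := p d)) = \<delta> * pd d (pd c h) (p(c := s, d := t))"
    using line_mvt[OF Ck_on_pd[OF h], of "p d" "p d + \<delta>" "p(c := s)" d c] box[of s] s(1,2)
    unfolding seg by (auto simp del: fun_upd_apply)
  have "?u (p c + \<delta>) - ?u (p c) = \<delta>\<^sup>2 * pd d (pd c h) (p(c := s, d := t))"
    using s(3) t(2) unfolding twist by (simp only: power2_eq_square mult.assoc)
  then have "h (p(c := p c + \<delta>, d := p d + \<delta>)) - h (p(c := p c + \<delta>)) - h (p(d := p d + \<delta>)) + h p
      = \<delta>\<^sup>2 * pd d (pd c h) (p(c := s, d := t))"
    unfolding twist triv by (simp only: fun_upd_triv triv)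
  with s(1,2) t(1) show ?thesis by (intro bexI[of _ s] bexI[of _ t]) auto
qed

text \<open>The second difference is symmetric in \<open>c\<close> and \<open>d\<close>. Both mixed
  derivatives therefore occur, at points of a small box, as its quotient by
  \<open>\<delta>\<^sup>2\<close>, and their continuity brings these points back to
  \<open>p\<close>.\<close>

lemma pd_commute:
  fixes h :: "('c \<Rightarrow> real) \<Rightarrow> real"
  assumes S: "open S" and h: "Ck_on (Suc (Suc k)) S h" and p: "p \<in> S"
  shows "pd d (pd c h) p = pd c (pd d h) p"
proof (cases "c = d")
  case False
  have "\<bar>pd d (pd c h) p - pd c (pd d h) p\<bar> \<le> e" if "e > 0" for e
  proof -
    let ?N = "\<lambda>h. {q \<in> S. \<bar>h q - h p\<bar> < e / 2}"
    have N: "open (?N g)" if "continuous_on S g" for g :: "('c \<Rightarrow> real) \<Rightarrow> real"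
    proof -
      have "open {q \<in> S. g q \<in> ball (g p) (e / 2)}"
        by (rule open_preimage[OF S _ that]) simp
      then show ?thesis by (simp add: dist_real_def abs_minus_commute)
    qed
    have "open (?N (pd d (pd c h)) \<inter> ?N (pd c (pd d h)))"
      using h by (intro open_Int N) (auto intro!: Ck_on_imp_continuous[where k = k])
    moreover have "p \<in> ?N (pd d (pd c h)) \<inter> ?N (pd c (pd d h))" using p \<open>e > 0\<close> by simp
    ultimately obtain B r where B: "finite B" "r > 0"
      "{q. \<forall>c\<in>B. \<bar>q c - p c\<bar> < r} \<subseteq> ?N (pd d (pd c h)) \<inter> ?N (pd c (pd d h))"
      by (rule open_fun_box)
    define \<delta> where "\<delta> = r / 2"
    have \<delta>: "\<delta> > 0" "\<delta> < r" using B(2) by (auto simp: \<delta>_def)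
    have box: "p(c := s, d := t) \<in> ?N (pd d (pd c h)) \<inter> ?N (pd c (pd d h))"
      if "s \<in> {p c..p c + \<delta>}" "t \<in> {p d..p d + \<delta>}" for s t
      by (rule subsetD[OF B(3)]) (use that \<delta> in auto)
    obtain s t where st: "s \<in> {p c..p c + \<delta>}" "t \<in> {p d..p d + \<delta>}"
      "h (p(c := p c + \<delta>, d := p d + \<delta>)) - h (p(c := p c + \<delta>)) - h (p(d := p d + \<delta>)) + h p
        = \<delta>\<^sup>2 * pd d (pd c h) (p(c := s, d := t))"
      using second_difference_mvt[OF h False \<delta>(1), of p] box by blast
    have box': "p(d := t, c := s) \<in> ?N (pd d (pd c h)) \<inter> ?N (pd c (pd d h))"
      if "s \<in> {p c..p c + \<delta>}" "t \<in> {p d..p d + \<delta>}" for s t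
      using box[OF that] fun_upd_twist[OF False, of p s t] by simp
    obtain t' s' where st': "s' \<in> {p c..p c + \<delta>}" "t' \<in> {p d..p d + \<delta>}"
      "h (p(d := p d + \<delta>, c := p c + \<delta>)) - h (p(d := p d + \<delta>)) - h (p(c := p c + \<delta>)) + h p
        = \<delta>\<^sup>2 * pd c (pd d h) (p(d := t', c := s'))"
      using second_difference_mvt[OF h not_sym[OF False] \<delta>(1), of p] box' by blast
    have "\<delta>\<^sup>2 * pd d (pd c h) (p(c := s, d := t)) = \<delta>\<^sup>2 * pd c (pd d h) (p(d := t', c := s'))"
      using st(3) st'(3) unfolding fun_upd_twist[OF False, of p "p c + \<delta>" "p d + \<delta>"] by linarith
    then have "pd d (pd c h) (p(c := s, d := t)) = pd c (pd d h) (p(d := t', c := s'))"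
      using \<delta>(1) by simp
    moreover have "\<bar>pd d (pd c h) (p(c := s, d := t)) - pd d (pd c h) p\<bar> < e / 2"
      using box[OF st(1,2)] by blast
    moreover have "\<bar>pd c (pd d h) (p(d := t', c := s')) - pd c (pd d h) p\<bar> < e / 2"
      using box'[OF st'(1,2)] by blast
    ultimately show ?thesis by linarith
  qed
  then have "\<bar>pd d (pd c h) p - pd c (pd d h) p\<bar> \<le> 0"
    by (rule field_le_epsilon[where y = 0, simplified])
  then show ?thesis by simp
qed simp

section \<open>Lie derivatives\<close>

text \<open>The definition of \<open>lie\<close> sums over a set that varies with the point. A fixed
  finite index set gives an expression that can be differentiated term by term.\<close>

lemma lie_eq_sum:
  assumes "open S" "finite C" "depends_on C S h" "p \<in> S"
  shows "lie b h p = (\<Sum>c\<in>C. b c p * pd c h p)"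
proof -
  have "{c. pd c h p \<noteq> 0} \<subseteq> C" using pd_eq_0[OF assms(1,3,4)] by blast
  then show ?thesis unfolding lie_def
    by (intro sum.mono_neutral_left) (use assms(2) in auto)
qed

lemma lie_cong:
  assumes "open S" "p \<in> S" "\<And>q. q \<in> S \<Longrightarrow> h q = g q"
  shows "lie b h p = lie b g p"
proof -
  have "pd c h p = pd c g p" for c by (rule pd_cong[OF assms])
  then show ?thesis unfolding lie_def by simp
qed

lemma tder_cong:
  assumes "open S" "p \<in> S" "\<And>q. q \<in> S \<Longrightarrow> h q = g q"
  shows "tder b k h p = tder b k g p"
  using assms(2)
proof (induction k arbitrary: p)
  case (Suc k)
  then show ?case using lie_cong[OF assms(1), of p "tder b k h" "tder b k g" b] by simp
qed (use assms in simp)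

lemma smooth_on_lie:
  assumes "open S" "smooth_on I S h" "\<And>c. c \<in> I \<Longrightarrow> smooth_on J S (b c)" "I \<subseteq> J"
  shows "smooth_on J S (lie b h)"
proof -
  obtain C where C: "finite C" "C \<subseteq> I" "depends_on C S h" using assms(2) unfolding smooth_on_def by blast
  have "smooth_on J S (\<lambda>p. \<Sum>c\<in>C. b c p * pd c h p)"
    using C assms(3) smooth_on_mono[OF smooth_on_pd[OF assms(1,2)] assms(4)]
    by (intro smooth_on_sum smooth_on_mult assms(1)) auto
  then show ?thesis
    using smooth_on_cong[OF assms(1), of "lie b h" "\<lambda>p. \<Sum>c\<in>C. b c p * pd c h p" J]
      lie_eq_sum[OF assms(1) C(1,3)] by simp
qed

lemma smooth_on_tder:
  assumes "open S" "smooth_on I S h" "\<And>c. smooth_on I S (b c)"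
  shows "smooth_on I S (tder b k h)"
  by (induction k) (auto intro: smooth_on_lie assms)

lemma lie_coord: "lie b (\<lambda>p. p c) p = b c p"
  using lie_eq_sum[of UNIV "{c}" "\<lambda>p. p c" p b] by (simp add: depends_on_def pd_coord)

lemma lie_const: "lie b (\<lambda>p. a) p = 0"
  by (simp add: lie_def pd_const)

lemma lie_mult:
  assumes "open S" "smooth_on I S h" "smooth_on J S g" "p \<in> S"
  shows "lie b (\<lambda>p. h p * g p) p = lie b h p * g p + h p * lie b g p"
proof -
  obtain C where C: "finite C" "depends_on C S h" using smooth_onE[OF assms(2)] by metis
  obtain B where B: "finite B" "depends_on B S g" using smooth_onE[OF assms(3)] by metis
  let ?U = "C \<union> B"
  have "depends_on ?U S (\<lambda>p. h p * g p)" "depends_on ?U S h" "depends_on ?U S g"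
    using C B unfolding depends_on_def by (metis UnCI)+
  then show ?thesis
    using C B assms lie_eq_sum[OF assms(1) _ _ assms(4), of ?U] pd_mult[OF assms(2-4)]
    by (simp add: sum.distrib distrib_left sum_distrib_left sum_distrib_right mult_ac)
qed

lemma lie_sum:
  assumes "open S" "\<And>a. a \<in> F \<Longrightarrow> smooth_on I S (g a)" "p \<in> S" "finite F"
  shows "lie b (\<lambda>p. \<Sum>a\<in>F. g a p) p = (\<Sum>a\<in>F. lie b (g a) p)"
proof -
  have "\<exists>C. finite C \<and> depends_on C S (g a)" if "a \<in> F" for a
    using smooth_onE[OF assms(2)[OF that]] by metis
  then obtain C where C: "\<And>a. a \<in> F \<Longrightarrow> finite (C a)" "\<And>a. a \<in> F \<Longrightarrow> depends_on (C a) S (g a)"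
    by metis
  let ?U = "\<Union>(C ` F)"
  have fin: "finite ?U" using assms(4) C(1) by simp
  have dep: "depends_on ?U S (g a)" if "a \<in> F" for a
    by (rule depends_on_mono[OF C(2)[OF that]]) (use that in blast)
  then have "depends_on ?U S (\<lambda>p. \<Sum>a\<in>F. g a p)"
    unfolding depends_on_def by (metis (no_types, lifting) sum.cong)
  then have "lie b (\<lambda>p. \<Sum>a\<in>F. g a p) p = (\<Sum>c\<in>?U. b c p * pd c (\<lambda>p. \<Sum>a\<in>F. g a p) p)"
    by (rule lie_eq_sum[OF assms(1) fin _ assms(3)])
  also have "\<dots> = (\<Sum>c\<in>?U. \<Sum>a\<in>F. b c p * pd c (g a) p)"
  proof -
    have "pd c (\<lambda>p. \<Sum>a\<in>F. g a p) p = (\<Sum>a\<in>F. pd c (g a) p)" for c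
      by (rule pd_sum[where I = "\<lambda>_. I", OF assms(2,3)])
    then show ?thesis by (simp add: sum_distrib_left)
  qed
  also have "\<dots> = (\<Sum>a\<in>F. \<Sum>c\<in>?U. b c p * pd c (g a) p)" by (rule sum.swap)
  also have "\<dots> = (\<Sum>a\<in>F. lie b (g a) p)"
    using lie_eq_sum[OF assms(1) fin dep assms(3)] by simp
  finally show ?thesis .
qed

text \<open>Coordinate form of the fact that the Lie derivative commutes with the exterior
  derivative: the extra sum comes from the Lie derivatives of the coordinate differentials. Symmetry
  of second derivatives turns \<open>pd x (pd c h)\<close> into
  \<open>pd c (pd x h)\<close>.\<close>

lemma pd_lie:
  assumes "open S" "smooth_on I S h" "\<And>c. smooth_on J S (b c)" "p \<in> S" "finite C" "depends_on C S h"
  shows "pd x (lie b h) p = lie b (pd x h) p + (\<Sum>c\<in>C. pd x (b c) p * pd c h p)"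
proof -
  have "pd x (lie b h) p = pd x (\<lambda>p. \<Sum>c\<in>C. b c p * pd c h p) p"
    by (rule pd_cong[OF assms(1,4)]) (rule lie_eq_sum[OF assms(1,5,6)])
  also have "\<dots> = (\<Sum>c\<in>C. pd x (\<lambda>p. b c p * pd c h p) p)"
    by (rule pd_sum[where I = "\<lambda>_. UNIV", OF _ assms(4)])
      (intro smooth_on_mult assms(1) smooth_on_mono[OF assms(3)] smooth_on_mono[OF smooth_on_pd[OF assms(1,2)]], auto)
  also have "\<dots> = (\<Sum>c\<in>C. pd x (b c) p * pd c h p + b c p * pd c (pd x h) p)"
    using pd_mult[OF assms(3) smooth_on_pd[OF assms(1,2)] assms(4)]
      pd_commute[OF assms(1) smooth_on_Ck[OF assms(2)] assms(4)] by simp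
  also have "\<dots> = lie b (pd x h) p + (\<Sum>c\<in>C. pd x (b c) p * pd c h p)"
    using lie_eq_sum[OF assms(1,5) depends_on_pd[OF assms(1,6)] assms(4)] by (simp add: sum.distrib)
  finally show ?thesis .
qed

lemma lie_comp:
  assumes "open V" "smooth_on J V h" "finite C" "depends_on C V h"
    and "open W" "\<And>a. smooth_on I W (\<lambda>p. \<Phi> p a)" "\<And>p. p \<in> W \<Longrightarrow> \<Phi> p \<in> V" "p \<in> W"
  shows "lie b (\<lambda>p. h (\<Phi> p)) p = (\<Sum>a\<in>C. pd a h (\<Phi> p) * lie b (\<lambda>p. \<Phi> p a) p)"
proof -
  have "\<exists>B. finite B \<and> depends_on B W (\<lambda>p. \<Phi> p a)" for a
    using smooth_onE[OF assms(6)[of a]] by metis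
  then obtain B where B: "\<And>a. finite (B a)" "\<And>a. depends_on (B a) W (\<lambda>p. \<Phi> p a)" by metis
  let ?U = "\<Union>(B ` C)"
  have fin: "finite ?U" using B assms(3) by auto
  have dep: "depends_on ?U W (\<lambda>p. \<Phi> p a)" if "a \<in> C" for a
    by (rule depends_on_mono[OF B(2)]) (use that in blast)
  have "depends_on ?U W (\<lambda>p. h (\<Phi> p))"
    unfolding depends_on_def
  proof (intro ballI impI)
    fix p q assume *: "p \<in> W" "q \<in> W" "\<forall>c\<in>?U. p c = q c"
    then have "\<Phi> p a = \<Phi> q a" if "a \<in> C" for a
      using dep[OF that] unfolding depends_on_def by blast
    then show "h (\<Phi> p) = h (\<Phi> q)"
      using assms(4,7) * unfolding depends_on_def by blast
  qed
  then have "lie b (\<lambda>p. h (\<Phi> p)) p = (\<Sum>c\<in>?U. b c p * pd c (\<lambda>p. h (\<Phi> p)) p)"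
    by (rule lie_eq_sum[OF assms(5) fin _ assms(8)])
  also have "\<dots> = (\<Sum>c\<in>?U. \<Sum>a\<in>C. pd a h (\<Phi> p) * (b c p * pd c (\<lambda>p. \<Phi> p a) p))"
    using pd_comp[OF assms(1-4,6-8)] by (simp add: sum_distrib_left mult_ac)
  also have "\<dots> = (\<Sum>a\<in>C. \<Sum>c\<in>?U. pd a h (\<Phi> p) * (b c p * pd c (\<lambda>p. \<Phi> p a) p))"
    by (rule sum.swap)
  also have "\<dots> = (\<Sum>a\<in>C. pd a h (\<Phi> p) * lie b (\<lambda>p. \<Phi> p a) p)"
    using lie_eq_sum[OF assms(5) fin dep assms(8)] by (simp add: sum_distrib_left)
  finally show ?thesis .
qed

text \<open>The last hypothesis says that \<open>b\<close> and \<open>b'\<close> are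
  \<open>\<Phi>\<close>-related at \<open>p\<close>; by the chain rule, pulling back along
  \<open>\<Phi>\<close> then commutes with differentiation along the fields.\<close>

lemma lie_related:
  assumes "open V" "smooth_on J V h"
    and "open W" "\<And>a. smooth_on I W (\<lambda>p. \<Phi> p a)" "\<And>p. p \<in> W \<Longrightarrow> \<Phi> p \<in> V" "p \<in> W"
    and "\<And>a. lie b (\<lambda>p. \<Phi> p a) p = b' a (\<Phi> p)"
  shows "lie b (\<lambda>p. h (\<Phi> p)) p = lie b' h (\<Phi> p)"
proof -
  obtain C where C: "finite C" "depends_on C V h" using smooth_onE[OF assms(2)] by metis
  show ?thesis
    using lie_comp[OF assms(1,2) C assms(3-6)] lie_eq_sum[OF assms(1) C assms(5)[OF assms(6)]] assms(7)
    by (simp add: mult.commute)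
qed

text \<open>Iteration needs relatedness on all of \<open>W\<close>: an equality must hold near
  \<open>p\<close> before it can be differentiated again.\<close>

lemma tder_related:
  assumes "open V" "smooth_on J V h" "\<And>a. smooth_on J V (b' a)"
    and "open W" "\<And>a. smooth_on I W (\<lambda>p. \<Phi> p a)" "\<And>p. p \<in> W \<Longrightarrow> \<Phi> p \<in> V" "p \<in> W"
    and "\<And>p a. p \<in> W \<Longrightarrow> lie b (\<lambda>p. \<Phi> p a) p = b' a (\<Phi> p)"
  shows "tder b k (\<lambda>p. h (\<Phi> p)) p = tder b' k h (\<Phi> p)"
  using assms(7)
proof (induction k arbitrary: p)
  case (Suc k)
  have "tder b (Suc k) (\<lambda>p. h (\<Phi> p)) p = lie b (\<lambda>p. tder b' k h (\<Phi> p)) p"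
    using lie_cong[OF assms(4) Suc.prems Suc.IH] by simp
  also have "\<dots> = tder b' (Suc k) h (\<Phi> p)"
  proof -
    have "smooth_on J V (tder b' k h)" by (rule smooth_on_tder[OF assms(1-3)])
    then show ?thesis
      using lie_related[of V J _ W I \<Phi> p b b', OF assms(1) _ assms(4-6) Suc.prems assms(8)[OF Suc.prems]]
      by simp
  qed
  finally show ?case .
qed simp

lemma DERIV_integral_curve:
  assumes "open W" "smooth_on I W h" "integral_curve b W t0 t1 \<gamma>" "t \<in> {t0<..<t1}"
  shows "((\<lambda>s. h (\<gamma> s)) has_real_derivative lie b h (\<gamma> t)) (at t)"
proof -
  obtain C where C: "finite C" "depends_on C W h" using smooth_onE[OF assms(2)] by metis
  have \<gamma>: "\<gamma> t \<in> W" "\<And>c. ((\<lambda>s. \<gamma> s c) has_real_derivative b c (\<gamma> t)) (at t)"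
    using assms(3,4) unfolding integral_curve_def by auto
  show ?thesis
    using DERIV_curve[OF assms(1) smooth_on_Ck[OF assms(2)] C \<gamma>]
      lie_eq_sum[OF assms(1) C \<gamma>(1)] by (simp add: mult.commute)
qed

lemma deriv_funpow_cong:
  fixes t :: real
  assumes "t \<in> {t0<..<t1}" "\<And>s. s \<in> {t0<..<t1} \<Longrightarrow> F s = G s"
  shows "(deriv ^^ k) F t = (deriv ^^ k) G t"
  using assms(1)
proof (induction k arbitrary: t)
  case (Suc k)
  have "\<forall>\<^sub>F s in nhds t. (deriv ^^ k) F s = (deriv ^^ k) G s"
    using eventually_nhds_in_open[OF open_greaterThanLessThan Suc.prems]
    by (rule eventually_mono) (rule Suc.IH)
  then show ?case by (simp add: deriv_cong_ev)
qed (use assms in simp)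

lemma deriv_integral_curve:
  assumes "open W" "smooth_on I W h" "\<And>c. smooth_on I W (b c)" "integral_curve b W t0 t1 \<gamma>" "t \<in> {t0<..<t1}"
  shows "(deriv ^^ k) (\<lambda>s. h (\<gamma> s)) t = tder b k h (\<gamma> t)"
  using assms(5)
proof (induction k arbitrary: t)
  case (Suc k)
  have "\<forall>\<^sub>F s in nhds t. (deriv ^^ k) (\<lambda>s. h (\<gamma> s)) s = tder b k h (\<gamma> s)"
    using eventually_nhds_in_open[OF open_greaterThanLessThan Suc.prems]
    by (rule eventually_mono) (rule Suc.IH)
  then have "(deriv ^^ Suc k) (\<lambda>s. h (\<gamma> s)) t = deriv (\<lambda>s. tder b k h (\<gamma> s)) t"
    by (simp add: deriv_cong_ev)
  also have "\<dots> = lie b (tder b k h) (\<gamma> t)"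
    by (rule DERIV_imp_deriv)
      (rule DERIV_integral_curve[OF assms(1) smooth_on_tder[OF assms(1-3)] assms(4) Suc.prems])
  finally show ?case by simp
qed simp

section \<open>Exchange of coordinates\<close>

lemma continuous_on_realI:
  fixes k :: "'a::topological_space \<Rightarrow> real"
  assumes "\<And>x e. x \<in> S \<Longrightarrow> e > 0 \<Longrightarrow> \<exists>N. open N \<and> x \<in> N \<and> (\<forall>y\<in>N \<inter> S. \<bar>k y - k x\<bar> < e)"
  shows "continuous_on S k"
  unfolding continuous_on_def tendsto_iff eventually_at_topological dist_real_def
  using assms by (meson IntI)

text \<open>The implicit function theorem for one coordinate. On a box where \<open>pd b h\<close>
  keeps its sign, \<open>h\<close> is strictly monotone along lines in direction \<open>b\<close>;
  the intermediate value theorem gives existence of the solution \<open>k\<close>, and monotonicity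
  gives uniqueness. The outcome is a bijection between the open sets \<open>U\<close> and
  \<open>X\<close> that replaces coordinate \<open>b\<close> by the value of
  \<open>h\<close>.\<close>

lemma exchange_coordinate:
  fixes V :: "('c \<Rightarrow> real) set"
  assumes V: "open V" "y0 \<in> V" and h: "smooth_on UNIV V h" and b: "pd b h y0 \<noteq> 0"
  obtains U X k where "open U" "y0 \<in> U" "U \<subseteq> V" "open X" "smooth_on UNIV X k"
    "\<And>y. y \<in> U \<Longrightarrow> y(b := h y) \<in> X \<and> k (y(b := h y)) = y b"
    "\<And>x. x \<in> X \<Longrightarrow> x(b := k x) \<in> U \<and> h (x(b := k x)) = x b"
proof -
  obtain C where C: "finite C" "depends_on C V h" using smooth_onE[OF h] by metis
  \<comment> \<open>Multiplication by the sign \<open>s\<close> makes \<open>h\<close> increasing in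
    direction \<open>b\<close>, so both signs are treated at once.\<close>
  define s where "s = sgn (pd b h y0)"
  have s: "s \<noteq> 0" "s * pd b h y0 > 0" using b by (auto simp: s_def sgn_if)
  define V1 where "V1 = {y \<in> V. s * pd b h y \<in> {0<..}}"
  have "open V1" unfolding V1_def
    by (rule open_preimage[OF V(1)])
      (auto intro!: continuous_intros smooth_on_continuous[OF smooth_on_pd[OF V(1) h]])
  moreover have "y0 \<in> V1" using V s by (simp add: V1_def)
  ultimately obtain B0 e where B0: "finite B0" "e > 0" "{q. \<forall>c\<in>B0. \<bar>q c - y0 c\<bar> < e} \<subseteq> V1"
    by (rule open_fun_box)
  \<comment> \<open>Besides keeping the box inside \<open>V1\<close>, \<open>B\<close> contains
    \<open>b\<close> and everything \<open>h\<close> depends on. This makes the solution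
    \<open>k\<close> depend on the coordinates in \<open>B\<close> only.\<close>
  define B where "B = insert b (B0 \<union> C)"
  have B: "finite B" "b \<in> B" "C \<subseteq> B" using B0(1) C(1) by (auto simp: B_def)
  define U where "U = {q. \<forall>c\<in>B. \<bar>q c - y0 c\<bar> < e}"
  have UV1: "U \<subseteq> V1" using B0(3) by (auto simp: U_def B_def)
  have UV: "U \<subseteq> V" using UV1 by (auto simp: V1_def)
  have U: "open U" "y0 \<in> U" unfolding U_def using open_fun_cylinder[OF B(1)] B0(2) by auto
  have pdpos: "s * pd b h y > 0" if "y \<in> U" for y using UV1 that by (auto simp: V1_def)
  have hU: "Ck_on k U h" for k using Ck_on_subset[OF smooth_on_Ck[OF h] UV] .
  have seg: "x(a := t) \<in> U" if "x(a := u) \<in> U" "x(a := v) \<in> U" "t \<in> closed_segment u v" for x a t u v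
    unfolding U_def
  proof (intro CollectI ballI)
    fix c assume "c \<in> B"
    then have "\<bar>(x(a := u)) c - y0 c\<bar> < e" "\<bar>(x(a := v)) c - y0 c\<bar> < e"
      using that(1,2) unfolding U_def by blast+
    then show "\<bar>(x(a := t)) c - y0 c\<bar> < e"
      using closed_segment_bound[OF that(3), of "y0 c"] by (cases "c = a") auto
  qed
  have mono: "s * h (x(b := t)) < s * h (x(b := t'))" if t: "x(b := t) \<in> U" "x(b := t') \<in> U" "t < t'" for x t t'
  proof -
    obtain w where w: "w \<in> closed_segment t t'"
      "h (x(b := t')) - h (x(b := t)) = (t' - t) * pd b h (x(b := w))"
      using line_mvt[OF hU[of "Suc 0"] seg[OF t(1,2)]] by metis
    have "s * (h (x(b := t')) - h (x(b := t))) = (t' - t) * (s * pd b h (x(b := w)))"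
      unfolding w(2) by simp
    also have "\<dots> > 0" using pdpos[OF seg[OF t(1,2) w(1)]] t(3) by simp
    finally show ?thesis by (simp add: algebra_simps)
  qed
  \<comment> \<open>Strict inequalities at two parameters \<open>t\<close> and \<open>t'\<close>
    bracket \<open>x b\<close>. They define an open set without reference to the solution, and the
    intermediate value theorem applies between them.\<close>
  define X where "X = (\<Union>t. \<Union>t'. {x. x(b := t) \<in> U \<and> x(b := t') \<in> U \<and>
      s * h (x(b := t)) < s * x b \<and> s * x b < s * h (x(b := t'))})"
  have updc: "continuous_on T (\<lambda>x. x(b := t))" for T :: "('c \<Rightarrow> real) set" and t
    by (intro continuous_intros)
  have hc: "continuous_on {x. x(b := t) \<in> U} (\<lambda>x. h (x(b := t)))" for t
    by (rule continuous_on_compose2[OF Ck_on_imp_continuous[OF hU[of 0]] updc]) auto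
  have oU: "open {x. x(b := t) \<in> U}" for t
    using open_preimage[OF open_UNIV U(1) updc] by simp
  have o1: "open {x. x(b := t) \<in> U \<and> s * h (x(b := t)) < s * x b}" for t
  proof -
    have "continuous_on {x. x(b := t) \<in> U} (\<lambda>x. s * x b - s * h (x(b := t)))"
      by (intro continuous_intros hc)
    from open_preimage[OF oU open_greaterThan[of 0] this] show ?thesis by simp
  qed
  have o2: "open {x. x(b := t) \<in> U \<and> s * x b < s * h (x(b := t))}" for t
  proof -
    have "continuous_on {x. x(b := t) \<in> U} (\<lambda>x. s * h (x(b := t)) - s * x b)"
      by (intro continuous_intros hc)
    from open_preimage[OF oU open_greaterThan[of 0] this] show ?thesis by simp
  qed
  have opX: "open X"
  proof -
    have "X = (\<Union>t. \<Union>t'. {x. x(b := t) \<in> U \<and> s * h (x(b := t)) < s * x b} \<inter>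
        {x. x(b := t') \<in> U \<and> s * x b < s * h (x(b := t'))})"
      unfolding X_def by blast
    then show ?thesis using o1 o2 by (auto intro!: open_UN open_Int)
  qed
  have ex: "\<exists>t. x(b := t) \<in> U \<and> h (x(b := t)) = x b" if "x \<in> X" for x
  proof -
    from that obtain t t' where t: "x(b := t) \<in> U" "x(b := t') \<in> U"
      "s * h (x(b := t)) < s * x b" "s * x b < s * h (x(b := t'))" unfolding X_def by blast
    have "t \<le> t'"
    proof (rule ccontr)
      assume "\<not> t \<le> t'"
      then have "s * h (x(b := t')) < s * h (x(b := t))" using mono[OF t(2,1)] by simp
      then show False using t(3,4) by linarith
    qed
    have "continuous_on {t..t'} (\<lambda>u. h (x(b := u)))"
    proof (rule continuous_on_compose2[OF Ck_on_imp_continuous[OF hU[of 0]]])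
      show "continuous_on {t..t'} (\<lambda>u. x(b := u))" by (intro continuous_intros)
      show "(\<lambda>u. x(b := u)) ` {t..t'} \<subseteq> U"
        using seg[OF t(1,2)] \<open>t \<le> t'\<close> by (auto simp: closed_segment_eq_real_ivl)
    qed
    then have "continuous_on {t..t'} (\<lambda>u. s * h (x(b := u)))" by (intro continuous_intros)
    then obtain u where "t \<le> u" "u \<le> t'" "s * h (x(b := u)) = s * x b"
      using IVT'[of "\<lambda>u. s * h (x(b := u))" t "s * x b" t'] t(3,4) \<open>t \<le> t'\<close> by auto
    then show ?thesis
      using seg[OF t(1,2), of u] s(1) \<open>t \<le> t'\<close> by (auto simp: closed_segment_eq_real_ivl)
  qed
  define k where "k x = (SOME t. x(b := t) \<in> U \<and> h (x(b := t)) = x b)" for x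
  have k: "x(b := k x) \<in> U" "h (x(b := k x)) = x b" if "x \<in> X" for x
    using someI_ex[OF ex[OF that]] unfolding k_def by auto
  have kuniq: "k x = t" if "x \<in> X" "x(b := t) \<in> U" "h (x(b := t)) = x b" for x t
    using mono[OF k(1)[OF that(1)] that(2)] mono[OF that(2) k(1)[OF that(1)]] that(3) k(2)[OF that(1)]
    by (metis less_irrefl linorder_less_linear)
  \<comment> \<open>For \<open>x\<close> in \<open>X\<close> the constraints of the box on
    coordinates other than \<open>b\<close> already hold, so membership depends on \<open>t\<close>
    alone.\<close>
  have upd: "x(b := t) \<in> U \<longleftrightarrow> \<bar>t - y0 b\<bar> < e" if "x \<in> X" for x t
    using k(1)[OF that] B(2) unfolding U_def by (auto split: if_splits)
  have klt: "s * h (x(b := t)) < s * x b \<longleftrightarrow> t < k x" "s * x b < s * h (x(b := t)) \<longleftrightarrow> k x < t"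
    if "x \<in> X" "x(b := t) \<in> U" for x t
    using mono[OF k(1)[OF that(1)] that(2)] mono[OF that(2) k(1)[OF that(1)]] k(2)[OF that(1)]
    by (metis less_irrefl less_asym linorder_less_linear)+
  have kcont: "continuous_on X k"
  proof (rule continuous_on_realI)
    fix x and r :: real assume x: "x \<in> X" and "r > 0"
    have "\<bar>k x - y0 b\<bar> < e" using upd[OF x] k(1)[OF x] by blast
    define d where "d = min r (e - \<bar>k x - y0 b\<bar>) / 2"
    have d: "d > 0" "d < r" "\<bar>k x - y0 b\<bar> + d < e"
      unfolding d_def using \<open>r > 0\<close> \<open>\<bar>k x - y0 b\<bar> < e\<close> by (auto simp: min_def field_simps)
    \<comment> \<open>By monotonicity, \<open>k\<close> of a nearby point lies between
      \<open>k x - d\<close> and \<open>k x + d\<close> once \<open>h\<close> at these two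
      parameters brackets its coordinate \<open>b\<close>; both conditions are open.\<close>
    let ?N = "{x'. x'(b := k x - d) \<in> U \<and> s * h (x'(b := k x - d)) < s * x' b} \<inter>
        {x'. x'(b := k x + d) \<in> U \<and> s * x' b < s * h (x'(b := k x + d))}"
    have "x \<in> ?N" using klt[OF x] upd[OF x] d by auto
    moreover have "open ?N" by (intro open_Int o1 o2)
    moreover have "\<bar>k y - k x\<bar> < r" if "y \<in> ?N \<inter> X" for y
    proof -
      have "k x - d < k y" "k y < k x + d" using that klt[of y] by auto
      then show ?thesis using d(2) by linarith
    qed
    ultimately show "\<exists>N. open N \<and> x \<in> N \<and> (\<forall>y\<in>N \<inter> X. \<bar>k y - k x\<bar> < r)" by blast
  qed
  let ?G = "\<lambda>x. x(b := k x)"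
  \<comment> \<open>Implicit differentiation of \<open>h (x(b := k x)) = x b\<close>. For
    \<open>c = b\<close> the term with \<open>pd c h\<close> is absent, because the update
    overwrites coordinate \<open>b\<close>.\<close>
  let ?g = "\<lambda>c x. ((if c = b then 1 else 0) - (if c = b then 0 else pd c h (?G x))) * inverse (pd b h (?G x))"
  have kderiv: "((\<lambda>t. k (x(c := t))) has_real_derivative ?g c x) (at (x c))" if x: "x \<in> X" for x c
  proof -
    let ?x = "\<lambda>t. x(c := t)"
    let ?y = "?G x"
    \<comment> \<open>The defect of keeping the old solution \<open>k x\<close> at the moved point.
      It vanishes at \<open>t = x c\<close>, and by the mean value theorem it equals the increment
      of \<open>k\<close> times a nearby value of \<open>pd b h\<close>.\<close>
    let ?\<mu> = "\<lambda>t. (?x t) b - h ((?x t)(b := k x))"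
    have evX: "\<forall>\<^sub>F t in at (x c). ?x t \<in> X"
      using eventually_line[OF opX, of x c "x c"] x by (auto simp: eventually_nhds_conv_at)
    have \<mu>: "(?\<mu> has_real_derivative ((if c = b then 1 else 0) - (if c = b then 0 else pd c h ?y))) (at (x c))"
    proof (cases "c = b")
      case True
      then show ?thesis by (auto intro!: derivative_eq_intros)
    next
      case False
      have "((\<lambda>t. h (?y(c := t))) has_real_derivative pd c h ?y) (at (?y c))"
        by (rule pd_DERIV[OF hU k(1)[OF x]])
      moreover have "?y(c := t) = (?x t)(b := k x)" for t using False by auto
      ultimately have "((\<lambda>t. h ((?x t)(b := k x))) has_real_derivative pd c h ?y) (at (x c))"
        using False by simp
      from DERIV_diff[OF DERIV_const[of "x b"] this] show ?thesis using False by simp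
    qed
    have "\<exists>w. ?x t \<in> X \<longrightarrow> w \<in> closed_segment (k x) (k (?x t)) \<and>
        ?\<mu> t - ?\<mu> (x c) = (k (?x t) - k x) * pd b h ((?x t)(b := w))" for t
    proof (cases "?x t \<in> X")
      case True
      have "(?x t)(b := k x) \<in> U" using upd[OF True] upd[OF x] k(1)[OF x] by blast
      with k(1)[OF True] have "(?x t)(b := w) \<in> U" if "w \<in> closed_segment (k x) (k (?x t))" for w
        using seg that by blast
      then obtain w where "w \<in> closed_segment (k x) (k (?x t))"
        "h ((?x t)(b := k (?x t))) - h ((?x t)(b := k x)) = (k (?x t) - k x) * pd b h ((?x t)(b := w))"
        by (rule line_mvt[OF hU])
      moreover have "?\<mu> (x c) = 0" using k(2)[OF x] by simp
      ultimately show ?thesis using k(2)[OF True] by auto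
    qed auto
    then obtain w where w: "\<And>t. ?x t \<in> X \<Longrightarrow> w t \<in> closed_segment (k x) (k (?x t))"
      "\<And>t. ?x t \<in> X \<Longrightarrow> ?\<mu> t - ?\<mu> (x c) = (k (?x t) - k x) * pd b h ((?x t)(b := w t))"
      by metis
    have xlim: "(?x \<longlongrightarrow> x) (at (x c))"
    proof (rule tendsto_fun)
      fix a show "((\<lambda>t. (x(c := t)) a) \<longlongrightarrow> x a) (at (x c))" by (cases "a = c") auto
    qed
    have klim: "((\<lambda>t. k (?x t)) \<longlongrightarrow> k x) (at (x c))"
      by (rule continuous_on_tendsto_compose[OF kcont xlim x evX])
    have wlim: "(w \<longlongrightarrow> k x) (at (x c))"
    proof (rule Lim_null_comparison[where f = "\<lambda>t. w t - k x", THEN LIM_zero_cancel])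
      show "\<forall>\<^sub>F t in at (x c). norm (w t - k x) \<le> \<bar>k (?x t) - k x\<bar>"
        using evX
      proof eventually_elim
        case (elim t)
        show ?case using closed_segment_bound[OF w(1)[OF elim], of "k x"] by auto
      qed
      show "((\<lambda>t. \<bar>k (?x t) - k x\<bar>) \<longlongrightarrow> 0) (at (x c))"
        using tendsto_rabs[OF LIM_zero[OF klim]] by simp
    qed
    have ylim: "((\<lambda>t. (?x t)(b := w t)) \<longlongrightarrow> ?y) (at (x c))"
    proof (rule tendsto_fun)
      fix a show "((\<lambda>t. ((?x t)(b := w t)) a) \<longlongrightarrow> ?y a) (at (x c))"
        using wlim by (cases "a = b"; cases "a = c") auto
    qed
    have evU: "\<forall>\<^sub>F t in at (x c). (?x t)(b := w t) \<in> U"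
      using ylim U(1) k(1)[OF x] by (rule topological_tendstoD)
    have pdlim: "((\<lambda>t. pd b h ((?x t)(b := w t))) \<longlongrightarrow> pd b h ?y) (at (x c))"
      by (rule continuous_on_tendsto_compose[OF Ck_on_imp_continuous[OF Ck_on_pd[OF hU[of "Suc 0"]]] ylim k(1)[OF x] evU])
    have "((\<lambda>t. (?\<mu> t - ?\<mu> (x c)) / (t - x c) * inverse (pd b h ((?x t)(b := w t)))) \<longlongrightarrow> ?g c x) (at (x c))"
      using \<mu> pdpos[OF k(1)[OF x]] unfolding has_field_derivative_iff
      by (intro tendsto_mult tendsto_inverse pdlim) auto
    then show ?thesis unfolding has_field_derivative_iff
    proof (rule Lim_transform_eventually)
      show "\<forall>\<^sub>F t in at (x c). (?\<mu> t - ?\<mu> (x c)) / (t - x c) * inverse (pd b h ((?x t)(b := w t))) =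
          (k (?x t) - k (?x (x c))) / (t - x c)"
        using evX evU
      proof eventually_elim
        case (elim t)
        have "pd b h ((?x t)(b := w t)) \<noteq> 0" using pdpos[OF elim(2)] by force
        then show ?case unfolding w(2)[OF elim(1)] by simp
      qed
    qed
  qed
  \<comment> \<open>Bootstrapping: the partial derivatives of \<open>k\<close> are expressions in
    \<open>k\<close> itself and in derivatives of \<open>h\<close>, so each order of
    differentiability yields the next.\<close>
  have kC: "Ck_on n X k" for n
  proof (induction n)
    case 0
    then show ?case using kcont by simp
  next
    case (Suc n)
    have G: "Ck_on n X (\<lambda>x. ?G x a)" for a
      using Suc Ck_on_coord[OF opX] by (cases "a = b") auto
    have pdG: "Ck_on n X (\<lambda>x. pd c h (?G x))" for c
      by (rule Ck_on_comp[OF opX U(1) Ck_on_pd[OF hU] C(1) depends_on_pd[OF U(1) depends_on_subset[OF C(2) UV]] G k(1)])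
    have neg: "Ck_on n X (\<lambda>x. (- 1) * pd c h (?G x))" for c
      by (rule Ck_on_mult[OF opX Ck_on_const[OF opX] pdG])
    have num: "Ck_on n X (\<lambda>x. (if c = b then 1 else 0) - (if c = b then 0 else pd c h (?G x)))" for c
      using neg[of c] by (cases "c = b") (simp_all add: Ck_on_const opX)
    have inv: "Ck_on n X (\<lambda>x. inverse (pd b h (?G x)))"
      by (rule Ck_on_inverse[OF opX pdG]) (use pdpos[OF k(1)] in force)
    show ?case
      by (rule Ck_on_SucI[OF opX kcont kderiv Ck_on_mult[OF opX num inv]])
  qed
  have kdep: "depends_on B X k"
    unfolding depends_on_def
  proof (intro ballI impI)
    fix x x' assume x: "x \<in> X" "x' \<in> X" "\<forall>c\<in>B. x c = x' c"
    have inU: "x(b := k x') \<in> U" using upd[OF x(1)] upd[OF x(2)] k(1)[OF x(2)] by blast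
    have "\<forall>c\<in>C. (x(b := k x')) c = (x'(b := k x')) c" using x(3) B(3) by auto
    then have "h (x(b := k x')) = h (x'(b := k x'))"
      using C(2) inU k(1)[OF x(2)] UV unfolding depends_on_def by blast
    also have "\<dots> = x b" using k(2)[OF x(2)] x(3) B(2) by simp
    finally show "k x = k x'" by (rule kuniq[OF x(1) inU])
  qed
  have EX: "y(b := h y) \<in> X" if y: "y \<in> U" for y
  proof -
    have ye: "\<bar>y b - y0 b\<bar> < e" using y B(2) by (auto simp: U_def)
    have inU: "y(b := t) \<in> U" if "\<bar>t - y0 b\<bar> < e" for t
      using y that by (auto simp: U_def)
    \<comment> \<open>Half the distance to the edge of the box leaves room on both sides of
      \<open>y b\<close> for parameters at which \<open>h\<close> brackets
      \<open>h y\<close>.\<close>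
    define d where "d = (e - \<bar>y b - y0 b\<bar>) / 2"
    have d: "d > 0" "\<bar>y b - y0 b\<bar> + d < e" using ye by (auto simp: d_def field_simps)
    have t: "y(b := y b - d) \<in> U" "y(b := y b + d) \<in> U" using d by (auto intro!: inU)
    have "s * h (y(b := y b - d)) < s * h (y(b := y b))" "s * h (y(b := y b)) < s * h (y(b := y b + d))"
      using mono[of y "y b - d" "y b"] mono[of y "y b" "y b + d"] t y d(1) by auto
    then have "y(b := h y) \<in> {x. x(b := y b - d) \<in> U \<and> x(b := y b + d) \<in> U \<and>
      s * h (x(b := y b - d)) < s * x b \<and> s * x b < s * h (x(b := y b + d))}" using t by simp
    then show ?thesis unfolding X_def by blast
  qed
  show thesis
  proof (rule that[OF U UV opX smooth_onI[OF B(1) subset_UNIV kdep kC]])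
    fix y assume y: "y \<in> U"
    have "k (y(b := h y)) = y b" by (rule kuniq[OF EX[OF y]]) (use y in auto)
    with EX[OF y] show "y(b := h y) \<in> X \<and> k (y(b := h y)) = y b" ..
  qed (use k in blast)
qed

text \<open>In the coordinates obtained so far, the next function must have a nonzero derivative in
  the direction of some coordinate of \<open>B\<close> not yet exchanged; otherwise its
  differential, restricted to \<open>B\<close>, would be a combination of the earlier ones.
  Independence is required of the columns in \<open>B\<close> so that the exchanged coordinates can
  all be found there.\<close>

lemma exchange_coordinates:
  fixes V :: "('c \<Rightarrow> real) set"
  assumes V: "open V" "y0 \<in> V" and I: "finite I" and h: "\<And>i. i \<in> I \<Longrightarrow> smooth_on UNIV V (h i)"
    and indep: "\<And>a. (\<forall>x\<in>B. (\<Sum>i\<in>I. a i * pd x (h i) y0) = 0) \<Longrightarrow> \<forall>i\<in>I. a i = 0"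
  shows "\<exists>c T G U X. inj_on c I \<and> c ` I \<subseteq> B \<and> open U \<and> y0 \<in> U \<and> U \<subseteq> V \<and> open X \<and>
    (\<forall>i\<in>I. \<forall>y. T y (c i) = h i y) \<and> (\<forall>a y. a \<notin> c ` I \<longrightarrow> T y a = y a) \<and>
    (\<forall>a. smooth_on UNIV U (\<lambda>y. T y a)) \<and> (\<forall>a. smooth_on UNIV X (\<lambda>x. G x a)) \<and>
    (\<forall>y\<in>U. T y \<in> X \<and> G (T y) = y) \<and> (\<forall>x\<in>X. G x \<in> U \<and> T (G x) = x)"
proof -
  have h': "\<forall>i\<in>I. smooth_on UNIV V (h i)" using h by blast
  have indep': "\<forall>a. (\<forall>x\<in>B. (\<Sum>i\<in>I. a i * pd x (h i) y0) = 0) \<longrightarrow> (\<forall>i\<in>I. a i = 0)"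
    using indep by blast
  show ?thesis
    using I h' indep'
  proof (induction I)
    case empty
    show ?case
      by (rule exI[of _ undefined], rule exI[of _ id], rule exI[of _ id], rule exI[of _ V], rule exI[of _ V])
        (use V smooth_on_coord[OF V(1)] in auto)
  next
    case (insert i I)
    have indepI: "\<forall>j\<in>I. a j = 0" if "\<forall>x\<in>B. (\<Sum>j\<in>I. a j * pd x (h j) y0) = 0" for a
    proof -
      have "\<forall>x\<in>B. (\<Sum>j\<in>insert i I. (a(i := 0)) j * pd x (h j) y0) = 0"
      proof
        fix x assume "x \<in> B"
        have "(\<Sum>j\<in>I. (a(i := 0)) j * pd x (h j) y0) = (\<Sum>j\<in>I. a j * pd x (h j) y0)"
          using insert.hyps by (intro sum.cong) auto
        with that \<open>x \<in> B\<close> insert.hyps show "(\<Sum>j\<in>insert i I. (a(i := 0)) j * pd x (h j) y0) = 0"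
          by simp
      qed
      then have "\<forall>j\<in>insert i I. (a(i := 0)) j = 0" using insert.prems(2) by blast
      then show ?thesis using insert.hyps by (metis fun_upd_other insert_iff)
    qed
    obtain c T G U X where IH: "inj_on c I" "c ` I \<subseteq> B" "open U" "y0 \<in> U" "U \<subseteq> V" "open X"
      and T: "\<And>j y. j \<in> I \<Longrightarrow> T y (c j) = h j y" "\<And>a y. a \<notin> c ` I \<Longrightarrow> T y a = y a"
      and sm: "\<And>a. smooth_on UNIV U (\<lambda>y. T y a)" "\<And>a. smooth_on UNIV X (\<lambda>x. G x a)"
      and TG: "\<And>y. y \<in> U \<Longrightarrow> T y \<in> X" "\<And>y. y \<in> U \<Longrightarrow> G (T y) = y"
        "\<And>x. x \<in> X \<Longrightarrow> G x \<in> U" "\<And>x. x \<in> X \<Longrightarrow> T (G x) = x"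
    proof -
      have hI: "\<forall>j\<in>I. smooth_on UNIV V (h j)" using insert.prems(1) by simp
      have indI: "\<forall>a. (\<forall>x\<in>B. (\<Sum>i\<in>I. a i * pd x (h i) y0) = 0) \<longrightarrow> (\<forall>i\<in>I. a i = 0)"
        using indepI by blast
      from insert.IH[OF hI indI] show thesis
      proof (elim exE conjE)
        fix c T G U X
        assume *: "inj_on c I" "c ` I \<subseteq> B" "open U" "y0 \<in> U" "U \<subseteq> V" "open X"
          "\<forall>i\<in>I. \<forall>y. T y (c i) = h i y" "\<forall>a y. a \<notin> c ` I \<longrightarrow> T y a = y a"
          "\<forall>a. smooth_on UNIV U (\<lambda>y. T y a)" "\<forall>a. smooth_on UNIV X (\<lambda>x. G x a)"
          "\<forall>y\<in>U. T y \<in> X \<and> G (T y) = y" "\<forall>x\<in>X. G x \<in> U \<and> T (G x) = x"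
        show thesis by (rule that[of c U X T G]) (use * in simp_all)
      qed
    qed
    have hi: "smooth_on UNIV U (h i)" using insert.prems(1) smooth_on_mono IH(5) by blast
    define k where "k x = h i (G x)" for x
    have k: "smooth_on UNIV X k"
      unfolding k_def by (rule smooth_on_comp[OF IH(6,3) hi sm(2) TG(3)])
    have kT: "k (T y) = h i y" if "y \<in> U" for y using TG(2)[OF that] by (simp add: k_def)
    have "\<exists>b\<in>B - c ` I. pd b k (T y0) \<noteq> 0"
    proof (rule ccontr)
      assume "\<not> ?thesis"
      then have zero: "pd b k (T y0) = 0" if "b \<in> B" "b \<notin> c ` I" for b using that by blast
      obtain C0 where C0: "finite C0" "depends_on C0 X k" using smooth_onE[OF k] by metis
      define C where "C = C0 - c ` I"
      have C: "finite (C \<union> c ` I)" "depends_on (C \<union> c ` I) X k" "C \<inter> c ` I = {}"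
        using C0 insert.hyps depends_on_mono[OF C0(2)] by (auto simp: C_def)
      have eq: "pd x (h i) y0 = (\<Sum>j\<in>I. pd (c j) k (T y0) * pd x (h j) y0)" if "x \<in> B" for x
      proof -
        have "pd x (h i) y0 = pd x (\<lambda>y. k (T y)) y0"
          by (rule pd_cong[OF IH(3,4)]) (simp add: kT)
        also have "\<dots> = (\<Sum>a\<in>C \<union> c ` I. pd a k (T y0) * pd x (\<lambda>y. T y a) y0)"
          by (rule pd_comp[OF IH(6) k C(1,2) sm(1) TG(1) IH(4)])
        also have "\<dots> = (\<Sum>a\<in>C. pd a k (T y0) * pd x (\<lambda>y. T y a) y0) + (\<Sum>a\<in>c ` I. pd a k (T y0) * pd x (\<lambda>y. T y a) y0)"
          using C by (intro sum.union_disjoint) auto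
        \<comment> \<open>If \<open>a\<close> is in \<open>B\<close>, then \<open>pd a k\<close>
          vanishes by \<open>zero\<close>; if not, \<open>a\<close> differs from \<open>x\<close>,
          and the derivative of coordinate \<open>a\<close> in direction \<open>x\<close>
          vanishes.\<close>
        also have "(\<Sum>a\<in>C. pd a k (T y0) * pd x (\<lambda>y. T y a) y0) = 0"
        proof (rule sum.neutral, rule ballI)
          fix a assume "a \<in> C"
          then have a: "a \<notin> c ` I" using C(3) by blast
          have "(\<lambda>y. T y a) = (\<lambda>y. y a)" using T(2)[OF a] by auto
          then show "pd a k (T y0) * pd x (\<lambda>y. T y a) y0 = 0"
            using zero[of a] a \<open>x \<in> B\<close> by (auto simp: pd_coord)
        qed
        also have "(\<Sum>a\<in>c ` I. pd a k (T y0) * pd x (\<lambda>y. T y a) y0) = (\<Sum>j\<in>I. pd (c j) k (T y0) * pd x (h j) y0)"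
          unfolding sum.reindex[OF IH(1)] comp_def by (rule sum.cong) (simp_all add: T(1))
        finally show ?thesis by simp
      qed
      let ?a = "\<lambda>j. if j = i then - 1 else pd (c j) k (T y0)"
      have "\<forall>x\<in>B. (\<Sum>j\<in>insert i I. ?a j * pd x (h j) y0) = 0"
      proof
        fix x assume "x \<in> B"
        have "(\<Sum>j\<in>I. ?a j * pd x (h j) y0) = (\<Sum>j\<in>I. pd (c j) k (T y0) * pd x (h j) y0)"
          by (rule sum.cong) (use insert.hyps in auto)
        then show "(\<Sum>j\<in>insert i I. ?a j * pd x (h j) y0) = 0"
          using eq[OF \<open>x \<in> B\<close>] insert.hyps by simp
      qed
      then have "\<forall>j\<in>insert i I. ?a j = 0" by (rule insert.prems(2)[THEN spec, THEN mp])
      then show False by simp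
    qed
    then obtain b where b: "b \<in> B" "b \<notin> c ` I" "pd b k (T y0) \<noteq> 0" by blast
    obtain U2 X2 l where E: "open U2" "T y0 \<in> U2" "U2 \<subseteq> X" "open X2" "smooth_on UNIV X2 l"
      "\<And>y. y \<in> U2 \<Longrightarrow> y(b := k y) \<in> X2 \<and> l (y(b := k y)) = y b"
      "\<And>x. x \<in> X2 \<Longrightarrow> x(b := l x) \<in> U2 \<and> k (x(b := l x)) = x b"
      using exchange_coordinate[OF IH(6) TG(1)[OF IH(4)] k b(3)] by metis
    define U' where "U' = {y \<in> U. T y \<in> U2}"
    define T' where "T' y = (T y)(b := h i y)" for y
    define G' where "G' x = G (x(b := l x))" for x
    define c' where "c' = c(i := b)"
    have c'I: "c' j = c j" if "j \<in> I" for j using that insert.hyps by (auto simp: c'_def)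
    have c'im: "c' ` insert i I = insert b (c ` I)"
    proof -
      have "c' ` I = c ` I" by (rule image_cong[OF refl c'I])
      moreover have "c' i = b" by (simp add: c'_def)
      ultimately show ?thesis by simp
    qed
    have T'U: "T' y = (T y)(b := k (T y))" if "y \<in> U" for y using kT[OF that] by (simp add: T'_def)
    have "open U'" unfolding U'_def by (rule open_preimage[OF IH(3) E(1) smooth_on_map_continuous[OF sm(1)]])
    moreover have "y0 \<in> U'" using IH(4) E(2) by (simp add: U'_def)
    moreover have "U' \<subseteq> V" using IH(5) by (auto simp: U'_def)
    moreover have "inj_on c' (insert i I)"
      using IH(1) b(2) insert.hyps c'I by (auto simp: inj_on_def c'_def)
    moreover have "c' ` insert i I \<subseteq> B" unfolding c'im using b(1) IH(2) by blast
    moreover have "\<forall>j\<in>insert i I. \<forall>y. T' y (c' j) = h j y"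
      using T(1) b(2) insert.hyps by (auto simp: T'_def c'_def)
    moreover have "\<forall>a y. a \<notin> c' ` insert i I \<longrightarrow> T' y a = y a"
      unfolding c'im using T(2) by (auto simp: T'_def)
    moreover have "\<forall>a. smooth_on UNIV U' (\<lambda>y. T' y a)"
    proof
      fix a
      have "U' \<subseteq> U" by (auto simp: U'_def)
      then show "smooth_on UNIV U' (\<lambda>y. T' y a)"
        using smooth_on_mono[OF sm(1)] smooth_on_mono[OF hi] by (cases "a = b") (auto simp: T'_def)
    qed
    moreover have "\<forall>a. smooth_on UNIV X2 (\<lambda>x. G' x a)"
    proof
      fix a
      show "smooth_on UNIV X2 (\<lambda>x. G' x a)"
        unfolding G'_def
      proof (rule smooth_on_comp[OF E(4) IH(6) sm(2)])
        fix d show "smooth_on UNIV X2 (\<lambda>x. (x(b := l x)) d)"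
          using E(5) smooth_on_coord[OF E(4)] by (cases "d = b") auto
      qed (use E(3,7) in blast)
    qed
    moreover have "\<forall>y\<in>U'. T' y \<in> X2 \<and> G' (T' y) = y"
    proof
      fix y assume "y \<in> U'"
      then have y: "y \<in> U" "T y \<in> U2" by (auto simp: U'_def)
      then show "T' y \<in> X2 \<and> G' (T' y) = y"
        using E(6)[OF y(2)] TG(2)[OF y(1)] unfolding G'_def T'U[OF y(1)] by simp
    qed
    moreover have "\<forall>x\<in>X2. G' x \<in> U' \<and> T' (G' x) = x"
    proof
      fix x assume "x \<in> X2"
      then have x: "x(b := l x) \<in> U2" "k (x(b := l x)) = x b" using E(7) by blast+
      then have GU: "G' x \<in> U" and TG': "T (G' x) = x(b := l x)"
        using E(3) TG(3,4) unfolding G'_def by blast+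
      then show "G' x \<in> U' \<and> T' (G' x) = x"
        using x T'U[OF GU] by (simp add: U'_def)
    qed
    moreover note E(4)
    ultimately show ?case
      by - (rule exI[of _ c'], rule exI[of _ T'], rule exI[of _ G'], rule exI[of _ U'], rule exI[of _ X2],
        (rule conjI | assumption)+)
  qed
qed

section \<open>Linear independence of differentials\<close>

text \<open>Independence over the reals of covectors at a single point, in contrast to
  \<open>diff_independent\<close>, whose coefficients are smooth functions.\<close>

definition lin_independent :: "('k \<Rightarrow> 'c \<Rightarrow> real) \<Rightarrow> 'k set \<Rightarrow> bool" where
  "lin_independent v K \<longleftrightarrow> (\<forall>a. (\<forall>x. (\<Sum>k\<in>K. a k * v k x) = 0) \<longrightarrow> (\<forall>k\<in>K. a k = 0))"

lemma lin_independent_subset: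
  assumes "lin_independent v K" "I \<subseteq> K" "finite K"
  shows "lin_independent v I"
  unfolding lin_independent_def
proof (intro allI impI)
  fix a assume a: "\<forall>x. (\<Sum>k\<in>I. a k * v k x) = 0"
  let ?a = "\<lambda>k. if k \<in> I then a k else 0"
  have "(\<Sum>k\<in>K. ?a k * v k x) = (\<Sum>k\<in>I. a k * v k x)" for x
    using assms(2,3) by (intro sum.mono_neutral_cong_right) auto
  then have "\<forall>x. (\<Sum>k\<in>K. ?a k * v k x) = 0" using a by simp
  then have "\<forall>k\<in>K. ?a k = 0" by (rule assms(1)[unfolded lin_independent_def, THEN spec, THEN mp])
  then show "\<forall>k\<in>I. a k = 0" using assms(2) by (auto split: if_splits dest!: bspec)
qed

text \<open>Pairing \<open>e\<close> with itself leaves only the term of \<open>k0\<close>, so the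
  squared norm of \<open>e\<close> is \<open>c k0\<close> times the pairing of \<open>e\<close> with
  \<open>v k0\<close>. Pairing any vanishing combination with a nonzero \<open>e\<close> likewise
  isolates its coefficient at \<open>k0\<close>. Thus \<open>e\<close> detects whether
  \<open>v k0\<close> enlarges an independent family.\<close>

lemma orthogonal_combination_eq_0:
  fixes v :: "'k \<Rightarrow> 'c \<Rightarrow> real"
  assumes fin: "finite C" "finite I" "k0 \<notin> I" and v: "\<And>k x. x \<notin> C \<Longrightarrow> v k x = 0"
    and e: "\<And>x. e x = (\<Sum>k\<in>insert k0 I. c k * v k x)"
    and orth: "\<And>i. i \<in> I \<Longrightarrow> (\<Sum>x\<in>C. e x * v i x) = 0"
    and c: "c k0 \<noteq> 0 \<longleftrightarrow> lin_independent v I"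
  shows "lin_independent v (insert k0 I) \<longleftrightarrow> (\<exists>x. e x \<noteq> 0)"
proof
  assume indep: "lin_independent v (insert k0 I)"
  then have "c k0 \<noteq> 0" using c lin_independent_subset[OF indep] fin(2) by auto
  show "\<exists>x. e x \<noteq> 0"
  proof (rule ccontr)
    assume "\<not> ?thesis"
    then have "\<forall>x. (\<Sum>k\<in>insert k0 I. c k * v k x) = 0" using e by simp
    then have "\<forall>k\<in>insert k0 I. c k = 0" using indep unfolding lin_independent_def by blast
    with \<open>c k0 \<noteq> 0\<close> show False by simp
  qed
next
  assume ex: "\<exists>x. e x \<noteq> 0"
  have ee: "(\<Sum>x\<in>C. e x * e x) = c k0 * (\<Sum>x\<in>C. e x * v k0 x)"
  proof -
    have "(\<Sum>x\<in>C. e x * e x) = (\<Sum>x\<in>C. \<Sum>k\<in>insert k0 I. c k * (e x * v k x))"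
      by (subst (2) e) (simp add: sum_distrib_left mult_ac)
    also have "\<dots> = (\<Sum>k\<in>insert k0 I. c k * (\<Sum>x\<in>C. e x * v k x))"
      by (subst sum.swap) (simp add: sum_distrib_left)
    also have "\<dots> = c k0 * (\<Sum>x\<in>C. e x * v k0 x)" using orth fin by simp
    finally show ?thesis .
  qed
  have pos: "(\<Sum>x\<in>C. e x * e x) \<noteq> 0"
  proof
    assume "(\<Sum>x\<in>C. e x * e x) = 0"
    then have "\<forall>x\<in>C. e x = 0" using fin(1) by (simp add: sum_nonneg_eq_0_iff)
    moreover have "e x = 0" if "x \<notin> C" for x using v[OF that] e by simp
    ultimately show False using ex by blast
  qed
  have "c k0 \<noteq> 0" using pos ee by auto
  then have indI: "lin_independent v I" using c by simp
  show "lin_independent v (insert k0 I)"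
    unfolding lin_independent_def
  proof (intro allI impI)
    fix a assume a: "\<forall>x. (\<Sum>k\<in>insert k0 I. a k * v k x) = 0"
    have "0 = (\<Sum>x\<in>C. e x * (\<Sum>k\<in>insert k0 I. a k * v k x))" using a by simp
    also have "\<dots> = (\<Sum>k\<in>insert k0 I. a k * (\<Sum>x\<in>C. e x * v k x))"
      by (simp only: sum_distrib_left, subst sum.swap) (simp add: sum_distrib_left mult_ac)
    also have "\<dots> = a k0 * (\<Sum>x\<in>C. e x * v k0 x)" using orth fin by simp
    finally have a0: "a k0 = 0" using pos ee by auto
    then have "\<forall>x. (\<Sum>k\<in>I. a k * v k x) = 0" using a fin by simp
    then show "\<forall>k\<in>insert k0 I. a k = 0" using indI a0 unfolding lin_independent_def by blast
  qed
qed

text \<open>Gram--Schmidt orthogonalisation without divisions, so that all coefficients stay smooth at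
  points where the rank drops.\<close>

lemma smooth_gram_schmidt:
  fixes v :: "'k \<Rightarrow> ('c \<Rightarrow> real) \<Rightarrow> 'c \<Rightarrow> real"
  assumes D: "open D" and C: "finite C" and I: "finite I" "k0 \<notin> I" "insert k0 I \<subseteq> K"
    and v: "\<And>k x. k \<in> K \<Longrightarrow> smooth_on UNIV D (\<lambda>q. v k q x)"
    and v0: "\<And>k q x. q \<in> D \<Longrightarrow> x \<notin> C \<Longrightarrow> v k q x = 0"
  shows "\<exists>c. (\<forall>k. smooth_on UNIV D (c k)) \<and>
    (\<forall>q\<in>D. (c k0 q \<noteq> 0 \<longleftrightarrow> lin_independent (\<lambda>k. v k q) I) \<and>
      (\<forall>i\<in>I. (\<Sum>x\<in>C. (\<Sum>k\<in>insert k0 I. c k q * v k q x) * v i q x) = 0))"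
  using I
proof (induction I arbitrary: k0)
  case empty
  show ?case
    by (rule exI[of _ "\<lambda>k q. 1"]) (auto intro: smooth_on_const D simp: lin_independent_def)
next
  case (insert i I)
  obtain c1 where c1: "\<And>k. smooth_on UNIV D (c1 k)"
    "\<And>q. q \<in> D \<Longrightarrow> c1 i q \<noteq> 0 \<longleftrightarrow> lin_independent (\<lambda>k. v k q) I"
    "\<And>q j. q \<in> D \<Longrightarrow> j \<in> I \<Longrightarrow> (\<Sum>x\<in>C. (\<Sum>k\<in>insert i I. c1 k q * v k q x) * v j q x) = 0"
    using insert.IH[of i] insert.hyps insert.prems by auto
  obtain c2 where c2: "\<And>k. smooth_on UNIV D (c2 k)"
    "\<And>q. q \<in> D \<Longrightarrow> c2 k0 q \<noteq> 0 \<longleftrightarrow> lin_independent (\<lambda>k. v k q) I"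
    "\<And>q j. q \<in> D \<Longrightarrow> j \<in> I \<Longrightarrow> (\<Sum>x\<in>C. (\<Sum>k\<in>insert k0 I. c2 k q * v k q x) * v j q x) = 0"
    using insert.IH[of k0] insert.hyps insert.prems by auto
  define e1 where "e1 q x = (\<Sum>k\<in>insert i I. c1 k q * v k q x)" for q x
  define e2 where "e2 q x = (\<Sum>k\<in>insert k0 I. c2 k q * v k q x)" for q x
  define n1 where "n1 q = (\<Sum>x\<in>C. e1 q x * e1 q x)" for q
  define n2 where "n2 q = (\<Sum>x\<in>C. e2 q x * e1 q x)" for q
  \<comment> \<open>Extension by zero: \<open>e1\<close> has no term for \<open>k0\<close> and
    \<open>e2\<close> none for \<open>i\<close>, so both become sums over the same index
    set.\<close>
  define b1 where "b1 k = (if k = k0 then (\<lambda>q. 0) else c1 k)" for k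
  define b2 where "b2 k = (if k = i then (\<lambda>q. 0) else c2 k)" for k
  \<comment> \<open>This makes \<open>e\<close> the component of \<open>e2\<close> orthogonal to
    \<open>e1\<close>, multiplied by the squared norm \<open>n1\<close> in order to avoid dividing
    by it.\<close>
  define c where "c k q = n1 q * b2 k q - n2 q * b1 k q" for k q
  define e where "e q x = (\<Sum>k\<in>insert k0 (insert i I). c k q * v k q x)" for q x
  have sm: "smooth_on UNIV D (\<lambda>q. e1 q x)" "smooth_on UNIV D (\<lambda>q. e2 q x)" for x
    unfolding e1_def e2_def using insert.hyps(1) insert.prems c1(1) c2(1)
    by (auto intro!: smooth_on_sum smooth_on_mult v D simp del: sum.insert)
  have smn: "smooth_on UNIV D n1" "smooth_on UNIV D n2"
    unfolding n1_def n2_def by (intro smooth_on_sum smooth_on_mult sm D C)+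
  have smb: "smooth_on UNIV D (b1 k)" "smooth_on UNIV D (b2 k)" for k
    unfolding b1_def b2_def using c1(1) c2(1) smooth_on_const[OF D] by auto
  have smc: "smooth_on UNIV D (c k)" for k
    unfolding c_def by (intro smooth_on_diff smooth_on_mult smn smb D)
  have ne: "k0 \<noteq> i" "i \<notin> I" "k0 \<notin> I" using insert.hyps insert.prems by auto
  have e: "e q x = n1 q * e2 q x - n2 q * e1 q x" for q x
  proof -
    have s1: "(\<Sum>k\<in>insert k0 (insert i I). b1 k q * v k q x) = e1 q x"
    proof -
      have "(\<Sum>k\<in>insert i I. b1 k q * v k q x) = e1 q x"
        unfolding e1_def using ne by (intro sum.cong) (auto simp: b1_def)
      then show ?thesis using ne insert.hyps(1) by (simp add: b1_def)
    qed
    have s2: "(\<Sum>k\<in>insert k0 (insert i I). b2 k q * v k q x) = e2 q x"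
    proof -
      have "(\<Sum>k\<in>insert k0 I. b2 k q * v k q x) = e2 q x"
        unfolding e2_def using ne by (intro sum.cong) (auto simp: b2_def)
      then show ?thesis using ne insert.hyps(1) by (simp add: b2_def insert_commute[of k0])
    qed
    show ?thesis unfolding s1[symmetric] s2[symmetric] e_def c_def
      by (simp only: sum_distrib_left left_diff_distrib sum_subtractf mult.assoc)
  qed
  have ortho: "(c k0 q \<noteq> 0 \<longleftrightarrow> lin_independent (\<lambda>k. v k q) (insert i I)) \<and>
      (\<forall>j\<in>insert i I. (\<Sum>x\<in>C. e q x * v j q x) = 0)" if q: "q \<in> D" for q
  proof
    have or1: "(\<Sum>x\<in>C. e1 q x * v j q x) = 0" if "j \<in> I" for j using c1(3)[OF q that] by (simp add: e1_def)
    have or2: "(\<Sum>x\<in>C. e2 q x * v j q x) = 0" if "j \<in> I" for j using c2(3)[OF q that] by (simp add: e2_def)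
    have ind1: "lin_independent (\<lambda>k. v k q) (insert i I) \<longleftrightarrow> (\<exists>x. e1 q x \<noteq> 0)"
      by (rule orthogonal_combination_eq_0[OF C insert.hyps(1) ne(2) v0[OF q] e1_def or1 c1(2)[OF q]])
    have e1C: "e1 q x = 0" if "x \<notin> C" for x using v0[OF q that] by (simp add: e1_def)
    have n1: "n1 q \<noteq> 0 \<longleftrightarrow> (\<exists>x. e1 q x \<noteq> 0)"
      unfolding n1_def using C e1C by (auto simp: sum_nonneg_eq_0_iff)
    show "c k0 q \<noteq> 0 \<longleftrightarrow> lin_independent (\<lambda>k. v k q) (insert i I)"
      using ind1 n1 c2(2)[OF q] ne lin_independent_subset[of "\<lambda>k. v k q" "insert i I" I] insert.hyps(1)
      by (auto simp: c_def b1_def b2_def)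
    have ore: "(\<Sum>x\<in>C. e q x * w x) = n1 q * (\<Sum>x\<in>C. e2 q x * w x) - n2 q * (\<Sum>x\<in>C. e1 q x * w x)" for w
      unfolding e by (simp add: left_diff_distrib right_diff_distrib sum_subtractf sum_distrib_left mult_ac)
    have orI: "(\<Sum>x\<in>C. e q x * v j q x) = 0" if "j \<in> I" for j
      unfolding ore using or1[OF that] or2[OF that] by simp
    have "(\<Sum>x\<in>C. e q x * e1 q x) = 0" unfolding ore by (simp add: n1_def n2_def)
    moreover have "(\<Sum>x\<in>C. e q x * e1 q x) = (\<Sum>k\<in>insert i I. c1 k q * (\<Sum>x\<in>C. e q x * v k q x))"
      unfolding e1_def by (simp only: sum_distrib_left, subst sum.swap) (simp add: sum_distrib_left mult_ac)
    ultimately have "c1 i q * (\<Sum>x\<in>C. e q x * v i q x) = 0" using orI insert.hyps by simp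
    then have "(\<Sum>x\<in>C. e q x * v i q x) = 0"
    proof (rule mult_eq_0_iff[THEN iffD1, THEN disjE])
      \<comment> \<open>A vanishing coefficient means that the earlier vectors are dependent at
        \<open>q\<close>. Then \<open>e1\<close> is zero, hence so are \<open>n1\<close>,
        \<open>n2\<close> and \<open>e\<close>.\<close>
      assume "c1 i q = 0"
      then have "\<not> lin_independent (\<lambda>k. v k q) (insert i I)"
        using c1(2)[OF q] lin_independent_subset[of "\<lambda>k. v k q" "insert i I" I] insert.hyps(1) by auto
      then have "\<And>x. e1 q x = 0" using ind1 by blast
      then show ?thesis unfolding ore by (simp add: n1_def n2_def)
    qed
    with orI show "\<forall>j\<in>insert i I. (\<Sum>x\<in>C. e q x * v j q x) = 0" by blast
  qed
  show ?case
    by (rule exI[of _ c]) (use smc ortho in \<open>simp only: e_def, blast\<close>)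
qed

text \<open>All partial derivatives vanish. Finite dependence is a separate hypothesis, because a
  locally constant function on a disconnected set may involve infinitely many coordinates.\<close>

lemma smooth_on_locally_const:
  assumes D: "open D" and dep: "finite C" "depends_on C D g"
    and loc: "\<And>p. p \<in> D \<Longrightarrow> \<exists>W. open W \<and> p \<in> W \<and> (\<forall>q\<in>W \<inter> D. g q = g p)"
  shows "smooth_on UNIV D g"
proof (rule smooth_onI[OF dep(1) subset_UNIV dep(2)])
  have cont: "continuous_on D g"
  proof (rule continuous_on_realI)
    fix p and e :: real assume "p \<in> D" "e > 0"
    then obtain W where "open W" "p \<in> W" "\<forall>q\<in>W \<inter> D. g q = g p" using loc by blast
    with \<open>e > 0\<close> show "\<exists>N. open N \<and> p \<in> N \<and> (\<forall>q\<in>N \<inter> D. \<bar>g q - g p\<bar> < e)"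
      by (intro exI[of _ W]) simp
  qed
  have deriv: "((\<lambda>t. g (p(c := t))) has_real_derivative 0) (at (p c))" if p: "p \<in> D" for p c
  proof -
    obtain W where W: "open W" "p \<in> W" "\<forall>q\<in>W \<inter> D. g q = g p" using loc[OF p] by blast
    have "\<forall>\<^sub>F t in nhds (p c). p(c := t) \<in> W \<inter> D"
      by (rule eventually_line) (use W D p in auto)
    then have "\<forall>\<^sub>F t in nhds (p c). g (p(c := t)) = g p"
      by (rule eventually_mono) (use W(3) in blast)
    then show ?thesis by (rule iffD2[OF DERIV_cong_ev[OF refl _ refl]]) simp
  qed
  show "Ck_on k D g" for k
  proof (cases k)
    case (Suc l)
    show ?thesis unfolding Suc by (rule Ck_on_SucI[OF D cont deriv Ck_on_const[OF D]])
  qed (simp add: cont)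
qed

section \<open>Constant rank and independence at a point\<close>

lemma diff_rank_eq:
  "diff_rank h K p = Max (card ` {F. F \<subseteq> K \<and> lin_independent (\<lambda>k x. pd x (h k) p) F})"
  unfolding diff_rank_def lin_independent_def by simp

lemma diff_rank_ge:
  assumes "finite K" "F \<subseteq> K" "lin_independent (\<lambda>k x. pd x (h k) p) F"
  shows "card F \<le> diff_rank h K p"
  unfolding diff_rank_eq using assms by (intro Max_ge) (auto intro: finite_subset[OF _ finite_Pow_iff[THEN iffD2]])

lemma diff_rank_attained:
  assumes "finite K"
  obtains F where "F \<subseteq> K" "lin_independent (\<lambda>k x. pd x (h k) p) F" "card F = diff_rank h K p"
proof -
  let ?S = "{F. F \<subseteq> K \<and> lin_independent (\<lambda>k x. pd x (h k) p) F}"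
  have "finite ?S" using assms by simp
  moreover have "{} \<in> ?S" by (simp add: lin_independent_def)
  ultimately have "Max (card ` ?S) \<in> card ` ?S" by (intro Max_in) auto
  then obtain F where "F \<in> ?S" "card F = diff_rank h K p" unfolding diff_rank_eq by (rule imageE) simp
  then show thesis by (intro that[of F]) auto
qed

text \<open>Without constant rank, independence over the smooth functions does not give independence at
  every point.\<close>

lemma diff_independent_pointwise:
  assumes D: "open D" and K: "finite K" "\<And>k. k \<in> K \<Longrightarrow> smooth_on UNIV D (h k)"
    and ind: "diff_independent D h K" and rank: "locally_constant_rank D h K" and p: "p \<in> D"
  shows "lin_independent (\<lambda>k x. pd x (h k) p) K"
proof (rule ccontr)
  assume dep: "\<not> lin_independent (\<lambda>k x. pd x (h k) p) K"
  obtain I where I: "I \<subseteq> K" "lin_independent (\<lambda>k x. pd x (h k) p) I" "card I = diff_rank h K p"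
    using diff_rank_attained[OF K(1)] .
  have "I \<noteq> K" using I(2) dep by blast
  then obtain k0 where k0: "k0 \<in> K" "k0 \<notin> I" using I(1) by blast
  have finI: "finite I" using K(1) I(1) finite_subset by blast
  have "\<exists>C. finite C \<and> depends_on C D (h k)" if "k \<in> K" for k
    using smooth_onE[OF K(2)[OF that]] by metis
  then obtain C' where C': "\<And>k. k \<in> K \<Longrightarrow> finite (C' k)" "\<And>k. k \<in> K \<Longrightarrow> depends_on (C' k) D (h k)"
    by metis
  define C where "C = \<Union>(C' ` K)"
  have C: "finite C" using K(1) C'(1) by (simp add: C_def)
  have depC: "depends_on C D (h k)" if "k \<in> K" for k
    by (rule depends_on_mono[OF C'(2)[OF that]]) (use that in \<open>auto simp: C_def\<close>)
  define v where "v k q x = (if k \<in> K then pd x (h k) q else 0)" for k q x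
  have v: "smooth_on UNIV D (\<lambda>q. v k q x)" if "k \<in> K" for k x
    using smooth_on_pd[OF D K(2)[OF that]] that by (simp add: v_def)
  have v0: "v k q x = 0" if "q \<in> D" "x \<notin> C" for k q x
    using pd_eq_0[OF D depC that] by (simp add: v_def)
  have indv: "lin_independent (\<lambda>k. v k q) F \<longleftrightarrow> lin_independent (\<lambda>k x. pd x (h k) q) F" if "F \<subseteq> K" for F q
  proof -
    have "(\<Sum>k\<in>F. a k * v k q x) = (\<Sum>k\<in>F. a k * pd x (h k) q)" for a x
      by (rule sum.cong) (use that in \<open>auto simp: v_def\<close>)
    then show ?thesis unfolding lin_independent_def by simp
  qed
  have k0I: "insert k0 I \<subseteq> K" using k0 I(1) by blast
  obtain c where c: "\<And>k. smooth_on UNIV D (c k)"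
    "\<And>q. q \<in> D \<Longrightarrow> c k0 q \<noteq> 0 \<longleftrightarrow> lin_independent (\<lambda>k. v k q) I"
    "\<And>q i. q \<in> D \<Longrightarrow> i \<in> I \<Longrightarrow> (\<Sum>x\<in>C. (\<Sum>k\<in>insert k0 I. c k q * v k q x) * v i q x) = 0"
  proof -
    have "\<exists>c. (\<forall>k. smooth_on UNIV D (c k)) \<and>
      (\<forall>q\<in>D. (c k0 q \<noteq> 0 \<longleftrightarrow> lin_independent (\<lambda>k. v k q) I) \<and>
        (\<forall>i\<in>I. (\<Sum>x\<in>C. (\<Sum>k\<in>insert k0 I. c k q * v k q x) * v i q x) = 0))"
      by (rule smooth_gram_schmidt[OF D C finI k0(2) k0I]) (simp_all add: v v0)
    then show thesis
    proof (elim exE conjE)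
      fix c assume "\<forall>k. smooth_on UNIV D (c k)"
        "\<forall>q\<in>D. (c k0 q \<noteq> 0 \<longleftrightarrow> lin_independent (\<lambda>k. v k q) I) \<and>
        (\<forall>i\<in>I. (\<Sum>x\<in>C. (\<Sum>k\<in>insert k0 I. c k q * v k q x) * v i q x) = 0)"
      then show thesis by (intro that[of c]) blast+
    qed
  qed
  let ?r = "diff_rank h K"
  \<comment> \<open>\<open>\<kappa>\<close> selects the points with the same rank as
    \<open>p\<close>. There \<open>insert k0 I\<close> is too large to be independent, so the
    Gram-Schmidt combination vanishes; elsewhere the factor \<open>\<kappa>\<close> removes it.
    Locally constant rank makes \<open>\<kappa>\<close> smooth.\<close>
  define \<kappa> where "\<kappa> q = (if ?r q = ?r p then 1 else 0 :: real)" for q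
  have "depends_on C D \<kappa>"
    unfolding depends_on_def
  proof (intro ballI impI)
    fix q q' assume q: "q \<in> D" "q' \<in> D" "\<forall>c\<in>C. q c = q' c"
    have "v k q x = v k q' x" for k x
    proof (cases "k \<in> K")
      case True
      have "pd x (h k) q = pd x (h k) q'"
        using depends_on_pd[OF D depC[OF True], of x] q unfolding depends_on_def by blast
      then show ?thesis by (simp add: v_def)
    qed (simp add: v_def)
    then have "(\<lambda>k. v k q) = (\<lambda>k. v k q')" by blast
    then have "lin_independent (\<lambda>k x. pd x (h k) q) F \<longleftrightarrow> lin_independent (\<lambda>k x. pd x (h k) q') F"
      if "F \<subseteq> K" for F using indv[OF that, of q] indv[OF that, of q'] by simp
    then have "{F. F \<subseteq> K \<and> lin_independent (\<lambda>k x. pd x (h k) q) F} =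
        {F. F \<subseteq> K \<and> lin_independent (\<lambda>k x. pd x (h k) q') F}" by blast
    then have "?r q = ?r q'" unfolding diff_rank_eq by simp
    then show "\<kappa> q = \<kappa> q'" by (simp add: \<kappa>_def)
  qed
  then have \<kappa>: "smooth_on UNIV D \<kappa>"
  proof (rule smooth_on_locally_const[OF D C])
    fix q assume "q \<in> D"
    then obtain W where "open W" "q \<in> W" "\<forall>q'\<in>W. ?r q' = ?r q"
      using rank unfolding locally_constant_rank_def by blast
    moreover have "\<kappa> q' = \<kappa> q" if "?r q' = ?r q" for q' using that by (simp add: \<kappa>_def)
    ultimately show "\<exists>W. open W \<and> q \<in> W \<and> (\<forall>q'\<in>W \<inter> D. \<kappa> q' = \<kappa> q)"
      by (intro exI[of _ W]) blast
  qed
  have rel: "(\<Sum>k\<in>insert k0 I. (\<kappa> q * c k q) * pd x (h k) q) = 0" if q: "q \<in> D" for q x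
  proof (cases "?r q = ?r p")
    case True
    define e where "e x = (\<Sum>k\<in>insert k0 I. c k q * v k q x)" for x
    have "lin_independent (\<lambda>k. v k q) (insert k0 I) \<longleftrightarrow> (\<exists>x. e x \<noteq> 0)"
      by (rule orthogonal_combination_eq_0[OF C finI k0(2) v0[OF q] e_def _ c(2)[OF q]])
        (use c(3)[OF q] e_def in auto)
    moreover have "\<not> lin_independent (\<lambda>k. v k q) (insert k0 I)"
    proof
      assume "lin_independent (\<lambda>k. v k q) (insert k0 I)"
      then have "card (insert k0 I) \<le> ?r q" using indv[OF k0I] diff_rank_ge[OF K(1) k0I] by blast
      then show False using True I(3) k0(2) finI by simp
    qed
    ultimately have "e x = 0" by blast
    moreover have "(\<Sum>k\<in>insert k0 I. (\<kappa> q * c k q) * pd x (h k) q) = \<kappa> q * e x"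
      unfolding e_def sum_distrib_left
      by (rule sum.cong) (use k0I in \<open>auto simp: v_def\<close>)
    ultimately show ?thesis by simp
  qed (simp add: \<kappa>_def)
  have "finite (insert k0 I) \<and> insert k0 I \<subseteq> K \<and>
      (\<forall>k\<in>insert k0 I. smooth_on UNIV D (\<lambda>q. \<kappa> q * c k q)) \<and>
      (\<forall>q\<in>D. \<forall>x. (\<Sum>k\<in>insert k0 I. (\<lambda>q. \<kappa> q * c k q) q * pd x (h k) q) = 0)"
    using finI k0I rel smooth_on_mult[OF D \<kappa> c(1)] by blast
  then have "\<forall>k\<in>insert k0 I. \<forall>q\<in>D. (\<lambda>q. \<kappa> q * c k q) q = 0"
    using ind unfolding diff_independent_def by (elim allE[of _ "insert k0 I"] allE[of _ "\<lambda>k q. \<kappa> q * c k q"]) blast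
  \<comment> \<open>At \<open>p\<close> the factor \<open>\<kappa>\<close> is one, while
    \<open>c k0\<close> is nonzero because \<open>I\<close> is independent there.\<close>
  then have "\<kappa> p * c k0 p = 0" using p by blast
  then have "c k0 p = 0" by (simp add: \<kappa>_def)
  then show False using c(2)[OF p] I(2) indv[OF I(1)] by simp
qed

text \<open>Gaussian elimination, one equation at a time: an unknown with nonzero coefficient in
  equation \<open>b\<close> is solved for, and the remaining equations are rewritten without
  it.\<close>

lemma underdetermined_system:
  fixes n :: "'a \<Rightarrow> 'b \<Rightarrow> real"
  assumes "finite G" "finite E" "card G < card E"
  shows "\<exists>x. (\<exists>a\<in>E. x a \<noteq> 0) \<and> (\<forall>b\<in>G. (\<Sum>a\<in>E. x a * n a b) = 0)"
  using assms
proof (induction G arbitrary: E n)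
  case empty
  then obtain a where "a \<in> E" by force
  then show ?case by (intro exI[of _ "\<lambda>_. 1"]) auto
next
  case (insert b G)
  show ?case
  proof (cases "\<exists>a0\<in>E. n a0 b \<noteq> 0")
    case False
    then show ?thesis using insert.IH[of E n] insert.prems insert.hyps by auto
  next
    case True
    then obtain a0 where a0: "a0 \<in> E" "n a0 b \<noteq> 0" by blast
    define E' where "E' = E - {a0}"
    have E': "E = insert a0 E'" "a0 \<notin> E'" "finite E'" using a0(1) insert.prems(1) by (auto simp: E'_def)
    define n' where "n' a b' = n a b' - n a b / n a0 b * n a0 b'" for a b'
    have "card G < card E'" using insert.prems(2) insert.hyps E' by simp
    then obtain x where x: "\<exists>a\<in>E'. x a \<noteq> 0" "\<And>b'. b' \<in> G \<Longrightarrow> (\<Sum>a\<in>E'. x a * n' a b') = 0"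
      using insert.IH[of E' n'] E'(3) by auto
    \<comment> \<open>The value of the eliminated unknown is the one that equation \<open>b\<close>
      forces.\<close>
    define x' where "x' = x(a0 := - (\<Sum>a\<in>E'. x a * n a b) / n a0 b)"
    have x': "(\<Sum>a\<in>E'. x' a * m a) = (\<Sum>a\<in>E'. x a * m a)" for m
      by (rule sum.cong) (use E'(2) in \<open>auto simp: x'_def\<close>)
    have "(\<Sum>a\<in>E. x' a * n a b') = 0" if "b' \<in> insert b G" for b'
    proof -
      have "(\<Sum>a\<in>E. x' a * n a b') = - (\<Sum>a\<in>E'. x a * n a b) / n a0 b * n a0 b' + (\<Sum>a\<in>E'. x a * n a b')"
        unfolding E'(1) using E'(2,3) x' by (simp add: x'_def)
      also have "\<dots> = (\<Sum>a\<in>E'. x a * n' a b')"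
        unfolding n'_def by (simp add: right_diff_distrib sum_subtractf sum_distrib_right sum_divide_distrib mult.assoc)
      also have "\<dots> = 0"
      proof (cases "b' = b")
        case True
        then show ?thesis using a0(2) by (simp add: n'_def)
      qed (use x(2) that in auto)
      finally show ?thesis .
    qed
    moreover have "\<exists>a\<in>E. x' a \<noteq> 0" using x(1) E' by (auto simp: x'_def)
    ultimately show ?thesis by blast
  qed
qed

section \<open>Flat parametrizations\<close>

text \<open>The total time derivative on the space of output jets, that is, the vector field of the
  trivial system in which all \<open>y\<close> are free functions of time. \<open>\<Phi>\<close>
  relates \<open>field_u f\<close> to it.\<close>

fun shift :: "'m \<times> nat \<Rightarrow> ('m \<times> nat \<Rightarrow> real) \<Rightarrow> real" where
  "shift (j, k) y = y (j, Suc k)"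

lemma shift_eq: "shift b = (\<lambda>y. y (fst b, Suc (snd b)))"
  by (cases b) (simp add: fun_eq_iff)

lemma tder_shift: "tder shift k (\<lambda>y. y (j, l)) = (\<lambda>y. y (j, l + k))"
proof (induction k)
  case (Suc k)
  show ?case by (simp add: Suc fun_eq_iff lie_coord)
qed simp

lemma tder_field_u: "tder (field_u f) k (\<lambda>q. q (In j l)) = (\<lambda>q. q (In j (l + k)))"
proof (induction k)
  case (Suc k)
  show ?case by (simp add: Suc fun_eq_iff lie_coord)
qed simp

lemma smooth_on_shift: "open V \<Longrightarrow> smooth_on UNIV V (shift b)"
  unfolding shift_eq by (rule smooth_on_coord) auto

lemma smooth_on_field_u:
  assumes open_W: "open W" and smooth_f: "smooth_system f W"
  shows "smooth_on UNIV W (field_u f c)"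
proof (cases c)
  case (St i)
  moreover have "field_u f (St i) = (\<lambda>p. f (state_of p) (input_of p) $ i)" by (simp add: fun_eq_iff)
  ultimately show ?thesis using smooth_f unfolding smooth_system_def by simp
next
  case (In j k)
  moreover have "field_u f (In j k) = (\<lambda>p. p (In j (Suc k)))" by (simp add: fun_eq_iff)
  ultimately show ?thesis using smooth_on_coord[OF open_W, of "In j (Suc k)"] by simp
qed

locale flat_chart =
  fixes f :: "real ^ 'n::finite \<Rightarrow> real ^ 'm::finite \<Rightarrow> real ^ 'n"
    and \<phi> :: "'m \<Rightarrow> ('n, 'm) jet \<Rightarrow> real"
    and R :: "'m \<Rightarrow> nat"
    and W :: "('n, 'm) jet set"
    and V :: "('m \<times> nat \<Rightarrow> real) set"
    and Fx :: "'n \<Rightarrow> ('m \<times> nat \<Rightarrow> real) \<Rightarrow> real"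
    and Fu :: "'m \<Rightarrow> ('m \<times> nat \<Rightarrow> real) \<Rightarrow> real"
  assumes open_W: "open W" and smooth_f: "smooth_system f W"
    and smooth_\<phi>: "\<And>j. smooth_on UNIV W (\<phi> j)"
    and open_V: "open V" and jet_V: "\<And>q. q \<in> W \<Longrightarrow> output_jet f \<phi> q \<in> V"
    and Fx: "\<And>i. smooth_on {(j, \<beta>). \<beta> < R j} V (Fx i)"
    and Fu: "\<And>j. smooth_on {(j, \<beta>). \<beta> \<le> R j} V (Fu j)"
    and x_eq: "\<And>q i. q \<in> W \<Longrightarrow> q (St i) = Fx i (output_jet f \<phi> q)"
    and u_eq: "\<And>q j. q \<in> W \<Longrightarrow> q (In j 0) = Fu j (output_jet f \<phi> q)"
begin

abbreviation \<Phi> :: "('n, 'm) jet \<Rightarrow> 'm \<times> nat \<Rightarrow> real" where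
  "\<Phi> \<equiv> output_jet f \<phi>"

definition \<Psi> :: "('m \<times> nat \<Rightarrow> real) \<Rightarrow> ('n, 'm) jet" where
  "\<Psi> y = (\<lambda>c. case c of St i \<Rightarrow> Fx i y | In j k \<Rightarrow> tder shift k (Fu j) y)"

lemma \<Psi>_simps [simp]: "\<Psi> y (St i) = Fx i y" "\<Psi> y (In j k) = tder shift k (Fu j) y"
  by (simp_all add: \<Psi>_def)

lemma \<Phi>_tder: "(\<lambda>q. \<Phi> q (j, k)) = tder (field_u f) k (\<phi> j)"
  by (simp add: output_jet_def)

lemmas smooth_field_u = smooth_on_field_u[OF open_W smooth_f]

lemma smooth_\<Phi>: "smooth_on UNIV W (\<lambda>q. \<Phi> q b)"
  by (cases b) (auto simp: \<Phi>_tder intro: smooth_on_tder open_W smooth_\<phi> smooth_field_u)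

lemma lie_\<Phi>: "lie (field_u f) (\<lambda>q. \<Phi> q b) = (\<lambda>q. shift b (\<Phi> q))"
  by (cases b) (simp add: \<Phi>_tder output_jet_def)

text \<open>Each time derivative raises the order of the output derivatives involved by at most one.
  The dimension count in \<open>no_leading_relation\<close> rests on the bound
  \<open>R l + k\<close>.\<close>

lemma smooth_tder_Fu: "smooth_on {(l, \<beta>). \<beta> \<le> R l + k} V (tder shift k (Fu j))"
proof (induction k)
  case 0
  then show ?case using Fu by simp
next
  case (Suc k)
  have "smooth_on {(l, \<beta>). \<beta> \<le> R l + Suc k} V (shift b)" if "b \<in> {(l, \<beta>). \<beta> \<le> R l + k}" for b
    unfolding shift_eq by (rule smooth_on_coord[OF open_V]) (use that in auto)
  then have "smooth_on {(l, \<beta>). \<beta> \<le> R l + Suc k} V (lie shift (tder shift k (Fu j)))"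
    by (rule smooth_on_lie[OF open_V Suc]) auto
  then show ?case by simp
qed

lemma smooth_\<Psi>: "smooth_on UNIV V (\<lambda>y. \<Psi> y c)"
  using smooth_on_mono[OF Fx] smooth_on_mono[OF smooth_tder_Fu]
  by (cases c) auto

lemma tder_\<Phi>:
  assumes "smooth_on UNIV V h" "q \<in> W"
  shows "tder (field_u f) k (\<lambda>q. h (\<Phi> q)) q = tder shift k h (\<Phi> q)"
  by (rule tder_related[OF open_V assms(1) smooth_on_shift[OF open_V] open_W smooth_\<Phi> jet_V assms(2)])
    (assumption, rule fun_cong[OF lie_\<Phi>])

text \<open>The equation expressing \<open>u\<close> by \<open>Fu\<close> holds on an open set, so
  it may be differentiated in time; \<open>\<Phi>\<close> turns derivatives along
  \<open>field_u f\<close> into derivatives along \<open>shift\<close>.\<close>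

lemma \<Psi>_\<Phi>:
  assumes "q \<in> W" shows "\<Psi> (\<Phi> q) = q"
proof
  fix c show "\<Psi> (\<Phi> q) c = q c"
  proof (cases c)
    case (St i)
    then show ?thesis using x_eq[OF assms] by simp
  next
    case (In j k)
    have "tder shift k (Fu j) (\<Phi> q) = tder (field_u f) k (\<lambda>q. Fu j (\<Phi> q)) q"
      by (rule tder_\<Phi>[OF smooth_on_mono[OF Fu] assms, symmetric]) auto
    also have "\<dots> = tder (field_u f) k (\<lambda>q. q (In j 0)) q"
      by (rule tder_cong[OF open_W assms]) (simp add: u_eq)
    also have "\<dots> = q (In j k)" by (simp add: tder_field_u)
    finally show ?thesis using In by simp
  qed
qed

lemma pd_\<Psi>_\<Phi>:
  assumes q: "q \<in> W" and B: "finite B" "depends_on B V (\<lambda>y. \<Psi> y c)"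
  shows "(\<Sum>b\<in>B. pd b (\<lambda>y. \<Psi> y c) (\<Phi> q) * pd x (\<lambda>q. \<Phi> q b) q) = (if c = x then 1 else 0)"
proof -
  have "pd x (\<lambda>q. \<Psi> (\<Phi> q) c) q = (\<Sum>b\<in>B. pd b (\<lambda>y. \<Psi> y c) (\<Phi> q) * pd x (\<lambda>q. \<Phi> q b) q)"
    by (rule pd_comp[OF open_V smooth_\<Psi> B smooth_\<Phi> jet_V q])
  moreover have "pd x (\<lambda>q. \<Psi> (\<Phi> q) c) q = pd x (\<lambda>q. q c) q"
    by (rule pd_cong[OF open_W q]) (simp add: \<Psi>_\<Phi>)
  ultimately show ?thesis by (simp add: pd_coord)
qed

section \<open>Time derivatives of relations among output differentials\<close>

abbreviation blk :: "nat \<Rightarrow> ('m \<times> nat) set" where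
  "blk K \<equiv> UNIV \<times> {..K}"

text \<open>The coefficients of the \<open>i\<close>-th time derivative of the relation with
  coefficients \<open>e\<close>. By the product rule, the coefficient at an output derivative is the
  Lie derivative of the old coefficient there plus the old coefficient one order lower; at order
  zero there is no predecessor.\<close>

primrec rel_deriv :: "('m \<times> nat \<Rightarrow> ('n, 'm) jet \<Rightarrow> real) \<Rightarrow> nat \<Rightarrow> 'm \<times> nat \<Rightarrow> ('n, 'm) jet \<Rightarrow> real" where
  "rel_deriv e 0 b = e b"
| "rel_deriv e (Suc i) b = (\<lambda>q. lie (field_u f) (rel_deriv e i b) q +
      (if snd b = 0 then 0 else rel_deriv e i (fst b, snd b - 1) q))"

text \<open>Lie derivatives commute with the differential, so a relation among the differentials of the
  \<open>\<phi>\<^sup>j\<^sub>[\<^sub>\<beta>\<^sub>]\<close> can be differentiated in time.\<close>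

lemma relation_lie:
  assumes e: "\<And>b. smooth_on UNIV W (e b)"
    and supp: "\<And>b q. q \<in> W \<Longrightarrow> b \<notin> blk K \<Longrightarrow> e b q = 0"
    and rel: "\<And>q x. q \<in> W \<Longrightarrow> (\<Sum>b\<in>blk K. e b q * pd x (\<lambda>q. \<Phi> q b) q) = 0"
    and q: "q \<in> W"
  shows "(\<Sum>b\<in>blk (Suc K). rel_deriv e 1 b q * pd x (\<lambda>q. \<Phi> q b) q) = 0"
proof -
  let ?L = "lie (field_u f)" and ?d = "\<lambda>x b. pd x (\<lambda>q. \<Phi> q b)"
  have "\<exists>C. finite C \<and> depends_on C W (\<lambda>q. \<Phi> q b)" for b using smooth_onE[OF smooth_\<Phi>[of b]] by metis
  then obtain C' where C': "\<And>b. finite (C' b)" "\<And>b. depends_on (C' b) W (\<lambda>q. \<Phi> q b)" by metis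
  define C where "C = \<Union>(C' ` blk K)"
  have C: "finite C" using C'(1) by (simp add: C_def)
  have dep: "depends_on C W (\<lambda>q. \<Phi> q b)" if "b \<in> blk K" for b
    by (rule depends_on_mono[OF C'(2)]) (use that in \<open>auto simp: C_def\<close>)
  have sm: "smooth_on UNIV W (?d x b)" for x b by (rule smooth_on_pd[OF open_W smooth_\<Phi>])
  \<comment> \<open>The correction sum stems from differentiating the vector field. Summed against
    \<open>e\<close> it contains the original relation in the directions \<open>c\<close>, and
    therefore drops out.\<close>
  have Ld: "?L (?d x b) q = ?d x (fst b, Suc (snd b)) q - (\<Sum>c\<in>C. pd x (field_u f c) q * ?d c b q)"
    if "b \<in> blk K" for b
  proof -
    have "pd x (?L (\<lambda>q. \<Phi> q b)) q = ?L (?d x b) q + (\<Sum>c\<in>C. pd x (field_u f c) q * ?d c b q)"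
      by (rule pd_lie[OF open_W smooth_\<Phi> smooth_field_u q C dep[OF that]])
    then show ?thesis unfolding lie_\<Phi> shift_eq by simp
  qed
  have "?L (\<lambda>q. \<Sum>b\<in>blk K. e b q * ?d x b q) q = ?L (\<lambda>q. 0) q"
    by (rule lie_cong[OF open_W q]) (rule rel)
  then have "0 = ?L (\<lambda>q. \<Sum>b\<in>blk K. e b q * ?d x b q) q" by (simp add: lie_const)
  also have "\<dots> = (\<Sum>b\<in>blk K. ?L (\<lambda>q. e b q * ?d x b q) q)"
    by (rule lie_sum[OF open_W smooth_on_mult[OF open_W e sm] q]) simp
  also have "\<dots> = (\<Sum>b\<in>blk K. ?L (e b) q * ?d x b q + e b q * ?L (?d x b) q)"
    by (simp add: lie_mult[OF open_W e sm q])
  also have "\<dots> = (\<Sum>b\<in>blk K. ?L (e b) q * ?d x b q) + (\<Sum>b\<in>blk K. e b q * ?d x (fst b, Suc (snd b)) q)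
      - (\<Sum>b\<in>blk K. e b q * (\<Sum>c\<in>C. pd x (field_u f c) q * ?d c b q))"
    using Ld by (simp add: sum.distrib right_diff_distrib sum_subtractf cong: sum.cong)
  also have "(\<Sum>b\<in>blk K. e b q * (\<Sum>c\<in>C. pd x (field_u f c) q * ?d c b q))
      = (\<Sum>c\<in>C. pd x (field_u f c) q * (\<Sum>b\<in>blk K. e b q * ?d c b q))"
    by (simp only: sum_distrib_left, subst sum.swap) (simp add: mult_ac)
  also have "\<dots> = 0" by (simp add: rel[OF q])
  also have "(\<Sum>b\<in>blk K. ?L (e b) q * ?d x b q) = (\<Sum>b\<in>blk (Suc K). ?L (e b) q * ?d x b q)"
  proof (rule sum.mono_neutral_left)
    show "\<forall>b\<in>blk (Suc K) - blk K. ?L (e b) q * ?d x b q = 0"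
    proof
      fix b assume "b \<in> blk (Suc K) - blk K"
      then have "?L (e b) q = ?L (\<lambda>q. 0) q" using supp by (intro lie_cong[OF open_W q]) auto
      then show "?L (e b) q * ?d x b q = 0" by (simp add: lie_const)
    qed
  qed auto
  \<comment> \<open>Reindexing by the order of the differential produces the coefficient one order
    lower, and none at order zero.\<close>
  also have "(\<Sum>b\<in>blk K. e b q * ?d x (fst b, Suc (snd b)) q) =
      (\<Sum>b\<in>blk (Suc K). (if snd b = 0 then 0 else e (fst b, snd b - 1) q) * ?d x b q)"
  proof -
    have "(\<Sum>b\<in>blk K. g b) = (\<Sum>j\<in>UNIV. \<Sum>k\<le>K. g (j, k))" for g :: "'m \<times> nat \<Rightarrow> real" and K
      by (simp add: sum.cartesian_product)
    then show ?thesis by (simp add: sum.atMost_Suc_shift del: sum.atMost_Suc)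
  qed
  finally show ?thesis by (simp add: distrib_right sum.distrib cong: if_cong)
qed

lemma smooth_rel_deriv:
  assumes "\<And>b. smooth_on UNIV W (e b)"
  shows "smooth_on UNIV W (rel_deriv e i b)"
proof (induction i arbitrary: b)
  case (Suc i)
  have "smooth_on UNIV W (\<lambda>q. if snd b = 0 then 0 else rel_deriv e i (fst b, snd b - 1) q)"
    using Suc smooth_on_const[OF open_W] by (cases "snd b = 0") auto
  then show ?case
    by (simp add: smooth_on_add open_W smooth_on_lie[OF open_W Suc smooth_field_u])
qed (simp add: assms)

lemma rel_deriv_outside:
  assumes "\<And>b q. q \<in> W \<Longrightarrow> b \<notin> blk K \<Longrightarrow> e b q = 0" "q \<in> W" "b \<notin> blk (K + i)"
  shows "rel_deriv e i b q = 0"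
  using assms(2,3)
proof (induction i arbitrary: b q)
  case (Suc i)
  have "lie (field_u f) (rel_deriv e i b) q = lie (field_u f) (\<lambda>q. 0) q"
  proof (rule lie_cong[OF open_W Suc.prems(1)])
    fix q' assume "q' \<in> W"
    then show "rel_deriv e i b q' = 0" by (rule Suc.IH) (use Suc.prems(2) in \<open>cases b, auto\<close>)
  qed
  then show ?case using Suc.IH[OF Suc.prems(1), of "(fst b, snd b - 1)"] Suc.prems(2)
    by (cases b) (auto simp: lie_const)
qed (use assms(1) in auto)

text \<open>Above the old top order the coefficients vanish identically, so their Lie derivatives do
  too, and the leading coefficient is passed up unchanged. The successive derivatives of a relation
  are thus in echelon form.\<close>

lemma rel_deriv_leading:
  assumes "\<And>b q. q \<in> W \<Longrightarrow> b \<notin> blk K \<Longrightarrow> e b q = 0" "q \<in> W"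
  shows "rel_deriv e i (j, K + i) q = e (j, K) q"
  using assms(2)
proof (induction i arbitrary: q)
  case (Suc i)
  have "lie (field_u f) (rel_deriv e i (j, K + Suc i)) q = lie (field_u f) (\<lambda>q. 0) q"
    by (rule lie_cong[OF open_W Suc.prems(1)]) (use rel_deriv_outside[OF assms(1)] in auto)
  then show ?case using Suc by (simp add: lie_const)
qed simp

lemma rel_deriv_Suc: "rel_deriv e (Suc i) b = rel_deriv (rel_deriv e i) 1 b"
  by (simp add: fun_eq_iff)

lemma relation_rel_deriv:
  assumes e: "\<And>b. smooth_on UNIV W (e b)"
    and supp: "\<And>b q. q \<in> W \<Longrightarrow> b \<notin> blk K \<Longrightarrow> e b q = 0"
    and rel: "\<And>q x. q \<in> W \<Longrightarrow> (\<Sum>b\<in>blk K. e b q * pd x (\<lambda>q. \<Phi> q b) q) = 0"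
    and q: "q \<in> W"
  shows "(\<Sum>b\<in>blk (K + i). rel_deriv e i b q * pd x (\<lambda>q. \<Phi> q b) q) = 0"
  using q
proof (induction i arbitrary: q x)
  case (Suc i)
  show ?case unfolding rel_deriv_Suc add_Suc_right
    by (rule relation_lie[OF smooth_rel_deriv[OF e] rel_deriv_outside[OF supp] Suc.IH Suc.prems])
qed (simp add: rel)

text \<open>The derivatives of a nontrivial relation would make the rank of \<open>d\<phi>\<^sub>[\<^sub>0\<^sub>,\<^sub>K\<^sub>]\<close> grow too slowly:
  these differentials span all \<open>du\<^sub>[\<^sub>k\<^sub>]\<close> with \<open>k \<le> K - max R\<close>.\<close>

lemma no_leading_relation:
  assumes e: "\<And>b. smooth_on UNIV W (e b)"
    and supp: "\<And>b q. q \<in> W \<Longrightarrow> b \<notin> blk K0 \<Longrightarrow> e b q = 0"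
    and rel: "\<And>q x. q \<in> W \<Longrightarrow> (\<Sum>b\<in>blk K0. e b q * pd x (\<lambda>q. \<Phi> q b) q) = 0"
    and q: "q \<in> W"
  shows "e (j0, K0) q = 0"
proof (rule ccontr)
  assume nz: "e (j0, K0) q \<noteq> 0"
  define r where "r = Max (range R)"
  have r: "R j \<le> r" for j by (simp add: r_def)
  \<comment> \<open>Since \<open>K = L + r\<close>, input derivatives up to order \<open>L\<close>
    involve output derivatives only up to order \<open>K\<close>. The block \<open>blk K\<close> has
    \<open>CARD('m) * r\<close> elements more than \<open>blk L\<close>, and the
    \<open>M + 1\<close> derived relations exceed that number.\<close>
  define M where "M = CARD('m) * r + r"
  define L where "L = K0 + CARD('m) * r"
  define K where "K = K0 + M"
  \<comment> \<open>Rows \<open>Inl (j, k)\<close> are differentials of the input part of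
    \<open>\<Psi>\<close>, rows \<open>Inr i\<close> are the coefficients of the relation
    differentiated \<open>i\<close> times. With columns \<open>blk K\<close> there are more rows
    than columns, hence a nontrivial dependence \<open>x\<close>.\<close>
  define n :: "('m \<times> nat) + nat \<Rightarrow> 'm \<times> nat \<Rightarrow> real" where
    "n a b = (case a of Inl (j, k) \<Rightarrow> pd b (\<lambda>y. \<Psi> y (In j k)) (\<Phi> q) | Inr i \<Rightarrow> rel_deriv e i b q)" for a b
  have "card (blk K) < card (blk L <+> {..M})"
    by (simp add: card_Plus K_def L_def M_def algebra_simps)
  then obtain x where x: "\<exists>a\<in>blk L <+> {..M}. x a \<noteq> 0" "\<And>b. b \<in> blk K \<Longrightarrow> (\<Sum>a\<in>blk L <+> {..M}. x a * n a b) = 0"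
    using underdetermined_system[of "blk K" "blk L <+> {..M}" n] by auto
  have sumPlus: "(\<Sum>a\<in>blk L <+> {..M}. g a) = (\<Sum>a\<in>blk L. g (Inl a)) + (\<Sum>i\<le>M. g (Inr i))" for g :: "_ \<Rightarrow> real"
    using sum.Plus[of "blk L" "{..M}" g] by simp
  have unit: "(\<Sum>b\<in>blk K. n (Inl (j, k)) b * pd \<xi> (\<lambda>q. \<Phi> q b) q) = (if In j k = \<xi> then 1 else 0)"
    if "k \<le> L" for j k \<xi>
  proof -
    obtain C where C: "C \<subseteq> {(l, \<beta>). \<beta> \<le> R l + k}" "depends_on C V (\<lambda>y. \<Psi> y (In j k))"
    proof -
      have "smooth_on {(l, \<beta>). \<beta> \<le> R l + k} V (\<lambda>y. \<Psi> y (In j k))" using smooth_tder_Fu by simp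
      then show thesis using that unfolding smooth_on_def by blast
    qed
    have "C \<subseteq> blk K"
    proof
      fix b assume "b \<in> C"
      then have "snd b \<le> R (fst b) + k" using C(1) by auto
      also have "\<dots> \<le> K" using r[of "fst b"] that by (simp add: K_def M_def L_def)
      finally show "b \<in> blk K" by (cases b) simp
    qed
    from pd_\<Psi>_\<Phi>[OF q _ depends_on_mono[OF C(2) this]] show ?thesis by (simp add: n_def)
  qed
  have relq: "(\<Sum>b\<in>blk K. n (Inr i) b * pd \<xi> (\<lambda>q. \<Phi> q b) q) = 0" if "i \<le> M" for i \<xi>
  proof -
    have "(\<Sum>b\<in>blk K. n (Inr i) b * pd \<xi> (\<lambda>q. \<Phi> q b) q) = (\<Sum>b\<in>blk (K0 + i). rel_deriv e i b q * pd \<xi> (\<lambda>q. \<Phi> q b) q)"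
      using that rel_deriv_outside[OF supp q] by (intro sum.mono_neutral_cong_right) (auto simp: K_def n_def)
    then show ?thesis using relation_rel_deriv[OF e supp rel q] by simp
  qed
  \<comment> \<open>Paired with the partial derivatives of \<open>\<Phi>\<close> in direction
    \<open>In j k\<close>, the relation rows give zero and the parametrization rows give zero or
    one, so the pairing isolates \<open>x (Inl (j, k))\<close>.\<close>
  have xu: "x (Inl (j, k)) = 0" if "k \<le> L" for j k
  proof -
    let ?\<xi> = "In j k :: ('n, 'm) coord"
    let ?d = "\<lambda>b. pd ?\<xi> (\<lambda>q. \<Phi> q b) q"
    have "0 = (\<Sum>b\<in>blk K. (\<Sum>a\<in>blk L <+> {..M}. x a * n a b) * ?d b)" using x(2) by simp
    also have "\<dots> = (\<Sum>a\<in>blk L <+> {..M}. x a * (\<Sum>b\<in>blk K. n a b * ?d b))"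
      by (simp only: sum_distrib_left sum_distrib_right, subst sum.swap) (simp add: mult_ac)
    also have "\<dots> = (\<Sum>a\<in>blk L. x (Inl a) * (\<Sum>b\<in>blk K. n (Inl a) b * ?d b))"
      unfolding sumPlus using relq by simp
    also have "\<dots> = (\<Sum>a\<in>blk L. if a = (j, k) then x (Inl (j, k)) else 0)"
      using unit by (intro sum.cong) (auto split: if_splits)
    also have "\<dots> = x (Inl (j, k))" using that by (simp add: sum.delta)
    finally show ?thesis by simp
  qed
  have xr: "(\<Sum>i\<le>M. x (Inr i) * rel_deriv e i b q) = 0" if "b \<in> blk K" for b
  proof -
    have "(\<Sum>a\<in>blk L. x (Inl a) * n (Inl a) b) = 0" by (rule sum.neutral) (use xu in auto)
    then show ?thesis using x(2)[OF that] unfolding sumPlus by (simp add: n_def)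
  qed
  \<comment> \<open>Elimination from the largest \<open>i\<close> downwards. In column
    \<open>(j0, K0 + i)\<close> the relations differentiated fewer than \<open>i\<close> times have
    no entry, and the \<open>i\<close>-th has the entry \<open>e (j0, K0) q\<close>, which is
    assumed nonzero.\<close>
  have xi: "x (Inr i) = 0" if "i \<le> M" for i
    using that
  proof (induction "M - i" arbitrary: i rule: less_induct)
    case less
    have "x (Inr i') * rel_deriv e i' (j0, K0 + i) q = 0" if "i' \<le> M" "i' \<noteq> i" for i'
    proof (cases "i' < i")
      case True
      then show ?thesis using rel_deriv_outside[where e = e and K = K0 and b = "(j0, K0 + i)" and i = i', OF supp q] by simp
    next
      case False
      then show ?thesis using less.hyps[of i'] that less.prems by simp
    qed
    then have "(\<Sum>i'\<le>M. x (Inr i') * rel_deriv e i' (j0, K0 + i) q) =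
        (\<Sum>i'\<le>M. if i' = i then x (Inr i) * rel_deriv e i (j0, K0 + i) q else 0)"
      by (intro sum.cong) auto
    then have "x (Inr i) * rel_deriv e i (j0, K0 + i) q = 0"
      using xr[of "(j0, K0 + i)"] less.prems by (simp add: K_def)
    then show ?case using rel_deriv_leading[where e = e and K = K0 and i = i and j = j0, OF supp q] nz by simp
  qed
  show False using x(1) xu xi by auto
qed

text \<open>The leading coefficients vanish on all of \<open>W\<close>, not only at one point, so
  what remains is again a relation with smooth coefficients, supported in a smaller block.\<close>

lemma relation_trivial:
  assumes e: "\<And>b. smooth_on UNIV W (e b)"
    and supp: "\<And>b q. q \<in> W \<Longrightarrow> b \<notin> blk K \<Longrightarrow> e b q = 0"
    and rel: "\<And>q x. q \<in> W \<Longrightarrow> (\<Sum>b\<in>blk K. e b q * pd x (\<lambda>q. \<Phi> q b) q) = 0"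
    and q: "q \<in> W"
  shows "e b q = 0"
  using supp rel q
proof (induction K arbitrary: q b)
  case 0
  show ?case
  proof (cases "b \<in> blk 0")
    case True
    then have "b = (fst b, 0)" by (cases b) auto
    then show ?thesis using no_leading_relation[OF e 0, of "fst b"] by simp
  qed (use 0 in blast)
next
  case (Suc K)
  have lead: "e (j, Suc K) q = 0" if "q \<in> W" for j q
    using no_leading_relation[OF e Suc.prems(1,2) that] by blast
  have supp': "e b q = 0" if "q \<in> W" "b \<notin> blk K" for b q
  proof (cases "b \<in> blk (Suc K)")
    case True
    then have "b = (fst b, Suc K)" using that by (cases b) auto
    then show ?thesis using lead[OF that(1), of "fst b"] by simp
  qed (use Suc.prems(1) that in auto)
  have rel': "(\<Sum>b\<in>blk K. e b q * pd x (\<lambda>q. \<Phi> q b) q) = 0" if "q \<in> W" for q x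
  proof -
    have "(\<Sum>b\<in>blk K. e b q * pd x (\<lambda>q. \<Phi> q b) q) = (\<Sum>b\<in>blk (Suc K). e b q * pd x (\<lambda>q. \<Phi> q b) q)"
      using supp'[OF that] by (intro sum.mono_neutral_left) auto
    then show ?thesis using Suc.prems(2)[OF that] by simp
  qed
  show ?case by (rule Suc.IH[OF supp' rel' Suc.prems(3)])
qed

text \<open>\<open>\<Psi>\<close> is a left inverse of \<open>\<Phi>\<close>. The difference of \<open>d\<Phi> d\<Psi>\<close> and the identity is a relation among
  the differentials of the \<open>\<phi>\<^sup>j\<^sub>[\<^sub>\<beta>\<^sub>]\<close> with smooth coefficients, so \<open>\<Psi>\<close> is also a right inverse to
  first order.\<close>

lemma pd_\<Phi>_\<Psi>:
  assumes q: "q \<in> W" and C: "finite C" "depends_on C W (\<lambda>q. \<Phi> q b0)"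
  shows "(\<Sum>c\<in>C. pd c (\<lambda>q. \<Phi> q b0) q * pd b (\<lambda>y. \<Psi> y c) (\<Phi> q)) = (if b = b0 then 1 else 0)"
proof -
  define e where "e b q = (\<Sum>c\<in>C. pd c (\<lambda>q. \<Phi> q b0) q * pd b (\<lambda>y. \<Psi> y c) (\<Phi> q)) - (if b = b0 then 1 else 0)"
    for b q
  have "\<exists>B. finite B \<and> depends_on B V (\<lambda>y. \<Psi> y c)" for c using smooth_onE[OF smooth_\<Psi>[of c]] by metis
  then obtain B' where B': "\<And>c. finite (B' c)" "\<And>c. depends_on (B' c) V (\<lambda>y. \<Psi> y c)" by metis
  \<comment> \<open>\<open>K\<close> bounds the orders of all output derivatives that occur in
    \<open>\<Psi> y c\<close> for \<open>c\<close> in \<open>C\<close>, and the order of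
    \<open>b0\<close>.\<close>
  define K where "K = Max (snd ` insert b0 (\<Union>(B' ` C)))"
  have fin: "finite (insert b0 (\<Union>(B' ` C)))" using B'(1) C(1) by simp
  have K: "insert b0 (\<Union>(B' ` C)) \<subseteq> blk K"
  proof
    fix b assume "b \<in> insert b0 (\<Union>(B' ` C))"
    then have "snd b \<le> K" unfolding K_def using fin by (intro Max_ge) auto
    then show "b \<in> blk K" by (cases b) simp
  qed
  have dep: "depends_on (blk K) V (\<lambda>y. \<Psi> y c)" if "c \<in> C" for c
    by (rule depends_on_mono[OF B'(2)]) (use K that in blast)
  have "e b q = 0"
  proof (rule relation_trivial[OF _ _ _ q])
    show "smooth_on UNIV W (e b)" for b
      unfolding e_def
      by (intro smooth_on_diff smooth_on_sum smooth_on_mult smooth_on_const open_W C(1)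
          smooth_on_pd[OF open_W smooth_\<Phi>]
          smooth_on_comp[OF open_W open_V smooth_on_pd[OF open_V smooth_\<Psi>] smooth_\<Phi> jet_V])
    show "e b q = 0" if "q \<in> W" "b \<notin> blk K" for b q
    proof -
      have "b \<noteq> b0" using that(2) K by blast
      then show ?thesis using pd_eq_0[OF open_V dep jet_V[OF that(1)] that(2)] by (simp add: e_def)
    qed
    show "(\<Sum>b\<in>blk K. e b q * pd x (\<lambda>q. \<Phi> q b) q) = 0" if q: "q \<in> W" for q x
    proof -
      let ?d = "\<lambda>b. pd x (\<lambda>q. \<Phi> q b) q"
      have "b0 \<in> blk K" using K by blast
      have "(\<Sum>b\<in>blk K. e b q * ?d b) =
          (\<Sum>b\<in>blk K. \<Sum>c\<in>C. pd c (\<lambda>q. \<Phi> q b0) q * (pd b (\<lambda>y. \<Psi> y c) (\<Phi> q) * ?d b)) -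
          (\<Sum>b\<in>blk K. if b = b0 then ?d b0 else 0)"
      proof -
        have "(if b = b0 then 1 else 0) * ?d b = (if b = b0 then ?d b0 else 0)" for b by simp
        then show ?thesis
          unfolding e_def by (simp only: left_diff_distrib sum_subtractf sum_distrib_right mult.assoc)
      qed
      also have "(\<Sum>b\<in>blk K. if b = b0 then ?d b0 else 0) = ?d b0"
        using \<open>b0 \<in> blk K\<close> by (simp add: sum.delta)
      also have "(\<Sum>b\<in>blk K. \<Sum>c\<in>C. pd c (\<lambda>q. \<Phi> q b0) q * (pd b (\<lambda>y. \<Psi> y c) (\<Phi> q) * ?d b)) =
          (\<Sum>c\<in>C. pd c (\<lambda>q. \<Phi> q b0) q * (\<Sum>b\<in>blk K. pd b (\<lambda>y. \<Psi> y c) (\<Phi> q) * ?d b))"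
        by (subst sum.swap) (simp add: sum_distrib_left)
      also have "\<dots> = (\<Sum>c\<in>C. if c = x then ?d b0 else 0)"
        using pd_\<Psi>_\<Phi>[OF q _ dep] by (intro sum.cong) auto
      \<comment> \<open>For \<open>x\<close> outside \<open>C\<close> both sides vanish, as
        \<open>\<Phi> q b0\<close> depends on \<open>C\<close> only.\<close>
      also have "\<dots> = ?d b0"
        using C pd_eq_0[OF open_W C(2) q, of x] by (simp add: sum.delta)
      finally show ?thesis by simp
    qed
  qed
  then show ?thesis by (simp add: e_def)
qed

text \<open>By \<open>pd_\<Phi>_\<Psi>\<close> the differential of \<open>\<Psi>\<close> is a right
  inverse of that of \<open>\<Phi>\<close>; contraction with it isolates each coefficient.\<close>

lemma lin_independent_\<Phi>:
  assumes q: "q \<in> W" and B: "finite B"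
  shows "lin_independent (\<lambda>b x. pd x (\<lambda>q. \<Phi> q b) q) B"
  unfolding lin_independent_def
proof (intro allI impI ballI)
  fix a b assume a: "\<forall>x. (\<Sum>b\<in>B. a b * pd x (\<lambda>q. \<Phi> q b) q) = 0" and b: "b \<in> B"
  have "\<exists>C. finite C \<and> depends_on C W (\<lambda>q. \<Phi> q b)" for b using smooth_onE[OF smooth_\<Phi>[of b]] by metis
  then obtain C' where C': "\<And>b. finite (C' b)" "\<And>b. depends_on (C' b) W (\<lambda>q. \<Phi> q b)" by metis
  define C where "C = \<Union>(C' ` B)"
  have C: "finite C" using C'(1) B by (simp add: C_def)
  have dep: "depends_on C W (\<lambda>q. \<Phi> q b)" if "b \<in> B" for b
    by (rule depends_on_mono[OF C'(2)]) (use that in \<open>auto simp: C_def\<close>)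
  have "0 = (\<Sum>c\<in>C. (\<Sum>b'\<in>B. a b' * pd c (\<lambda>q. \<Phi> q b') q) * pd b (\<lambda>y. \<Psi> y c) (\<Phi> q))"
    using a by simp
  also have "\<dots> = (\<Sum>b'\<in>B. a b' * (\<Sum>c\<in>C. pd c (\<lambda>q. \<Phi> q b') q * pd b (\<lambda>y. \<Psi> y c) (\<Phi> q)))"
    by (simp only: sum_distrib_left sum_distrib_right, subst sum.swap) (simp add: mult_ac)
  also have "\<dots> = (\<Sum>b'\<in>B. if b' = b then a b else 0)"
    using pd_\<Phi>_\<Psi>[OF q C dep] by (intro sum.cong) auto
  also have "\<dots> = a b" using b B by (simp add: sum.delta)
  finally show "a b = 0" by simp
qed

text \<open>Independence lets the components in \<open>B\<close> be completed to local coordinates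
  \<open>T\<close> on \<open>W\<close>, so that they take all values near those at \<open>p\<close>.
  The set \<open>Y\<close> is open in the whole space, but \<open>q\<close> has to match
  \<open>y\<close> on \<open>B\<close> only.\<close>

lemma \<Phi>_locally_open:
  assumes p: "p \<in> W" and B: "finite B"
  obtains Y where "open Y" "\<Phi> p \<in> Y" "\<And>y. y \<in> Y \<Longrightarrow> \<exists>q\<in>W. \<forall>b\<in>B. \<Phi> q b = y b"
proof -
  have "\<exists>(c :: 'm \<times> nat \<Rightarrow> ('n, 'm) coord) T G U X. inj_on c B \<and> c ` B \<subseteq> UNIV \<and> open U \<and> p \<in> U \<and> U \<subseteq> W \<and> open X \<and>
    (\<forall>b\<in>B. \<forall>q. T q (c b) = \<Phi> q b) \<and> (\<forall>a q. a \<notin> c ` B \<longrightarrow> T q a = q a) \<and>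
    (\<forall>a. smooth_on UNIV U (\<lambda>q. T q a)) \<and> (\<forall>a. smooth_on UNIV X (\<lambda>x. G x a)) \<and>
    (\<forall>q\<in>U. T q \<in> X \<and> G (T q) = q) \<and> (\<forall>x\<in>X. G x \<in> U \<and> T (G x) = x)"
    by (rule exchange_coordinates[OF open_W p B smooth_\<Phi>])
      (use lin_independent_\<Phi>[OF p B] in \<open>simp add: lin_independent_def\<close>)
  then obtain c :: "'m \<times> nat \<Rightarrow> ('n, 'm) coord" and T G U X where inj: "inj_on c B" and U: "p \<in> U" "U \<subseteq> W" "open X"
    and T: "\<And>b q. b \<in> B \<Longrightarrow> T q (c b) = \<Phi> q b"
    and TG: "\<And>q. q \<in> U \<Longrightarrow> T q \<in> X" "\<And>x. x \<in> X \<Longrightarrow> G x \<in> U" "\<And>x. x \<in> X \<Longrightarrow> T (G x) = x"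
  proof (elim exE conjE)
    fix c :: "'m \<times> nat \<Rightarrow> ('n, 'm) coord" and T G U X
    assume *: "inj_on c B" "p \<in> U" "U \<subseteq> W" "open X" "\<forall>b\<in>B. \<forall>q. T q (c b) = \<Phi> q b"
      "\<forall>q\<in>U. T q \<in> X \<and> G (T q) = q" "\<forall>x\<in>X. G x \<in> U \<and> T (G x) = x"
    show thesis by (rule that[of c U X T G]) (use * in simp_all)
  qed
  \<comment> \<open>The coordinates not exchanged for outputs are frozen at their values at
    \<open>p\<close>.\<close>
  define E where "E y = (\<lambda>a. if a \<in> c ` B then y (inv_into B c a) else T p a)" for y :: "'m \<times> nat \<Rightarrow> real"
  have E: "E y (c b) = y b" if "b \<in> B" for y b using that inj by (simp add: E_def)
  have contE: "continuous_on UNIV E"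
  proof (rule continuous_on_coordinatewise_then_product)
    fix a show "continuous_on UNIV (\<lambda>y. E y a)"
      by (cases "a \<in> c ` B") (simp_all add: E_def continuous_on_coord)
  qed
  have "E (\<Phi> p) = T p"
  proof
    fix a show "E (\<Phi> p) a = T p a"
      by (cases "a \<in> c ` B") (auto simp: E T, simp add: E_def)
  qed
  then have "\<Phi> p \<in> {y \<in> UNIV. E y \<in> X}" using TG(1)[OF U(1)] by simp
  moreover have "open {y \<in> UNIV. E y \<in> X}" by (rule open_preimage[OF open_UNIV U(3) contE])
  moreover have "\<exists>q\<in>W. \<forall>b\<in>B. \<Phi> q b = y b" if "y \<in> {y \<in> UNIV. E y \<in> X}" for y
  proof (intro bexI ballI)
    show "G (E y) \<in> W" using that TG(2) U(2) by blast
    fix b assume "b \<in> B"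
    then show "\<Phi> (G (E y)) b = y b" using T[of b "G (E y)"] TG(3)[of "E y"] that E by simp
  qed
  ultimately show thesis using that by blast
qed

text \<open>A common neighbourhood exists because finitely many equations suffice:
  \<open>\<phi> j (\<Psi> y) = y (j, 0)\<close> and the state equation for \<open>Fx\<close>. On
  \<open>V1\<close> they involve finitely many entries of \<open>y\<close>, so \<open>y\<close> may
  be replaced by an output jet \<open>\<Phi> q\<close> with the same entries, for which they are
  known. Differentiation in time supplies all other components of
  \<open>\<Phi> (\<Psi> y) = y\<close>.\<close>

lemma invertible_neighbourhood:
  assumes p: "p \<in> W"
  obtains V1 where "open V1" "\<Phi> p \<in> V1" "V1 \<subseteq> V" "\<And>y. y \<in> V1 \<Longrightarrow> \<Psi> y \<in> W"
    "\<And>y. y \<in> V1 \<Longrightarrow> \<Phi> (\<Psi> y) = y" "\<And>y c. y \<in> V1 \<Longrightarrow> lie shift (\<lambda>y. \<Psi> y c) y = field_u f c (\<Psi> y)"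
proof -
  have sL: "smooth_on UNIV V (lie shift (Fx i))" for i
    by (rule smooth_on_lie[OF open_V _ smooth_on_shift[OF open_V], of UNIV])
      (use smooth_on_mono[OF Fx] in auto)
  have "\<exists>B. finite B \<and> depends_on B V (\<lambda>y. \<Psi> y c)" for c using smooth_onE[OF smooth_\<Psi>[of c]] by metis
  then obtain B where B: "\<And>c. finite (B c)" "\<And>c. depends_on (B c) V (\<lambda>y. \<Psi> y c)" by metis
  have "\<exists>B. finite B \<and> depends_on B V (lie shift (Fx i))" for i using smooth_onE[OF sL] by metis
  then obtain B' where B': "\<And>i. finite (B' i)" "\<And>i. depends_on (B' i) V (lie shift (Fx i))" by metis
  have "\<exists>C. finite C \<and> depends_on C W (\<phi> j)" for j using smooth_onE[OF smooth_\<phi>[of j]] by metis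
  then obtain C where C: "\<And>j. finite (C j)" "\<And>j. depends_on (C j) W (\<phi> j)" by metis
  \<comment> \<open>\<open>C1\<close> collects the coordinates seen by the outputs and by
    \<open>f\<close>. \<open>B1\<close> then collects the entries of \<open>y\<close> that determine
    \<open>\<Psi> y\<close> on \<open>C1\<close> and the Lie derivatives of \<open>Fx\<close>,
    together with the entries \<open>(j, 0)\<close>.\<close>
  define C1 where "C1 = (\<Union>j. C j) \<union> range St \<union> range (\<lambda>j. In j 0)"
  define B1 where "B1 = \<Union>(B ` C1) \<union> (\<Union>i. B' i) \<union> range (\<lambda>j. (j, 0))"
  have "finite C1" using C(1) by (simp add: C1_def)
  then have "finite B1" using B(1) B'(1) by (simp add: B1_def)
  then obtain Y where Y: "open Y" "\<Phi> p \<in> Y" "\<And>y. y \<in> Y \<Longrightarrow> \<exists>q\<in>W. \<forall>b\<in>B1. \<Phi> q b = y b"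
    using \<Phi>_locally_open[OF p] by metis
  define V1 where "V1 = {y \<in> V \<inter> Y. \<Psi> y \<in> W}"
  have contV: "continuous_on (V \<inter> Y) \<Psi>"
    by (rule continuous_on_subset[OF smooth_on_map_continuous[OF smooth_\<Psi>]]) auto
  have V1: "open V1" unfolding V1_def
    by (rule open_preimage[OF open_Int[OF open_V Y(1)] open_W contV])
  have V1V: "V1 \<subseteq> V" by (auto simp: V1_def)
  have pV1: "\<Phi> p \<in> V1" using p Y(2) jet_V[OF p] \<Psi>_\<Phi>[OF p] by (simp add: V1_def)
  have V1W: "\<Psi> y \<in> W" if "y \<in> V1" for y using that by (simp add: V1_def)
  have key: "\<phi> j (\<Psi> y) = y (j, 0) \<and> lie shift (Fx i) y = field_u f (St i) (\<Psi> y)" if y: "y \<in> V1" for y i j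
  proof -
    obtain q where q: "q \<in> W" "\<And>b. b \<in> B1 \<Longrightarrow> \<Phi> q b = y b" using Y(3)[of y] y by (auto simp: V1_def)
    have yV: "y \<in> V" using y V1V by blast
    have \<Psi>q: "\<Psi> y c = q c" if "c \<in> C1" for c
    proof -
      have "B c \<subseteq> B1" unfolding B1_def using that by blast
      then have "y b = \<Phi> q b" if "b \<in> B c" for b using q(2)[of b] that by auto
      then have "\<Psi> y c = \<Psi> (\<Phi> q) c"
        by (intro B(2)[of c, unfolded depends_on_def, rule_format] yV jet_V[OF q(1)])
      then show ?thesis using \<Psi>_\<Phi>[OF q(1)] by simp
    qed
    have "\<phi> j (\<Psi> y) = \<phi> j q"
    proof -
      have "\<forall>c\<in>C j. \<Psi> y c = q c" using \<Psi>q by (auto simp: C1_def)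
      then show ?thesis using C(2)[of j] V1W[OF y] q(1) unfolding depends_on_def by blast
    qed
    also have "\<dots> = y (j, 0)" using q(2)[of "(j, 0)"] by (simp add: B1_def output_jet_def)
    finally have 1: "\<phi> j (\<Psi> y) = y (j, 0)" .
    have "B' i \<subseteq> B1" unfolding B1_def by blast
    then have "y b = \<Phi> q b" if "b \<in> B' i" for b using q(2)[of b] that by auto
    then have "lie shift (Fx i) y = lie shift (Fx i) (\<Phi> q)"
      by (intro B'(2)[of i, unfolded depends_on_def, rule_format] yV jet_V[OF q(1)])
    also have "\<dots> = lie (field_u f) (\<lambda>q. Fx i (\<Phi> q)) q"
      using tder_\<Phi>[OF smooth_on_mono[OF Fx] q(1), where k = 1] by simp
    also have "\<dots> = lie (field_u f) (\<lambda>q. q (St i)) q"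
      by (rule lie_cong[OF open_W q(1)]) (simp add: x_eq)
    also have "\<dots> = field_u f (St i) q" by (rule lie_coord)
    also have "\<dots> = field_u f (St i) (\<Psi> y)"
    proof -
      have "state_of (\<Psi> y) = state_of q" "input_of (\<Psi> y) = input_of q"
        unfolding state_of_def input_of_def vec_eq_iff using \<Psi>q by (auto simp: C1_def simp del: \<Psi>_simps)
      then show ?thesis by simp
    qed
    finally show ?thesis using 1 by blast
  qed
  \<comment> \<open>The input components satisfy the equation by the construction of
    \<open>\<Psi>\<close>; only the state components need \<open>key\<close>.\<close>
  have lie\<Psi>: "lie shift (\<lambda>y. \<Psi> y c) y = field_u f c (\<Psi> y)" if y: "y \<in> V1" for y c
    using key[OF y] by (cases c) (auto simp: fun_eq_iff)
  have "\<Phi> (\<Psi> y) = y" if y: "y \<in> V1" for y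
  proof
    fix b :: "'m \<times> nat" obtain j k where b: "b = (j, k)" by (cases b)
    have "\<Phi> (\<Psi> y) b = tder (field_u f) k (\<phi> j) (\<Psi> y)" by (simp add: b output_jet_def)
    also have "\<dots> = tder shift k (\<lambda>y. \<phi> j (\<Psi> y)) y"
      by (rule tder_related[OF open_W smooth_\<phi> smooth_field_u V1 smooth_on_mono[OF smooth_\<Psi> subset_UNIV V1V] V1W y lie\<Psi>, symmetric])
    also have "\<dots> = tder shift k (\<lambda>y. y (j, 0)) y"
      by (rule tder_cong[OF V1 y]) (use key in blast)
    also have "\<dots> = y b" by (simp add: tder_shift b)
    finally show "\<Phi> (\<Psi> y) b = y b" .
  qed
  then show thesis using that[OF V1 pV1 V1V V1W _ lie\<Psi>] by blast
qed

end

section \<open>The feedback\<close>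

text \<open>On \<open>U\<close> the coordinates \<open>c i\<close>, certain \<open>\<phi>\<^sup>j\<^sub>[\<^sub>\<beta>\<^sub>]\<close> with \<open>\<beta> < A j\<close>, are exchanged for the states;
  the remaining \<open>\<phi>\<^sup>j\<^sub>[\<^sub>\<beta>\<^sub>]\<close> with \<open>\<beta> < A j\<close> form the controller state \<open>z\<close>.\<close>

locale feedback_chart = flat_chart f \<phi> R W V Fx Fu
  for f :: "real ^ 'n::finite \<Rightarrow> real ^ 'm::finite \<Rightarrow> real ^ 'n"
    and \<phi> :: "'m \<Rightarrow> ('n, 'm) jet \<Rightarrow> real" and R W V Fx Fu +
  fixes A :: "'m \<Rightarrow> nat"
    and U X :: "('m \<times> nat \<Rightarrow> real) set"
    and T G :: "('m \<times> nat \<Rightarrow> real) \<Rightarrow> 'm \<times> nat \<Rightarrow> real"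
    and c :: "'n \<Rightarrow> 'm \<times> nat" and zs :: "nat \<Rightarrow> 'm \<times> nat" and d :: nat
  assumes open_U: "open U" and U_V: "U \<subseteq> V" and open_X: "open X"
    and \<Psi>_W: "\<And>y. y \<in> U \<Longrightarrow> \<Psi> y \<in> W" and \<Phi>_\<Psi>: "\<And>y. y \<in> U \<Longrightarrow> \<Phi> (\<Psi> y) = y"
    and lie_\<Psi>: "\<And>y a. y \<in> U \<Longrightarrow> lie shift (\<lambda>y. \<Psi> y a) y = field_u f a (\<Psi> y)"
    and inj_c: "inj c" and c_A: "range c \<subseteq> {(j, \<beta>). \<beta> < A j}"
    and T_c: "\<And>i y. T y (c i) = Fx i y" and T_other: "\<And>a y. a \<notin> range c \<Longrightarrow> T y a = y a"
    and smooth_T: "\<And>a. smooth_on UNIV U (\<lambda>y. T y a)" and smooth_G: "\<And>a. smooth_on UNIV X (\<lambda>x. G x a)"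
    and T_X: "\<And>y. y \<in> U \<Longrightarrow> T y \<in> X" and G_T: "\<And>y. y \<in> U \<Longrightarrow> G (T y) = y"
    and G_U: "\<And>x. x \<in> X \<Longrightarrow> G x \<in> U" and T_G: "\<And>x. x \<in> X \<Longrightarrow> T (G x) = x"
    and zs: "bij_betw zs {..<d} ({(j, \<beta>). \<beta> < A j} - range c)"
begin

text \<open>The closed-loop coordinate in which the entry \<open>T y b\<close> is stored;
  \<open>arrange\<close> below reads these entries back.\<close>

definition pos :: "'m \<times> nat \<Rightarrow> ('n + nat, 'm) coord" where
  "pos b = (if b \<in> range c then St (Inl (inv c b))
    else if snd b < A (fst b) then St (Inr (inv_into {..<d} zs b))
    else In (fst b) (snd b - A (fst b)))"

lemma zs_range: "k < d \<Longrightarrow> zs k \<notin> range c" "k < d \<Longrightarrow> snd (zs k) < A (fst (zs k))"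
  using bij_betw_apply[OF zs, of k] by auto

lemma high_range: "A j \<le> k \<Longrightarrow> (j, k) \<notin> range c"
  using c_A by force

lemma pos_simps [simp]:
  "pos (c i) = St (Inl i)"
  "k < d \<Longrightarrow> pos (zs k) = St (Inr k)"
  "A j \<le> k \<Longrightarrow> pos (j, k) = In j (k - A j)"
  using zs_range[of k] high_range[of j k] inj_c bij_betw_imp_inj_on[OF zs]
  by (auto simp: pos_def)

lemma index_cases:
  obtains (state) i where "b = c i" | (controller) k where "k < d" "b = zs k"
    | (input) j k where "A j \<le> k" "b = (j, k)"
proof -
  obtain j k where b: "b = (j, k)" by (cases b)
  show thesis
  proof (cases "b \<in> range c")
    case True
    then show ?thesis using state by blast
  next
    case False
    show ?thesis
    proof (cases "k < A j")
      case True
      then have "b \<in> zs ` {..<d}" using False bij_betw_imp_surj_on[OF zs] by (auto simp: b)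
      then show ?thesis using controller by blast
    next
      case False
      then show ?thesis using input[of j k] b by simp
    qed
  qed
qed

lemma pos_cl_coords: "pos b \<in> cl_coords d"
  by (rule index_cases[of b]) (auto simp: cl_coords_def)

definition arrange :: "('n + nat, 'm) jet \<Rightarrow> 'm \<times> nat \<Rightarrow> real" where
  "arrange w = (\<lambda>b. w (pos b))"

lemma smooth_arrange: "open S \<Longrightarrow> smooth_on (cl_coords d) S (\<lambda>w. arrange w b)"
  unfolding arrange_def by (rule smooth_on_coord[OF _ pos_cl_coords])

lemma arrange_cong: "(\<And>a. a \<in> cl_coords d \<Longrightarrow> w a = w' a) \<Longrightarrow> arrange w = arrange w'"
  unfolding arrange_def using pos_cl_coords by blast

definition Wc :: "('n + nat, 'm) jet set" where "Wc = {w. arrange w \<in> X}"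

text \<open>Recovers all output derivatives from a closed-loop point; the feedback and its
  properties are expressed through this map.\<close>

definition Y :: "('n + nat, 'm) jet \<Rightarrow> 'm \<times> nat \<Rightarrow> real" where "Y w = G (arrange w)"

definition fb :: "'m \<Rightarrow> ('n + nat, 'm) jet \<Rightarrow> real" where "fb j w = Fu j (Y w)"

text \<open>A component of \<open>z\<close> is an output derivative, so its time derivative is the
  next output derivative, whether that one is itself in \<open>z\<close>, belongs to
  \<open>v\<close>, or must be recovered from \<open>x\<close> through \<open>G\<close>.\<close>

definition ctrl :: "nat \<Rightarrow> ('n + nat, 'm) jet \<Rightarrow> real" where
  "ctrl k w = shift (zs k) (Y w)"

abbreviation cl :: "('n + nat, 'm) coord \<Rightarrow> ('n + nat, 'm) jet \<Rightarrow> real" where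
  "cl \<equiv> cl_field f d ctrl fb"

lemma open_Wc: "open Wc"
  using open_preimage[OF open_UNIV open_X smooth_on_map_continuous[OF smooth_arrange[OF open_UNIV]]]
  by (simp add: Wc_def)

lemma arrange_X: "w \<in> Wc \<Longrightarrow> arrange w \<in> X" by (simp add: Wc_def)

lemma Y_U: "w \<in> Wc \<Longrightarrow> Y w \<in> U" unfolding Y_def by (intro G_U arrange_X)

lemma Y_V: "w \<in> Wc \<Longrightarrow> Y w \<in> V" using Y_U U_V by blast

lemma T_Y: "w \<in> Wc \<Longrightarrow> T (Y w) = arrange w" unfolding Y_def by (intro T_G arrange_X)

lemma smooth_Y: "smooth_on (cl_coords d) Wc (\<lambda>w. Y w b)"
  unfolding Y_def by (rule smooth_on_comp[OF open_Wc open_X smooth_G smooth_arrange[OF open_Wc] arrange_X])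

lemma smooth_Y_comp: "smooth_on UNIV V h \<Longrightarrow> smooth_on (cl_coords d) Wc (\<lambda>w. h (Y w))"
  by (rule smooth_on_comp[OF open_Wc open_V _ smooth_Y Y_V])

lemma Y_state: "w \<in> Wc \<Longrightarrow> Fx i (Y w) = w (St (Inl i))"
  using T_c[of "Y w" i] T_Y[of w] by (simp add: arrange_def)

lemma Y_controller: "w \<in> Wc \<Longrightarrow> k < d \<Longrightarrow> Y w (zs k) = w (St (Inr k))"
  using T_other[OF zs_range(1), of k "Y w"] T_Y[of w] by (simp add: arrange_def)

lemma Y_input: "w \<in> Wc \<Longrightarrow> A j \<le> k \<Longrightarrow> Y w (j, k) = w (In j (k - A j))"
  using T_other[OF high_range, of j k "Y w"] T_Y[of w] by (simp add: arrange_def)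

lemma cl_state: "w \<in> Wc \<Longrightarrow> cl (St (Inl i)) w = field_u f (St i) (\<Psi> (Y w))"
  by (simp add: state_of_def input_of_def Y_state fb_def)

text \<open>Each kind of coordinate has its own reason: for states, \<open>\<Psi>\<close> relates
  \<open>shift\<close> to \<open>field_u f\<close>; for controller states, \<open>ctrl\<close> was
  chosen to this end; for inputs, both fields raise the order by one.\<close>

lemma lie_arrange:
  assumes w: "w \<in> Wc"
  shows "lie cl (\<lambda>w. arrange w b) w = lie shift (\<lambda>y. T y b) (Y w)"
proof -
  have "lie cl (\<lambda>w. arrange w b) w = cl (pos b) w" unfolding arrange_def by (rule lie_coord)
  also have "\<dots> = lie shift (\<lambda>y. T y b) (Y w)"
  proof (cases rule: index_cases[of b])
    case (state i)
    have "(\<lambda>y. T y (c i)) = (\<lambda>y. \<Psi> y (St i))" by (simp add: T_c)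
    then show ?thesis
      unfolding state by (simp only: pos_simps(1) cl_state[OF w] lie_\<Psi>[OF Y_U[OF w]])
  next
    case (controller k)
    have "(\<lambda>y. T y b) = (\<lambda>y. y b)" using T_other[OF zs_range(1)] controller by simp
    then show ?thesis using controller by (simp add: lie_coord ctrl_def)
  next
    case (input j k)
    have "(\<lambda>y. T y b) = (\<lambda>y. y b)" using T_other[OF high_range] input by simp
    then show ?thesis using input Y_input[OF w, of j "Suc k"] by (simp add: lie_coord Suc_diff_le)
  qed
  finally show ?thesis .
qed

text \<open>The field on \<open>X\<close> is \<open>shift\<close> transported by \<open>T\<close>;
  since \<open>G\<close> inverts \<open>T\<close>, it transports this field back.\<close>

lemma lie_G:
  assumes x: "x \<in> X"
  shows "lie (\<lambda>a x. lie shift (\<lambda>y. T y a) (G x)) (\<lambda>x. G x b) x = shift b (G x)"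
proof -
  let ?b = "\<lambda>a x. lie shift (\<lambda>y. T y a) (G x)"
  have "lie shift (\<lambda>y. G (T y) b) (G x) = lie ?b (\<lambda>x. G x b) (T (G x))"
    by (rule lie_related[OF open_X smooth_G open_U smooth_T T_X G_U[OF x]]) (assumption, simp only: T_G[OF x])
  moreover have "lie shift (\<lambda>y. G (T y) b) (G x) = lie shift (\<lambda>y. y b) (G x)"
    by (rule lie_cong[OF open_U G_U[OF x]]) (simp add: G_T)
  ultimately show ?thesis by (simp add: T_G x lie_coord)
qed

text \<open>The closed-loop field and \<open>shift\<close> are \<open>Y\<close>-related, so time
  derivatives along the closed loop can be computed in the trivial dynamics of the outputs.\<close>

lemma lie_Y:
  assumes w: "w \<in> Wc"
  shows "lie cl (\<lambda>w. Y w b) w = shift b (Y w)"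
proof -
  have "lie cl (\<lambda>w. G (arrange w) b) w = lie (\<lambda>a x. lie shift (\<lambda>y. T y a) (G x)) (\<lambda>x. G x b) (arrange w)"
    by (rule lie_related[OF open_X smooth_G open_Wc smooth_arrange[OF open_Wc] arrange_X w])
      (assumption, rule lie_arrange[OF w, unfolded Y_def])
  then show ?thesis using lie_G[OF arrange_X[OF w]] by (simp add: Y_def)
qed

lemma tder_Y:
  assumes "smooth_on UNIV V h" "w \<in> Wc"
  shows "tder cl k (\<lambda>w. h (Y w)) w = tder shift k h (Y w)"
  by (rule tder_related[OF open_V assms(1) smooth_on_shift[OF open_V] open_Wc smooth_Y Y_V assms(2) lie_Y])

lemma cl_jet_eq:
  assumes w: "w \<in> Wc"
  shows "cl_jet f d ctrl fb w = \<Psi> (Y w)"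
proof
  fix a show "cl_jet f d ctrl fb w a = \<Psi> (Y w) a"
  proof (cases a)
    case (St i)
    then show ?thesis by (simp add: cl_jet_def Y_state[OF w])
  next
    case (In j k)
    have "fb j = (\<lambda>w. Fu j (Y w))" by (simp add: fun_eq_iff fb_def)
    moreover have "tder cl k (\<lambda>w. Fu j (Y w)) w = tder shift k (Fu j) (Y w)"
      by (rule tder_Y[OF _ w]) (use smooth_on_mono[OF Fu] in auto)
    ultimately have "tder cl k (fb j) w = tder shift k (Fu j) (Y w)" by (simp only:)
    then show ?thesis using In by (simp add: cl_jet_def)
  qed
qed

lemma smooth_fb: "smooth_on (cl_coords d) Wc (fb j)"
  unfolding fb_def by (rule smooth_Y_comp) (use smooth_on_mono[OF Fu] in auto)

lemma smooth_ctrl: "smooth_on (cl_coords d) Wc (ctrl k)"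
  unfolding ctrl_def by (rule smooth_Y_comp[OF smooth_on_shift[OF open_V]])

lemma smooth_cl: "smooth_on UNIV Wc (cl a)"
proof (cases a)
  case (In j k)
  then show ?thesis using smooth_on_coord[OF open_Wc, of "In j (Suc k)" UNIV]
    by (subst smooth_on_cong[OF open_Wc, where g = "\<lambda>w. w (In j (Suc k))"]) auto
next
  case (St s)
  show ?thesis
  proof (cases s)
    case (Inl i)
    have "smooth_on UNIV Wc (\<lambda>w. field_u f (St i) (\<Psi> (Y w)))"
      by (rule smooth_on_comp[OF open_Wc open_W smooth_field_u _ \<Psi>_W[OF Y_U]])
        (use smooth_on_mono[OF smooth_Y_comp[OF smooth_\<Psi>]] in auto)
    then have "smooth_on UNIV Wc (cl (St (Inl i)))"
      by (rule iffD2[OF smooth_on_cong[OF open_Wc, of "cl (St (Inl i))"], rotated]) (rule cl_state)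
    then show ?thesis using St Inl by simp
  next
    case (Inr k)
    have "smooth_on UNIV Wc (\<lambda>w. if k < d then ctrl k w else 0)"
      using smooth_on_mono[OF smooth_ctrl] smooth_on_const[OF open_Wc] by (cases "k < d") auto
    then show ?thesis using St Inr
      by (subst smooth_on_cong[OF open_Wc, where g = "\<lambda>w. if k < d then ctrl k w else 0"]) auto
  qed
qed

lemma feedback: "feedback_on d Wc ctrl fb"
  unfolding feedback_on_def
proof (intro conjI ballI allI impI)
  fix w w' assume "w \<in> Wc" "\<forall>a\<in>cl_coords d. w' a = w a"
  then show "w' \<in> Wc" using arrange_cong[of w' w] by (simp add: Wc_def)
qed (rule open_Wc smooth_ctrl smooth_fb)+

text \<open>These are exactly the jets that the closed loop reaches: \<open>\<Psi>\<close> maps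
  \<open>U\<close> into this set, and \<open>cl_jet_surj\<close> gives a closed-loop point for each
  of its elements.\<close>

definition N :: "('n, 'm) jet set" where "N = {q \<in> W. \<Phi> q \<in> U}"

lemma open_N: "open N"
  unfolding N_def by (rule open_preimage[OF open_W open_U smooth_on_map_continuous[OF smooth_\<Phi>]])

lemma N_W: "N \<subseteq> W" by (auto simp: N_def)

lemma \<Psi>_N: "y \<in> U \<Longrightarrow> \<Psi> y \<in> N" by (simp add: N_def \<Psi>_W \<Phi>_\<Psi>)

lemma smooth_\<Phi>_N: "smooth_on UNIV N (\<lambda>q. \<Phi> q b)"
  by (rule smooth_on_mono[OF smooth_\<Phi> _ N_W]) simp

lemma endogenous:
  assumes "W \<subseteq> D"
  shows "endogenous_feedback f D d Wc ctrl fb"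
  unfolding endogenous_feedback_def
proof (intro conjI exI)
  show "feedback_on d Wc ctrl fb" by (rule feedback)
  show "open N" by (rule open_N)
  show "N \<subseteq> D" using N_W assms by blast
  show "cl_jet f d ctrl fb ` Wc \<subseteq> N" using cl_jet_eq \<Psi>_N Y_U by auto
  show "\<forall>k<d. smooth_on UNIV N ((\<lambda>k q. \<Phi> q (zs k)) k)" by (simp add: smooth_\<Phi>_N)
  show "\<forall>j. smooth_on UNIV N ((\<lambda>j q. \<Phi> q (j, A j)) j)" by (simp add: smooth_\<Phi>_N)
  show "\<forall>w\<in>Wc. (\<forall>k<d. w (St (Inr k)) = (\<lambda>k q. \<Phi> q (zs k)) k (cl_jet f d ctrl fb w)) \<and>
      (\<forall>j. w (In j 0) = (\<lambda>j q. \<Phi> q (j, A j)) j (cl_jet f d ctrl fb w))"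
    by (simp add: cl_jet_eq \<Phi>_\<Psi> Y_U Y_controller Y_input)
qed

lemma cl_jet_surj:
  assumes "p \<in> N"
  shows "\<exists>w\<in>Wc. cl_jet f d ctrl fb w = p"
proof -
  define x where "x = T (\<Phi> p)"
  \<comment> \<open>\<open>w\<close> undoes \<open>arrange\<close>. The entries
    \<open>St (Inr k)\<close> with \<open>k \<ge> d\<close> are arbitrary, as \<open>arrange\<close>
    reads coordinates in \<open>cl_coords d\<close> only.\<close>
  define w :: "('n + nat, 'm) jet" where "w a = (case a of
      St s \<Rightarrow> (case s of Inl i \<Rightarrow> x (c i) | Inr k \<Rightarrow> x (zs k)) | In j k \<Rightarrow> x (j, A j + k))" for a
  have p: "p \<in> W" "\<Phi> p \<in> U" using assms by (auto simp: N_def)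
  have "arrange w = x"
  proof
    fix b show "arrange w b = x b"
      by (rule index_cases[of b]) (simp_all add: arrange_def w_def)
  qed
  then have "w \<in> Wc" "Y w = \<Phi> p" using p by (simp_all add: Wc_def Y_def x_def T_X G_T)
  then show ?thesis using cl_jet_eq[of w] \<Psi>_\<Phi>[OF p(1)] by (intro bexI[of _ w]) simp_all
qed

text \<open>Along a trajectory the produced jet is \<open>\<Psi> (Y (\<gamma> s))\<close>, so the
  output is the entry \<open>(j, 0)\<close> of \<open>Y\<close>. Differentiating \<open>A j\<close>
  times moves to the entry \<open>(j, A j)\<close>, which is stored as the input.\<close>

lemma io: "io_behavior f \<phi> A d Wc ctrl fb"
  unfolding io_behavior_def
proof (intro allI impI ballI)
  fix t0 t1 \<gamma> j t
  assume \<gamma>: "integral_curve cl Wc t0 t1 \<gamma>" and t: "t \<in> {t0<..<t1}"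
  have \<gamma>W: "\<gamma> s \<in> Wc" if "s \<in> {t0<..<t1}" for s using \<gamma> that unfolding integral_curve_def by blast
  have jet: "traj_jet fb \<gamma> s = \<Psi> (Y (\<gamma> s))" if s: "s \<in> {t0<..<t1}" for s
  proof -
    have "traj_jet fb \<gamma> s = cl_jet f d ctrl fb (\<gamma> s)"
      unfolding traj_jet_def cl_jet_def
      using deriv_integral_curve[OF open_Wc smooth_on_mono[OF smooth_fb] smooth_cl \<gamma> s]
      by (auto split: coord.splits)
    then show ?thesis using cl_jet_eq[OF \<gamma>W[OF s]] by simp
  qed
  have \<phi>: "\<phi> j (traj_jet fb \<gamma> s) = Y (\<gamma> s) (j, 0)" if s: "s \<in> {t0<..<t1}" for s
    using fun_cong[OF \<Phi>_\<Psi>[OF Y_U[OF \<gamma>W[OF s]]], of "(j, 0)"] jet[OF s] by (simp add: output_jet_def)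
  have "(deriv ^^ A j) (\<lambda>s. \<phi> j (traj_jet fb \<gamma> s)) t = (deriv ^^ A j) (\<lambda>s. Y (\<gamma> s) (j, 0)) t"
    by (rule deriv_funpow_cong[OF t \<phi>])
  also have "\<dots> = tder cl (A j) (\<lambda>w. Y w (j, 0)) (\<gamma> t)"
    by (rule deriv_integral_curve[OF open_Wc smooth_on_mono[OF smooth_Y] smooth_cl \<gamma> t]) auto
  also have "\<dots> = tder shift (A j) (\<lambda>y. y (j, 0)) (Y (\<gamma> t))"
    by (rule tder_Y[OF smooth_on_coord[OF open_V] \<gamma>W[OF t]]) simp
  also have "\<dots> = \<gamma> t (In j 0)" using Y_input[OF \<gamma>W[OF t], of j "A j"] by (simp add: tder_shift)
  finally show "(deriv ^^ A j) (\<lambda>s. \<phi> j (traj_jet fb \<gamma> s)) t = \<gamma> t (In j 0)" .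
qed

end

section \<open>Quasi-static feedback when the controller state is empty\<close>

text \<open>Differentiating \<open>\<Theta> (\<Lambda> w) = w\<close> at
  \<open>w = \<Theta> p\<close> gives a right inverse of the differential of
  \<open>\<Theta>\<close>, so the coefficients of a relation vanish at each point
  separately.\<close>

lemma diff_independent_left_inverse:
  assumes open_N: "open N" and W': "open W'"
    and \<Theta>: "\<And>c. smooth_on UNIV N (\<lambda>q. \<Theta> q c)" and \<Lambda>: "\<And>c. smooth_on UNIV W' (\<lambda>w. \<Lambda> w c)"
    and \<Theta>W: "\<And>q. q \<in> N \<Longrightarrow> \<Theta> q \<in> W' \<and> \<Lambda> (\<Theta> q) = q"
    and \<Lambda>N: "\<And>w. w \<in> W' \<Longrightarrow> \<Lambda> w \<in> N \<and> \<Theta> (\<Lambda> w) = w"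
  shows "diff_independent N (\<lambda>c q. \<Theta> q c) UNIV"
  unfolding diff_independent_def
proof (intro allI impI ballI)
  fix F a k p
  assume "finite F \<and> F \<subseteq> UNIV \<and> (\<forall>k\<in>F. smooth_on UNIV N (a k)) \<and>
    (\<forall>p\<in>N. \<forall>\<xi>. (\<Sum>k\<in>F. a k p * pd \<xi> (\<lambda>q. \<Theta> q k) p) = 0)" and k: "k \<in> F" and p: "p \<in> N"
  then have F: "finite F" and rel: "\<And>\<xi>. (\<Sum>k\<in>F. a k p * pd \<xi> (\<lambda>q. \<Theta> q k) p) = 0" by auto
  define w where "w = \<Theta> p"
  have w: "w \<in> W'" "\<Lambda> w = p" using \<Theta>W[OF p] by (auto simp: w_def)
  have "\<exists>C. finite C \<and> depends_on C N (\<lambda>q. \<Theta> q c)" for c using smooth_onE[OF \<Theta>[of c]] by metis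
  then obtain C' where C': "\<And>c. finite (C' c)" "\<And>c. depends_on (C' c) N (\<lambda>q. \<Theta> q c)" by metis
  define C where "C = \<Union>(C' ` F)"
  have C: "finite C" using C'(1) F by (simp add: C_def)
  have dep: "depends_on C N (\<lambda>q. \<Theta> q c)" if "c \<in> F" for c
    by (rule depends_on_mono[OF C'(2)]) (use that in \<open>auto simp: C_def\<close>)
  have delta: "(\<Sum>\<xi>\<in>C. pd \<xi> (\<lambda>q. \<Theta> q c) p * pd k (\<lambda>w. \<Lambda> w \<xi>) w) = (if c = k then 1 else 0)"
    if "c \<in> F" for c
  proof -
    have "pd k (\<lambda>w. \<Theta> (\<Lambda> w) c) w = (\<Sum>\<xi>\<in>C. pd \<xi> (\<lambda>q. \<Theta> q c) (\<Lambda> w) * pd k (\<lambda>w. \<Lambda> w \<xi>) w)"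
      by (rule pd_comp[OF open_N \<Theta> C dep[OF that] \<Lambda> _ w(1)]) (use \<Lambda>N in blast)
    moreover have "pd k (\<lambda>w. \<Theta> (\<Lambda> w) c) w = pd k (\<lambda>w. w c) w"
      by (rule pd_cong[OF W' w(1)]) (use \<Lambda>N in simp)
    ultimately show ?thesis by (simp add: pd_coord w(2))
  qed
  have "0 = (\<Sum>\<xi>\<in>C. (\<Sum>c\<in>F. a c p * pd \<xi> (\<lambda>q. \<Theta> q c) p) * pd k (\<lambda>w. \<Lambda> w \<xi>) w)"
    using rel by simp
  also have "\<dots> = (\<Sum>c\<in>F. a c p * (\<Sum>\<xi>\<in>C. pd \<xi> (\<lambda>q. \<Theta> q c) p * pd k (\<lambda>w. \<Lambda> w \<xi>) w))"
    by (simp only: sum_distrib_left sum_distrib_right, subst sum.swap) (simp add: mult_ac)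
  also have "\<dots> = (\<Sum>c\<in>F. if c = k then a k p else 0)"
    using delta by (intro sum.cong) auto
  also have "\<dots> = a k p" using k F by (simp add: sum.delta)
  finally show "a k p = 0" by simp
qed

lemma smooth_empty_z: "open S \<Longrightarrow> smooth_on UNIV S (\<lambda>w. empty_z w a)"
proof (cases a)
  case (St s)
  assume "open S"
  then show ?thesis unfolding St
    by (cases s) (simp_all add: empty_z_def smooth_on_coord smooth_on_const)
qed (simp add: empty_z_def smooth_on_coord)

context feedback_chart
begin

text \<open>With \<open>d = 0\<close>, \<open>empty_z\<close> relates \<open>qs_field\<close> to the
  closed-loop field, so the map to \<open>(x, u, ...)\<close> is \<open>\<Psi>\<close> after
  \<open>Y\<close> after \<open>empty_z\<close>. The inverse takes the outputs of order
  \<open>A\<close> as \<open>v\<close>. That both compositions are identities rests on the mutually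
  inverse pairs \<open>\<Psi>\<close>, \<open>\<Phi>\<close> and \<open>T\<close>,
  \<open>G\<close>.\<close>

lemma quasi_static:
  assumes d: "d = 0" and WD: "W \<subseteq> D" and p: "p \<in> N"
  shows "quasi_static_feedback f D p (empty_z -` Wc) (\<lambda>j w. fb j (empty_z w))"
proof -
  let ?S = "empty_z -` Wc" and ?\<alpha> = "\<lambda>j w. fb j (empty_z w)" and ?\<beta> = "\<lambda>j q. \<Phi> q (j, A j)"
  let ?\<Lambda> = "state_input_map (qs_field f ?\<alpha>) ?\<alpha>" and ?\<Theta> = "state_input_map (field_u f) ?\<beta>"
  have S: "open ?S"
    using open_preimage[OF open_UNIV open_Wc smooth_on_map_continuous[OF smooth_empty_z[OF open_UNIV]]]
    by (simp add: vimage_def)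
  have SW: "empty_z w \<in> Wc" if "w \<in> ?S" for w :: "('n, 'm) jet" using that by simp
  have lie_empty_z: "lie (qs_field f ?\<alpha>) (\<lambda>w. empty_z w a) w = cl a (empty_z w)" for a w
  proof (cases a)
    case (St s)
    then show ?thesis
      by (cases s) (simp_all add: empty_z_def lie_coord lie_const d state_of_def)
  qed (simp add: empty_z_def lie_coord)
  have \<Lambda>: "?\<Lambda> w = \<Psi> (Y (empty_z w))" if w: "w \<in> ?S" for w
  proof -
    have "tder (qs_field f ?\<alpha>) k (?\<alpha> j) w = tder cl k (fb j) (empty_z w)" for j k
      by (rule tder_related[OF open_Wc smooth_on_mono[OF smooth_fb] smooth_cl S smooth_empty_z[OF S] SW w lie_empty_z]) auto
    then have "?\<Lambda> w = cl_jet f d ctrl fb (empty_z w)"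
      by (auto simp: state_input_map_def cl_jet_def empty_z_def split: coord.split)
    then show ?thesis using cl_jet_eq[OF SW[OF w]] by simp
  qed
  have \<Theta>: "?\<Theta> q (St i) = q (St i)" "?\<Theta> q (In j k) = \<Phi> q (j, A j + k)" for q i j k
    by (simp_all add: state_input_map_def output_jet_def funpow_add[symmetric] add.commute
        flip: comp_apply[of "_ ^^ _" "_ ^^ _"])
  have arrange\<Theta>: "arrange (empty_z (?\<Theta> q)) = T (\<Phi> q)" if "q \<in> N" for q
  proof
    fix b show "arrange (empty_z (?\<Theta> q)) b = T (\<Phi> q) b"
    proof (cases rule: index_cases[of b])
      case (state i)
      then show ?thesis using x_eq[of q i] that by (simp add: arrange_def empty_z_def \<Theta> T_c N_def)
    next
      case (input j k)
      then show ?thesis using T_other[OF high_range, of j k] by (simp add: arrange_def empty_z_def \<Theta>)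
    qed (simp add: d)
  qed
  have \<Theta>S: "?\<Theta> q \<in> ?S \<and> ?\<Lambda> (?\<Theta> q) = q" if q: "q \<in> N" for q
  proof -
    have "q \<in> W" "\<Phi> q \<in> U" using q by (auto simp: N_def)
    then have "?\<Theta> q \<in> ?S" "Y (empty_z (?\<Theta> q)) = \<Phi> q"
      by (simp_all add: Wc_def Y_def arrange\<Theta>[OF q] T_X G_T)
    then show ?thesis using \<Lambda> \<Psi>_\<Phi>[OF \<open>q \<in> W\<close>] by simp
  qed
  have \<Lambda>N: "?\<Lambda> w \<in> N \<and> ?\<Theta> (?\<Lambda> w) = w" if w: "w \<in> ?S" for w
  proof
    note Wc = SW[OF w]
    show "?\<Lambda> w \<in> N" using \<Lambda>[OF w] \<Psi>_N Y_U[OF Wc] by simp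
    show "?\<Theta> (?\<Lambda> w) = w"
    proof
      fix a show "?\<Theta> (?\<Lambda> w) a = w a"
      proof (cases a)
        case (St i)
        show ?thesis unfolding \<Lambda>[OF w] St \<Theta> \<Psi>_simps Y_state[OF Wc] by (simp add: empty_z_def)
      next
        case (In j k)
        show ?thesis unfolding \<Lambda>[OF w] In \<Theta> \<Phi>_\<Psi>[OF Y_U[OF Wc]] Y_input[OF Wc le_add1]
          by (simp add: empty_z_def)
      qed
    qed
  qed
  have smooth\<Theta>: "smooth_on UNIV N (\<lambda>q. ?\<Theta> q a)" for a
    using smooth_\<Phi>_N smooth_on_coord[OF open_N] by (cases a) (auto simp: \<Theta>)
  have smooth\<Lambda>: "smooth_on UNIV ?S (\<lambda>w. ?\<Lambda> w a)" for a
  proof -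
    have "smooth_on UNIV ?S (\<lambda>w. \<Psi> (Y (empty_z w)) a)"
      by (rule smooth_on_comp[OF S open_Wc smooth_Y_comp[OF smooth_\<Psi>] smooth_empty_z[OF S] SW])
    then show ?thesis using smooth_on_cong[OF S, of "\<lambda>w. ?\<Lambda> w a" "\<lambda>w. \<Psi> (Y (empty_z w)) a"] \<Lambda> by simp
  qed
  have smooth\<alpha>: "smooth_on UNIV ?S (?\<alpha> j)" for j
    by (rule smooth_on_comp[OF S open_Wc smooth_fb smooth_empty_z[OF S] SW])
  have "diff_independent N (\<lambda>a q. ?\<Theta> q a) UNIV"
    by (rule diff_independent_left_inverse[OF open_N S smooth\<Theta> smooth\<Lambda> \<Theta>S \<Lambda>N])
  then show ?thesis
    unfolding quasi_static_feedback_def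
    by (intro conjI allI exI[of _ N] exI[of _ ?\<beta>])
      (use S smooth\<alpha> open_N p N_W WD smooth_\<Phi>_N \<Lambda>N \<Theta>S in blast)+
qed

end

section \<open>Assembly of the local data at a point\<close>

lemma finite_indices: "finite {(j :: 'm::finite, \<beta>). \<beta> < (R j :: nat)}"
proof -
  have "{(j, \<beta>). \<beta> < R j} = Sigma UNIV (\<lambda>j. {..<R j})" by auto
  then show ?thesis by simp
qed

theorem theorem3p1:
  fixes f :: "real ^ 'n::finite \<Rightarrow> real ^ 'm::finite \<Rightarrow> real ^ 'n"
    and \<phi> :: "'m \<Rightarrow> ('n, 'm) jet \<Rightarrow> real"
    and R A :: "'m \<Rightarrow> nat"
    and D :: "('n, 'm) jet set"
    and p :: "('n, 'm) jet"
  assumes "open D"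
    and "smooth_system f D"
    and "flat_output f D \<phi>"
    and "minimal_index f D \<phi> R"
    and "A \<le> R"
    and "diff_independent D (state_output f \<phi>) (state_output_indices A R)"
    and "locally_constant_rank D (state_output f \<phi>) (state_output_indices A R)"
    and "p \<in> D"
  shows "\<exists>d W g \<alpha>.
      CARD('n) + d = (\<Sum>j\<in>UNIV. A j) \<and>
      endogenous_feedback f D d W g \<alpha> \<and>
      (\<exists>w\<in>W. cl_jet f d g \<alpha> w = p) \<and>
      io_behavior f \<phi> A d W g \<alpha> \<and>
      ((\<Sum>j\<in>UNIV. A j) = CARD('n) \<longrightarrow>
        quasi_static_feedback f D p (empty_z -` W) (\<lambda>j w. \<alpha> j (empty_z w)))"
proof -
  have sm\<phi>: "smooth_on UNIV D (\<phi> j)" for j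
    using assms(3) smooth_on_mono unfolding flat_output_def by blast
  have "flat_parametrization f D \<phi> R" using assms(4) unfolding minimal_index_def by blast
  from bspec[OF this[unfolded flat_parametrization_def] assms(8)]
  obtain W V Fx Fu where W: "open W" "p \<in> W" "W \<subseteq> D" "open V" "output_jet f \<phi> ` W \<subseteq> V"
    "\<forall>i. smooth_on {(j, \<beta>). \<beta> < R j} V (Fx i)" "\<forall>j. smooth_on {(j, \<beta>). \<beta> \<le> R j} V (Fu j)"
    "\<forall>q\<in>W. (\<forall>i. q (St i) = Fx i (output_jet f \<phi> q)) \<and> (\<forall>j. q (In j 0) = Fu j (output_jet f \<phi> q))"
    by (elim exE conjE) (rule that; assumption)
  interpret flat_chart f \<phi> R W V Fx Fu
  proof
    show "smooth_system f W"
      using assms(2) W(3) smooth_on_mono unfolding smooth_system_def by blast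
    show "smooth_on UNIV W (\<phi> j)" for j using sm\<phi> W(3) smooth_on_mono by blast
  qed (use W in auto)
  let ?so = "state_output f \<phi>" and ?K = "state_output_indices A R :: ('n + 'm \<times> nat) set"
  let ?A = "{(j, \<beta>). \<beta> < A j}" and ?R = "{(j, \<beta>). \<beta> < R j}" and ?AR = "{(j, \<beta>). A j \<le> \<beta> \<and> \<beta> < R j}"
  have finAR: "finite ?AR" by (rule finite_subset[OF _ finite_indices[of R]]) auto
  have so: "?so (Inl i) = (\<lambda>q. q (St i))" "?so (Inr b) = (\<lambda>q. \<Phi> q b)" for i b
    by (simp add: fun_eq_iff) (cases b, simp add: fun_eq_iff output_jet_def)
  have smD: "smooth_on UNIV D (?so k)" for k
  proof (cases k)
    case (Inl i)
    then show ?thesis by (simp add: so smooth_on_coord assms(1))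
  next
    case (Inr b)
    then show ?thesis
      by (cases b) (simp add: so \<Phi>_tder smooth_on_tder smooth_on_field_u sm\<phi> assms(1,2))
  qed
  have finK: "finite ?K" using finAR by (simp add: state_output_indices_def)
  have ind: "lin_independent (\<lambda>k x. pd x (?so k) p) ?K"
    by (rule diff_independent_pointwise[OF assms(1) finK smD assms(6-8)])
  \<comment> \<open>If a combination of the differentials of the \<open>Fx i\<close> has no
    component in the variables of order below \<open>A\<close>, then the parametrization turns the
    same combination of the \<open>dx^i\<close> into one of output differentials of orders
    \<open>A\<close> to \<open>R - 1\<close>. Independence of these together with \<open>dx\<close>
    forces \<open>a\<close> to vanish.\<close>
  have indA: "\<forall>i\<in>UNIV. a i = 0" if a: "\<forall>b\<in>?A. (\<Sum>i\<in>UNIV. a i * pd b (Fx i) (\<Phi> p)) = 0" for a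
  proof -
    define e where "e b = (\<Sum>i\<in>UNIV. a i * pd b (Fx i) (\<Phi> p))" for b
    have St: "pd x (?so (Inl i)) p = (\<Sum>b\<in>?R. pd b (Fx i) (\<Phi> p) * pd x (\<lambda>q. \<Phi> q b) p)" for x i
    proof -
      obtain C where C: "C \<subseteq> ?R" "depends_on C V (Fx i)" using smooth_onE[OF Fx[of i]] by metis
      have "depends_on ?R V (\<lambda>y. \<Psi> y (St i))" using depends_on_mono[OF C(2,1)] by simp
      from pd_\<Psi>_\<Phi>[OF W(2) finite_indices this, of x] show ?thesis by (simp add: so pd_coord)
    qed
    have sum: "(\<Sum>i\<in>UNIV. a i * pd x (?so (Inl i)) p) = (\<Sum>b\<in>?AR. e b * pd x (\<lambda>q. \<Phi> q b) p)" for x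
    proof -
      have "(\<Sum>i\<in>UNIV. a i * pd x (?so (Inl i)) p) = (\<Sum>b\<in>?R. e b * pd x (\<lambda>q. \<Phi> q b) p)"
        unfolding St e_def
        by (simp only: sum_distrib_left sum_distrib_right, subst sum.swap) (simp add: mult_ac)
      also have "\<dots> = (\<Sum>b\<in>?AR. e b * pd x (\<lambda>q. \<Phi> q b) p)"
      proof (rule sum.mono_neutral_right[OF finite_indices])
        show "\<forall>b\<in>?R - ?AR. e b * pd x (\<lambda>q. \<Phi> q b) p = 0"
        proof
          fix b assume "b \<in> ?R - ?AR"
          then have "b \<in> ?A" by auto
          then have "e b = 0" unfolding e_def by (rule bspec[OF a])
          then show "e b * pd x (\<lambda>q. \<Phi> q b) p = 0" by simp
        qed
      qed auto
      finally show ?thesis .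
    qed
    \<comment> \<open>The coefficients \<open>a\<close> on the states and \<open>- e\<close> on the
      outputs form a relation of the kind that \<open>ind\<close> excludes.\<close>
    let ?a = "\<lambda>k. case k of Inl i \<Rightarrow> a i | Inr b \<Rightarrow> - e b"
    have "(\<Sum>k\<in>?K. ?a k * pd x (?so k) p) = 0" for x
    proof -
      have "(\<Sum>k\<in>?K. ?a k * pd x (?so k) p) =
          (\<Sum>k\<in>range Inl. ?a k * pd x (?so k) p) + (\<Sum>k\<in>Inr ` ?AR. ?a k * pd x (?so k) p)"
        unfolding state_output_indices_def by (rule sum.union_disjoint) (use finAR in auto)
      also have "\<dots> = (\<Sum>i\<in>UNIV. a i * pd x (?so (Inl i)) p) + (\<Sum>b\<in>?AR. - e b * pd x (?so (Inr b)) p)"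
        by (simp add: sum.reindex inj_on_def)
      also have "\<dots> = 0" unfolding sum so(2) by (simp add: sum_negf)
      finally show ?thesis .
    qed
    then have "\<forall>k\<in>?K. ?a k = 0" using ind unfolding lin_independent_def by blast
    then have "?a (Inl i) = 0" for i unfolding state_output_indices_def by blast
    then show ?thesis by simp
  qed
  obtain V1 where V1: "open V1" "\<Phi> p \<in> V1" "V1 \<subseteq> V" "\<And>y. y \<in> V1 \<Longrightarrow> \<Psi> y \<in> W"
    "\<And>y. y \<in> V1 \<Longrightarrow> \<Phi> (\<Psi> y) = y" "\<And>y a. y \<in> V1 \<Longrightarrow> lie shift (\<lambda>y. \<Psi> y a) y = field_u f a (\<Psi> y)"
    using invertible_neighbourhood[OF W(2)] by metis
  \<comment> \<open>The admissible columns are the orders below \<open>A\<close>, so the states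
    displace none of the entries that are to become \<open>v\<close> and its derivatives.\<close>
  have "\<exists>(c :: 'n \<Rightarrow> 'm \<times> nat) T G U X. inj_on c UNIV \<and> c ` UNIV \<subseteq> ?A \<and> open U \<and> \<Phi> p \<in> U \<and> U \<subseteq> V1 \<and> open X \<and>
    (\<forall>i\<in>UNIV. \<forall>y. T y (c i) = Fx i y) \<and> (\<forall>a y. a \<notin> c ` UNIV \<longrightarrow> T y a = y a) \<and>
    (\<forall>a. smooth_on UNIV U (\<lambda>y. T y a)) \<and> (\<forall>a. smooth_on UNIV X (\<lambda>x. G x a)) \<and>
    (\<forall>y\<in>U. T y \<in> X \<and> G (T y) = y) \<and> (\<forall>x\<in>X. G x \<in> U \<and> T (G x) = x)"
    by (rule exchange_coordinates[OF V1(1,2) finite_class.finite_UNIV smooth_on_mono[OF Fx subset_UNIV V1(3)] indA])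
  then obtain c :: "'n \<Rightarrow> 'm \<times> nat" and T G U X where c: "inj c" "range c \<subseteq> ?A"
    and U: "open U" "\<Phi> p \<in> U" "U \<subseteq> V1" "open X"
    and T: "\<forall>i y. T y (c i) = Fx i y" "\<forall>a y. a \<notin> range c \<longrightarrow> T y a = y a"
      "\<forall>a. smooth_on UNIV U (\<lambda>y. T y a)" "\<forall>a. smooth_on UNIV X (\<lambda>x. G x a)"
      "\<forall>y\<in>U. T y \<in> X \<and> G (T y) = y" "\<forall>x\<in>X. G x \<in> U \<and> T (G x) = x"
    by (elim exE conjE) (rule that; (assumption | simp))
  define d where "d = card (?A - range c)"
  obtain zs where zs: "bij_betw zs {..<d} (?A - range c)"
    using ex_bij_betw_nat_finite[of "?A - range c"] finite_indices[of A]
    unfolding d_def by (auto simp: lessThan_atLeast0)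
  interpret feedback_chart f \<phi> R W V Fx Fu A U X T G c zs d
  proof
    show "\<Psi> y \<in> W" "\<Phi> (\<Psi> y) = y" "lie shift (\<lambda>y. \<Psi> y a) y = field_u f a (\<Psi> y)" if "y \<in> U" for y a
      using that U(3) V1(4-6) by blast+
    show "U \<subseteq> V" using U(3) V1(3) by blast
  qed (use c U T zs in auto)
  have cardA: "card ?A = (\<Sum>j\<in>UNIV. A j)"
  proof -
    have "?A = Sigma UNIV (\<lambda>j. {..<A j})" by auto
    then show ?thesis by simp
  qed
  have card: "CARD('n) + d = (\<Sum>j\<in>UNIV. A j)"
  proof -
    have "card (range c) \<le> card ?A" by (rule card_mono[OF finite_indices c(2)])
    moreover have "d = card ?A - card (range c)"
      unfolding d_def by (rule card_Diff_subset[OF _ c(2)]) simp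
    ultimately show ?thesis using card_image[OF c(1)] cardA by simp
  qed
  have p: "p \<in> N" using W(2) U(2) by (simp add: N_def)
  show ?thesis
  proof (intro exI conjI impI)
    show "CARD('n) + d = (\<Sum>j\<in>UNIV. A j)" by (rule card)
    show "endogenous_feedback f D d Wc ctrl fb" by (rule endogenous[OF W(3)])
    show "\<exists>w\<in>Wc. cl_jet f d ctrl fb w = p" by (rule cl_jet_surj[OF p])
    show "io_behavior f \<phi> A d Wc ctrl fb" by (rule io)
    assume "(\<Sum>j\<in>UNIV. A j) = CARD('n)"
    then have "d = 0" using card by simp
    then show "quasi_static_feedback f D p (empty_z -` Wc) (\<lambda>j w. fb j (empty_z w))"
      by (rule quasi_static[OF _ W(3) p])
  qed
qed

end
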